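(* Let $h$ be sufficiently small and let $T$ be an interface element, in either the curve or the line variant. Then for every vector $(v_i)_{i\in\mathcal I}\in\mathbb R^{N}$ there exists a unique IFE function $\phi_T$ on $T$ (i.e. satisfying (J1) and (J2)) such that $$\frac1{|b_i|}\int_{b_i}\phi_T\,ds=v_i,\qquad i\in\mathcal I.$$ Moreover, labelling the sides (interchanging $+$ and $-$, together with $\beta^\pm$, if necessary) so that $|\overline{\mathcal I^-}|\le|\overline{\mathcal I^+}|$, this function has the form $$\phi_T^+=\sum_{i\in\overline{\mathcal I^-}}c_i\psi_{i,T}+\sum_{i\in\mathcal I^+}v_i\psi_{i,T},\qquad \phi_T^-=\phi_T^++c_0L,\quad L(X)=\bar{\mathbf n}\cdot(X-D),$$ where $\mathbf c=(c_i)_{i\in\overline{\mathcal I^-}}$ is given by $$\mathbf c=\mathbf b-k\frac{(\boldsymbol\gamma^T\mathbf b)\,\boldsymbol\delta}{1+k\,\boldsymbol\gamma^T\boldsymbol\delta},$$ and $c_0=k\big(\sum_{i\in\overline{\mathcal I^-}}c_i\nabla\psi_{i,T}(F)\cdot\mathbf v(F)+\sum_{i\in\mathcal I^+}v_i\nabla\psi_{i,T}(F)\cdot\mathbf v(F)\big)$. Here $k=(\frac1\rho-1)\frac{1}{\bar{\mathbf n}\cdot\mathbf v(F)}$, $\boldsymbol\gamma=(\nabla\psi_{i,T}(F)\cdot\mathbf v(F))_{i\in\overline{\mathcal I^-}}$, $\boldsymbol\delta=(\frac1{|b_i|}\int_{b_i\cap T^-}L\,ds)_{i\in\overline{\mathcal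 I^-}}$, and $\mathbf b=\big(v_i-\frac{k}{|b_i|}\int_{b_i\cap T^-}L\,ds\sum_{j\in\mathcal I^+}\nabla\psi_{j,T}(F)\cdot\mathbf v(F)\,v_j\big)_{i\in\overline{\mathcal I^-}}$; in particular $1+k\boldsymbol\gamma^T\boldsymbol\delta\neq0$.
   Context: Standard setting. $\Omega\subset\mathbb R^2$ is a bounded domain that is a finite union of rectangles, separated by a curve $\Gamma$ into open subdomains $\Omega^+,\Omega^-$ with $\overline\Omega=\overline{\Omega^+}\cup\overline{\Omega^-}\cup\Gamma$; $\beta^\pm>0$ are constants and $\rho=\beta^-/\beta^+$. $\mathcal T_h$ is a Cartesian mesh of $\Omega$ made either of rectangles or of triangles (Cartesian rectangles cut along a diagonal), with maximal edge length $h$. An element $T$ is an interface element if its interior meets $\Gamma$. The mesh satisfies: (H1) $\Gamma$ does not intersect an edge of any element at more than two points unless the edge is part of $\Gamma$; (H2) if $\Gamma$ meets the boundary of an element at two points, they lie on different edges; (H3) $\Gamma$ is piecewise $C^2$ and $\Gamma\cap T$ is $C^2$ for every interface element $T$; (H4) $PC^2_{int}(T)$ is dense in $PH^2_{int}(T)$ for every interface element $T$. On an interface element $T$, $D,E$ are the two points of $\Gamma\cap\partial T$, $l$ is the segment $DE$, $\bar{\mathbf n}$ is a unit normal to $l$, and $T^\pm=T\cap\Omega^\pm$. IFE setting. Let $T$ be an interface element with edges $b_i$, $i\in\mathcal I=\{1,\dots,N\}$ ($N=3$ for triangles, $N=4$ for rectangles) and midpoints $M_i$ of $b_i$. $\Pi_T=\mathrm{span}\{1,x,y\}$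 (Crouzeix–Raviart, triangles) or $\Pi_T=\mathrm{span}\{1,x,y,x^2-y^2\}$ (rotated-$Q_1$, rectangles); $\psi_{i,T}\in\Pi_T$ are the standard shape functions with $\frac1{|b_j|}\int_{b_j}\psi_{i,T}\,ds=\delta_{ij}$. Set $\mathcal I^s=\{i:b_i\subseteq\overline{T^s}\}$, $\mathcal I^{int}=\{i: b_i\cap T^+\ne\emptyset\text{ and }b_i\cap T^-\ne\emptyset\}$, $\overline{\mathcal I^s}=\mathcal I^s\cup\mathcal I^{int}$ ($s=\pm$). One of two variants is fixed: (curve) a point $F\in\Gamma\cap T$, $F\neq D,E$, $\mathbf v(F)=\mathbf n(F)$ the unit normal to $\Gamma$ at $F$ oriented so that $\bar{\mathbf n}\cdot\mathbf n(F)>0$, and $T_p^\pm=T^\pm$; (line) a point $F\in l$, $\mathbf v(F)=\bar{\mathbf n}$, and $T_p^\pm$ are the two parts into which $l$ cuts $T$, $T_p^s$ being the one on the same side of $l$ as $\partial T\cap \overline{T^s}$. An IFE function on $T$ is a function $\phi_T$ with $\phi_T|_{T_p^s}=\phi_T^s$, $\phi_T^s\in\Pi_T$ ($s=\pm$), satisfying (J1) $\phi_T^-=\phi_T^+$ on $l$, and additionally $\partial_{xx}\phi_T^-=\partial_{xx}\phi_T^+$ in the rotated-$Q_1$ case; (J2) $\beta^-\nabla\phi_T^-(F)\cdot\mathbf v(F)=\beta^+\nabla\phi_T^+(F)\cdot\mathbf v(F)$. Here $\beta^s$ is the coefficient attached to the side $T^s_p$. *)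

theory Defs
  imports "HOL-Analysis.Analysis"
begin

type_synonym pt = "real^2"

definition C2_reg_param :: "(real \<Rightarrow> pt) \<Rightarrow> (real \<Rightarrow> pt) \<Rightarrow> real \<Rightarrow> real \<Rightarrow> bool" where
  "C2_reg_param g g1 a b \<longleftrightarrow> a < b \<and> (\<exists>g2.
     (\<forall>s\<in>{a..b}. (g has_vector_derivative g1 s) (at s within {a..b})
               \<and> (g1 has_vector_derivative g2 s) (at s within {a..b})
               \<and> g1 s \<noteq> 0)
     \<and> continuous_on {a..b} g2)"

definition C2_arc :: "pt set \<Rightarrow> bool" where
  "C2_arc A \<longleftrightarrow> (\<exists>g g1 a b. C2_reg_param g g1 a b \<and> inj_on g {a..b} \<and> g ` {a..b} = A)"

definition unit_normal_at :: "pt set \<Rightarrow> pt \<Rightarrow> pt \<Rightarrow> bool" where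
  "unit_normal_at A F n \<longleftrightarrow> norm n = 1 \<and>
     (\<exists>g g1 a b s. C2_reg_param g g1 a b \<and> inj_on g {a..b} \<and> g ` {a..b} = A
        \<and> s \<in> {a..b} \<and> g s = F \<and> n \<bullet> g1 s = 0)"

definition piecewise_C2_path :: "(real \<Rightarrow> pt) \<Rightarrow> bool" where
  "piecewise_C2_path g \<longleftrightarrow> (\<exists>(t::nat \<Rightarrow> real) k. t 0 = 0 \<and> t k = 1 \<and>
     (\<forall>i<k. \<exists>g1. C2_reg_param g g1 (t i) (t (Suc i))))"

definition interface_setting :: "pt set \<Rightarrow> pt set \<Rightarrow> pt set \<Rightarrow> pt set \<Rightarrow> bool" where
  "interface_setting \<Omega> \<Omega>p \<Omega>m \<Gamma> \<longleftrightarrow>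
     open \<Omega> \<and> connected \<Omega> \<and> bounded \<Omega> \<and> \<Omega> \<noteq> {} \<and>
     (\<exists>\<R>. finite \<R> \<and> (\<forall>R\<in>\<R>. \<exists>a b. R = cbox a b \<and> a$1 < b$1 \<and> a$2 < b$2)
          \<and> closure \<Omega> = \<Union>\<R> \<and> \<Omega> = interior (closure \<Omega>)) \<and>
     open \<Omega>p \<and> open \<Omega>m \<and> connected \<Omega>p \<and> connected \<Omega>m \<and> \<Omega>p \<noteq> {} \<and> \<Omega>m \<noteq> {} \<and>
     \<Omega>p \<inter> \<Omega>m = {} \<and> \<Omega> - \<Gamma> = \<Omega>p \<union> \<Omega>m \<and>
     closure \<Omega> = closure \<Omega>p \<union> closure \<Omega>m \<union> \<Gamma> \<and>
     (\<exists>g. simple_path g \<and> path_image g = \<Gamma> \<and> piecewise_C2_path g)"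

text \<open>An element is given by the list of its vertices in cyclic order;
  edge b_i goes from vertex i to vertex i+1 (indices mod N), i < N.\<close>
definition vtx :: "pt list \<Rightarrow> nat \<Rightarrow> pt" where
  "vtx P i = P ! (i mod length P)"

definition edge :: "pt list \<Rightarrow> nat \<Rightarrow> pt set" where
  "edge P i = closed_segment (vtx P i) (vtx P (Suc i))"

definition elem :: "pt list \<Rightarrow> pt set" where
  "elem P = convex hull (set P)"

definition pt2 :: "real \<Rightarrow> real \<Rightarrow> pt" where
  "pt2 x y = vector [x, y]"

definition rect_elem :: "(nat \<Rightarrow> real) \<Rightarrow> (nat \<Rightarrow> real) \<Rightarrow> nat \<Rightarrow> nat \<Rightarrow> pt list" where
  "rect_elem xg yg i j = [pt2 (xg i) (yg j), pt2 (xg (Suc i)) (yg j),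
                          pt2 (xg (Suc i)) (yg (Suc j)), pt2 (xg i) (yg (Suc j))]"

definition tri_elems :: "(nat \<Rightarrow> real) \<Rightarrow> (nat \<Rightarrow> real) \<Rightarrow> bool \<Rightarrow> nat \<Rightarrow> nat \<Rightarrow> pt list set" where
  "tri_elems xg yg d i j =
     (let v0 = pt2 (xg i) (yg j); v1 = pt2 (xg (Suc i)) (yg j);
          v2 = pt2 (xg (Suc i)) (yg (Suc j)); v3 = pt2 (xg i) (yg (Suc j))
      in if d then {[v0, v1, v2], [v0, v2, v3]} else {[v0, v1, v3], [v1, v2, v3]})"

definition cartesian_mesh :: "bool \<Rightarrow> pt set \<Rightarrow> real \<Rightarrow> pt list set \<Rightarrow> bool" where
  "cartesian_mesh tri \<Omega> h \<T> \<longleftrightarrow>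
     (\<exists>xg yg m n S dg. strict_mono_on {..m} xg \<and> strict_mono_on {..n} yg \<and>
        S \<subseteq> {..<m} \<times> {..<n} \<and>
        closure \<Omega> = (\<Union>(i,j)\<in>S. cbox (pt2 (xg i) (yg j)) (pt2 (xg (Suc i)) (yg (Suc j)))) \<and>
        \<T> = (if tri then (\<Union>(i,j)\<in>S. tri_elems xg yg (dg i j) i j)
              else (\<lambda>(i,j). rect_elem xg yg i j) ` S)) \<and>
     (\<forall>P\<in>\<T>. \<forall>i<length P. dist (vtx P i) (vtx P (Suc i)) \<le> h)"

definition mesh_hyps :: "pt set \<Rightarrow> pt list set \<Rightarrow> bool" where
  "mesh_hyps \<Gamma> \<T> \<longleftrightarrow>
     (\<forall>P\<in>\<T>. \<forall>i<length P. edge P i \<subseteq> \<Gamma> \<or> (finite (\<Gamma> \<inter> edge P i) \<and> card (\<Gamma> \<inter> edge P i) \<le> 2)) \<and>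
     (\<forall>P\<in>\<T>. card (\<Gamma> \<inter> frontier (elem P)) = 2 \<longrightarrow>
         \<not> (\<exists>i<length P. \<Gamma> \<inter> frontier (elem P) \<subseteq> edge P i)) \<and>
     (\<forall>P\<in>\<T>. interior (elem P) \<inter> \<Gamma> \<noteq> {} \<longrightarrow> C2_arc (\<Gamma> \<inter> elem P))"

definition PiT :: "nat \<Rightarrow> (pt \<Rightarrow> real) set" where
  "PiT N = {(\<lambda>X. a + b * X$1 + c * X$2 + d * ((X$1)^2 - (X$2)^2)) | a b c d. N = 3 \<longrightarrow> d = 0}"

definition edge_avg :: "(pt \<Rightarrow> real) \<Rightarrow> pt \<Rightarrow> pt \<Rightarrow> real" where
  "edge_avg f P Q = integral {0..1} (\<lambda>t. f (P + t *\<^sub>R (Q - P)))"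

text \<open>(1/|b|) times the line integral of f over the part of b = [P,Q] lying in A.\<close>
definition edge_part_avg :: "pt set \<Rightarrow> (pt \<Rightarrow> real) \<Rightarrow> pt \<Rightarrow> pt \<Rightarrow> real" where
  "edge_part_avg A f P Q = integral {t \<in> {0..1}. P + t *\<^sub>R (Q - P) \<in> A} (\<lambda>t. f (P + t *\<^sub>R (Q - P)))"

definition shape_fn :: "pt list \<Rightarrow> nat \<Rightarrow> pt \<Rightarrow> real" where
  "shape_fn P i = (THE f. f \<in> PiT (length P) \<and>
      (\<forall>j<length P. edge_avg f (vtx P j) (vtx P (Suc j)) = (if i = j then 1 else 0)))"

definition dderiv :: "(pt \<Rightarrow> real) \<Rightarrow> pt \<Rightarrow> pt \<Rightarrow> real" where
  "dderiv f F w = frechet_derivative f (at F) w"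

definition d2x :: "(pt \<Rightarrow> real) \<Rightarrow> pt \<Rightarrow> real" where
  "d2x f X = deriv (\<lambda>s. deriv (\<lambda>t. f (X + t *\<^sub>R axis 1 1)) s) 0"

definition Iside :: "pt list \<Rightarrow> pt set \<Rightarrow> nat set" where
  "Iside P Ts = {i. i < length P \<and> edge P i \<subseteq> closure Ts}"

definition Iint :: "pt list \<Rightarrow> pt set \<Rightarrow> pt set \<Rightarrow> nat set" where
  "Iint P Tp Tm = {i. i < length P \<and> i \<notin> Iside P Tp \<and> i \<notin> Iside P Tm}"

text \<open>Line variant: the part of T on the same side of l (through D with normal nb)
  as the boundary arc of T lying in the closure of T^-.\<close>
definition line_piece :: "pt set \<Rightarrow> pt set \<Rightarrow> pt \<Rightarrow> pt \<Rightarrow> pt set" where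
  "line_piece T Tm D nb = {X \<in> T. \<exists>Y \<in> frontier T \<inter> closure Tm.
       (nb \<bullet> (X - D)) * (nb \<bullet> (Y - D)) > 0}"

definition ife_fun :: "pt set \<Rightarrow> (pt \<Rightarrow> real) \<Rightarrow> (pt \<Rightarrow> real) \<Rightarrow> pt \<Rightarrow> real" where
  "ife_fun Tpm \<phi>p \<phi>m X = (if X \<in> closure Tpm then \<phi>m X else \<phi>p X)"

definition is_IFE :: "pt list \<Rightarrow> pt \<Rightarrow> pt \<Rightarrow> pt \<Rightarrow> pt \<Rightarrow> real \<Rightarrow> real
                      \<Rightarrow> (pt \<Rightarrow> real) \<Rightarrow> (pt \<Rightarrow> real) \<Rightarrow> bool" where
  "is_IFE P D E F vF \<beta>p \<beta>m \<phi>p \<phi>m \<longleftrightarrow>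
     \<phi>p \<in> PiT (length P) \<and> \<phi>m \<in> PiT (length P) \<and>
     (\<forall>X\<in>closed_segment D E. \<phi>m X = \<phi>p X) \<and>
     (length P = 4 \<longrightarrow> (\<forall>X. d2x \<phi>m X = d2x \<phi>p X)) \<and>
     \<beta>m * dderiv \<phi>m F vF = \<beta>p * dderiv \<phi>p F vF"

end

(*
Write L for the signed distance to the line DE and x_i for the edge means of phi^+.  By (J1),
phi^- = phi^+ + c0 L; by (J2), c0 = k gamma^T x.  The prescribed means turn into
(I + k delta gamma^T) x = v, a rank one perturbation of the identity, so everything reduces to
1 + k gamma^T delta <> 0 and the Sherman-Morrison formula.

On the boundary of T, the closures of T^+ and T^- are complementary off Gamma, hence constant on
the two connected pieces {L > 0} and {L < 0}.  Gamma may contain spurs, so both pieces can lie on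
the same side; then delta = 0 or delta is the vector of means of L.  Otherwise gamma^T delta is, up
to L -> -L, the derivative in direction v(F) of the interpolant of max(0, L).  With
theta = gamma^T delta / (n . v(F)), 1 + k gamma^T delta = 1 + (1/rho - 1) theta is positive as soon
as theta stays within a small distance of [0, 1].

For Crouzeix-Raviart, the gradient of the interpolant is theta n with theta in [0, 1] exactly.
For rotated Q1 and F on the segment DE, theta in [0, 1] is an algebraic inequality.  For F on the
curve one perturbs: arcs of Gamma of small diameter have nearly parallel tangents, uniformly in the
mesh, and the quadratic coefficient of the interpolant is O(1 / diam T), whatever the aspect ratio.
If F lies between D and E on the arc, F is close to the segment.  If not, the arc touches the
boundary of T at an interior point of the arc, the tangent there is parallel to an axis, and the
normal derivative hardly varies along the line DE.
*)
theory Submission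
  imports Defs
begin

subsection \<open>Local spaces and edge means\<close>

text \<open>The ratio \<theta> need only stay within \<epsilon> of [0, 1] because 1 + (r - 1)
  \<theta> with r = \<beta>^+ / \<beta>^- runs from 1 to r; the admissible \<epsilon> depends on r
  alone. The curve therefore enters through angles between its tangents, which is what allows
  arbitrarily thin rectangles. One obstacle is that \<Gamma> is only piecewise C^2: near a corner,
  short arcs have two unrelated directions, and compactness of \<Gamma> yields only a cover by two
  narrow cones. (H3) repairs this: an arc inside one element that passes from one cone to the other
  has a single tangent at the passage, and it belongs to both cones. Another is that \<Gamma>
  \<inter> T may continue past D or E inside T, so F need not be close to the segment DE. A third is
  that the derivative of the rotated Q1 interpolant may leave [0, 1] away from the line L = 0, so F
  has to be compared with a point of that line.\<close>

definition pol :: "real \<Rightarrow> real \<Rightarrow> real \<Rightarrow> real \<Rightarrow> pt \<Rightarrow> real" where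
  "pol a b c d = (\<lambda>X. a + b * X$1 + c * X$2 + d * ((X$1)\<^sup>2 - (X$2)\<^sup>2))"

text \<open>With explicit coefficients, derivatives and edge means become polynomial identities; one
  family serves both elements, the triangle merely forcing the quadratic coefficient to
  vanish.\<close>

lemma PiT_iff: "f \<in> PiT N \<longleftrightarrow> (\<exists>a b c d. f = pol a b c d \<and> (N = 3 \<longrightarrow> d = 0))"
  unfolding PiT_def pol_def by auto

lemma pol_add: "pol a b c d X + pol a' b' c' d' X = pol (a + a') (b + b') (c + c') (d + d') X"
  by (simp add: pol_def algebra_simps)

lemma pol_scale: "r * pol a b c d X = pol (r * a) (r * b) (r * c) (r * d) X"
  by (simp add: pol_def algebra_simps)

lemma PiT_add: "f \<in> PiT N \<Longrightarrow> g \<in> PiT N \<Longrightarrow> (\<lambda>X. f X + g X) \<in> PiT N"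
proof -
  assume "f \<in> PiT N" "g \<in> PiT N"
  then obtain a b c d a' b' c' d' where f: "f = pol a b c d" and g: "g = pol a' b' c' d'"
    and "N = 3 \<longrightarrow> d = 0" "N = 3 \<longrightarrow> d' = 0"
    unfolding PiT_iff by metis
  moreover have "(\<lambda>X. f X + g X) = pol (a+a') (b+b') (c+c') (d+d')"
    by (auto simp: f g pol_add)
  ultimately show ?thesis unfolding PiT_iff by (metis add.right_neutral)
qed

lemma PiT_scale: "f \<in> PiT N \<Longrightarrow> (\<lambda>X. r * f X) \<in> PiT N"
proof -
  assume "f \<in> PiT N"
  then obtain a b c d where f: "f = pol a b c d" and "N = 3 \<longrightarrow> d = 0"
    unfolding PiT_iff by metis
  moreover have "(\<lambda>X. r * f X) = pol (r*a) (r*b) (r*c) (r*d)"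
    by (auto simp: f pol_scale)
  ultimately show ?thesis unfolding PiT_iff by (metis mult_zero_right)
qed

lemma PiT_zero: "(\<lambda>X. 0) \<in> PiT N"
  unfolding PiT_iff pol_def by (rule exI[of _ 0], rule exI[of _ 0], rule exI[of _ 0], rule exI[of _ 0]) auto

lemma PiT_sum: "(\<And>i. i \<in> I \<Longrightarrow> f i \<in> PiT N) \<Longrightarrow> (\<lambda>X. \<Sum>i\<in>I. c i * f i X) \<in> PiT N"
proof (induction I rule: infinite_finite_induct)
  case (insert i I)
  then have "(\<lambda>X. c i * f i X + (\<Sum>i\<in>I. c i * f i X)) \<in> PiT N"
    by (intro PiT_add PiT_scale) auto
  then show ?case using insert by simp
qed (auto intro: PiT_zero)

lemma affine_pol: "n \<bullet> (X - D) = pol (- (n \<bullet> D)) (n$1) (n$2) 0 X" for n :: pt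
  by (simp add: pol_def inner_diff_right) (simp add: inner_vec_def sum_2)

lemma PiT_affine: "(\<lambda>X. (n::pt) \<bullet> (X - D)) \<in> PiT N"
  unfolding PiT_iff affine_pol by metis

lemma PiT_const: "(\<lambda>X. k) \<in> PiT N"
  unfolding PiT_iff by (rule exI[of _ k], rule exI[of _ 0], rule exI[of _ 0], rule exI[of _ 0]) (auto simp: pol_def)

lemma dderiv_pol: "dderiv (pol a b c d) F w = b * w$1 + c * w$2 + 2 * d * (F$1 * w$1 - F$2 * w$2)"
proof -
  have c: "((\<lambda>X::pt. X $ i) has_derivative (\<lambda>h. h $ i)) (at F)" for i
    by (rule bounded_linear_imp_has_derivative) (rule bounded_linear_vec_nth)
  have q: "((\<lambda>X::pt. (X $ i)\<^sup>2) has_derivative (\<lambda>h. F $ i * h $ i + h $ i * F $ i)) (at F)" for i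
    unfolding power2_eq_square by (rule has_derivative_mult[OF c c])
  have "((\<lambda>X. a + b * X$1 + c * X$2 + d * ((X$1)\<^sup>2 - (X$2)\<^sup>2)) has_derivative (\<lambda>w. 0 + b * w$1 + c * w$2
      + d * ((F$1 * w$1 + w$1 * F$1) - (F$2 * w$2 + w$2 * F$2)))) (at F)"
    by (rule has_derivative_add[OF has_derivative_add[OF has_derivative_add[OF has_derivative_const
          has_derivative_mult_right[OF c]] has_derivative_mult_right[OF c]]
          has_derivative_mult_right[OF has_derivative_diff[OF q q]]])
  moreover have "(\<lambda>w. 0 + b * w$1 + c * w$2 + d * ((F$1 * w$1 + w$1 * F$1) - (F$2 * w$2 + w$2 * F$2)))
     = (\<lambda>w::pt. b * w$1 + c * w$2 + 2 * d * (F$1 * w$1 - F$2 * w$2))"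
    by (rule ext) algebra
  ultimately have "(pol a b c d has_derivative (\<lambda>w. b * w$1 + c * w$2 + 2 * d * (F$1 * w$1 - F$2 * w$2))) (at F)"
    unfolding pol_def by simp
  from fun_cong[OF frechet_derivative_at[OF this], of w] show ?thesis
    unfolding dderiv_def by simp
qed

text \<open>The second derivative reads off the quadratic coefficient, so the extra clause of (J1)
  says exactly that the two pieces share it.\<close>

lemma d2x_pol: "d2x (pol a b c d) X = 2 * d"
proof -
  have [simp]: "(axis 1 1 :: pt) $ 2 = 0" "(axis 1 1 :: pt) $ 1 = 1"
    by (simp_all add: axis_def)
  have "deriv (\<lambda>t. pol a b c d (X + t *\<^sub>R axis 1 1)) s = b + 2 * d * (X$1 + s)" for s
    unfolding pol_def
    by (rule DERIV_imp_deriv) (auto intro!: derivative_eq_intros simp: power2_eq_square algebra_simps)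
  moreover have "deriv (\<lambda>s. b + 2 * d * (X$1 + s)) 0 = 2 * d"
    by (rule DERIV_imp_deriv) (auto intro!: derivative_eq_intros)
  ultimately show ?thesis by (simp add: d2x_def)
qed

lemma dderiv_add:
  assumes "f \<in> PiT N" "g \<in> PiT N"
  shows "dderiv (\<lambda>X. f X + g X) F w = dderiv f F w + dderiv g F w"
proof -
  obtain a b c d a' b' c' d' where f: "f = pol a b c d" and g: "g = pol a' b' c' d'"
    using assms unfolding PiT_iff by metis
  have e: "(\<lambda>X. f X + g X) = pol (a+a') (b+b') (c+c') (d+d')"
    by (auto simp: f g pol_add)
  show ?thesis unfolding e by (simp add: f g dderiv_pol algebra_simps)
qed

lemma dderiv_scale:
  assumes "f \<in> PiT N"
  shows "dderiv (\<lambda>X. r * f X) F w = r * dderiv f F w"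
proof -
  obtain a b c d where f: "f = pol a b c d"
    using assms unfolding PiT_iff by metis
  have e: "(\<lambda>X. r * f X) = pol (r*a) (r*b) (r*c) (r*d)"
    by (auto simp: f pol_scale)
  show ?thesis unfolding e by (simp add: f dderiv_pol algebra_simps)
qed

lemma dderiv_const: "dderiv (\<lambda>X. k) F w = 0"
proof -
  have "(\<lambda>X. k) = pol k 0 0 0" by (auto simp: pol_def)
  then show ?thesis by (simp add: dderiv_pol)
qed

lemma dderiv_sum:
  assumes "finite I" "\<And>i. i \<in> I \<Longrightarrow> f i \<in> PiT N"
  shows "dderiv (\<lambda>X. \<Sum>i\<in>I. c i * f i X) F w = (\<Sum>i\<in>I. c i * dderiv (f i) F w)"
  using assms
proof (induction I rule: finite_induct)
  case empty
  then show ?case by (simp add: dderiv_const)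
next
  case (insert i I)
  then have "f i \<in> PiT N" "(\<lambda>X. \<Sum>i\<in>I. c i * f i X) \<in> PiT N"
    by (auto intro: PiT_sum)
  from dderiv_add[OF PiT_scale[OF this(1)] this(2)] show ?case using insert
    by (simp add: dderiv_scale[of _ N])
qed

lemma dderiv_affine: "dderiv (\<lambda>X. (n::pt) \<bullet> (X - D)) F w = n \<bullet> w"
proof -
  have "(\<lambda>X. n \<bullet> (X - D)) = pol (- (n \<bullet> D)) (n$1) (n$2) 0" by (auto simp: affine_pol)
  then show ?thesis by (simp add: dderiv_pol inner_vec_def sum_2)
qed

section \<open>Edge means: linearity and closed formulas\<close>

lemma PiT_integrable:
  assumes "f \<in> PiT N"
  shows "(\<lambda>t. f (P + t *\<^sub>R (Q - P))) integrable_on {0..1}"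
proof -
  obtain a b c d where f: "f = pol a b c d"
    using assms unfolding PiT_iff by metis
  show ?thesis unfolding f pol_def
    by (intro integrable_continuous_interval continuous_intros)
qed

lemma edge_avg_add:
  assumes "f \<in> PiT N" "g \<in> PiT N"
  shows "edge_avg (\<lambda>X. f X + g X) P Q = edge_avg f P Q + edge_avg g P Q"
  unfolding edge_avg_def
  by (intro integral_add PiT_integrable[OF assms(1)] PiT_integrable[OF assms(2)])

lemma edge_avg_scale: "edge_avg (\<lambda>X. r * f X) P Q = r * edge_avg f P Q"
  unfolding edge_avg_def by simp

lemma edge_avg_sum:
  assumes "finite I" "\<And>i. i \<in> I \<Longrightarrow> f i \<in> PiT N"
  shows "edge_avg (\<lambda>X. \<Sum>i\<in>I. c i * f i X) P Q = (\<Sum>i\<in>I. c i * edge_avg (f i) P Q)"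
  using assms
proof (induction I rule: finite_induct)
  case empty
  then show ?case by (simp add: edge_avg_def)
next
  case (insert i I)
  then have "f i \<in> PiT N" "(\<lambda>X. \<Sum>i\<in>I. c i * f i X) \<in> PiT N"
    by (auto intro: PiT_sum)
  from edge_avg_add[OF PiT_scale[OF this(1)] this(2)] show ?case using insert
    by (simp add: edge_avg_scale)
qed

text \<open>On a segment the integrand is a quadratic in the parameter, and \<open>G\<close> is its
  antiderivative. The thirds come from the mean of a square along a segment, (p^2 + p q + q^2) / 3
  for end values p and q.\<close>

lemma edge_avg_pol:
  "edge_avg (pol a b c d) P Q = a + b * (P$1 + Q$1) / 2 + c * (P$2 + Q$2) / 2
     + d * (((P$1)\<^sup>2 + P$1 * Q$1 + (Q$1)\<^sup>2) / 3 - ((P$2)\<^sup>2 + P$2 * Q$2 + (Q$2)\<^sup>2) / 3)"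
proof -
  define u1 u2 where "u1 = Q$1 - P$1" and "u2 = Q$2 - P$2"
  define G where "G t = (a + b * P$1 + c * P$2 + d * ((P$1)^2 - (P$2)^2)) * t
     + (b * u1 + c * u2 + 2 * d * (P$1 * u1 - P$2 * u2)) * t^2 / 2 + d * (u1^2 - u2^2) * t^3 / 3" for t
  have "((\<lambda>t. pol a b c d (P + t *\<^sub>R (Q - P))) has_integral (G 1 - G 0)) {0..1}"
  proof (rule fundamental_theorem_of_calculus)
    fix t :: real
    have "(G has_real_derivative pol a b c d (P + t *\<^sub>R (Q - P))) (at t within {0..1})"
      unfolding G_def pol_def
      by (auto intro!: derivative_eq_intros simp: u1_def u2_def)
        (simp add: algebra_simps power2_eq_square)
    then show "(G has_vector_derivative pol a b c d (P + t *\<^sub>R (Q - P))) (at t within {0..1})"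
      by (simp add: has_real_derivative_iff_has_vector_derivative)
  qed simp
  then have "edge_avg (pol a b c d) P Q = G 1 - G 0"
    unfolding edge_avg_def by (rule integral_unique)
  then show ?thesis
    unfolding G_def u1_def u2_def by (simp add: field_simps power2_eq_square)
qed

lemma edge_avg_affine: "edge_avg (\<lambda>X. (n::pt) \<bullet> (X - D)) P Q = (n \<bullet> (P - D) + n \<bullet> (Q - D)) / 2"
proof -
  have "(\<lambda>X. n \<bullet> (X - D)) = pol (- (n \<bullet> D)) (n$1) (n$2) 0" by (auto simp: affine_pol)
  then show ?thesis by (simp add: edge_avg_pol inner_diff_right) (simp add: inner_vec_def sum_2 field_simps)
qed

section \<open>The mean of the positive part of an affine function along an edge, in terms of its
  end values\<close>

definition pos_avg :: "real \<Rightarrow> real \<Rightarrow> real" where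
  "pos_avg a b = integral {0..1} (\<lambda>t. max 0 (a + t * (b - a)))"

text \<open>Squaring removes the kink of max(0, y). Away from 0 the function is locally a
  polynomial; at 0 the difference quotient is at most |h| in modulus.\<close>

lemma DERIV_max0_sq: "((\<lambda>y::real. (max 0 y)\<^sup>2 / 2) has_real_derivative max 0 y) (at y)"
proof -
  consider "y > 0" | "y < 0" | "y = 0" by linarith
  then show ?thesis
  proof cases
    case 1
    have "((\<lambda>y::real. y\<^sup>2 / 2) has_real_derivative max 0 y) (at y)"
      using 1 by (auto intro!: derivative_eq_intros)
    then show ?thesis
      by (rule has_field_derivative_transform_within_open[of _ _ _ "{0<..}"]) (use 1 in auto)
  next
    case 2
    have "((\<lambda>y::real. 0) has_real_derivative max 0 y) (at y)"
      using 2 by (auto intro!: derivative_eq_intros)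
    then show ?thesis
      by (rule has_field_derivative_transform_within_open[of _ _ _ "{..<0}"]) (use 2 in auto)
  next
    case 3
    have "\<forall>\<^sub>F h in at 0. norm ((max 0 h)\<^sup>2 / 2 / h) \<le> \<bar>h\<bar>" 
      by (rule always_eventually) (auto simp: max_def power2_eq_square)
    moreover have "((\<lambda>h::real. \<bar>h\<bar>) \<longlongrightarrow> 0) (at 0)"
      by (rule tendsto_rabs_zero) simp
    ultimately have "((\<lambda>h::real. (max 0 h)\<^sup>2 / 2 / h) \<longlongrightarrow> 0) (at 0)"
      by (rule Lim_null_comparison)
    then show ?thesis using 3 by (simp add: DERIV_def)
  qed
qed

text \<open>\<open>max 0\<close> is the derivative of half its square, so the fundamental theorem of
  calculus applies after division by the slope b - a. Since a and b are values of L at two vertices,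
  the gradient estimates turn into algebra.\<close>

lemma pos_avg_eq:
  "pos_avg a b = (if a = b then max 0 a else ((max 0 b)\<^sup>2 - (max 0 a)\<^sup>2) / (2 * (b - a)))"
proof (cases "a = b")
  case True
  then show ?thesis by (simp add: pos_avg_def)
next
  case False
  define G where "G t = (max 0 (a + t * (b - a)))\<^sup>2 / 2 / (b - a)" for t
  have "((\<lambda>t. max 0 (a + t * (b - a))) has_integral (G 1 - G 0)) {0..1}"
  proof (rule fundamental_theorem_of_calculus)
    fix t :: real
    have 1: "((\<lambda>t. a + t * (b - a)) has_real_derivative (b - a)) (at t within {0..1})"
      by (auto intro!: derivative_eq_intros)
    have "((\<lambda>t. (max 0 (a + t * (b - a)))\<^sup>2 / 2) has_real_derivative
         max 0 (a + t * (b - a)) * (b - a)) (at t within {0..1})"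
      by (rule DERIV_chain2[OF DERIV_max0_sq 1])
    from DERIV_cdivide[OF this, of "b - a"]
    have "(G has_real_derivative max 0 (a + t * (b - a))) (at t within {0..1})"
      unfolding G_def using False by simp
    then show "(G has_vector_derivative max 0 (a + t * (b - a))) (at t within {0..1})"
      by (simp add: has_real_derivative_iff_has_vector_derivative)
  qed simp
  then have "pos_avg a b = G 1 - G 0"
    unfolding pos_avg_def by (rule integral_unique)
  then show ?thesis using False unfolding G_def by (simp add: diff_divide_distrib)
qed

lemma pos_avg_sym: "pos_avg a b = pos_avg b a"
  unfolding pos_avg_eq by (auto simp: field_simps)

text \<open>max(0, -x) = max(0, x) - x. This is the trace on an edge of the symmetry L -> -L, which
  exchanges the two sides of the line.\<close>

lemma pos_avg_minus: "pos_avg (- a) (- b) = pos_avg a b - (a + b) / 2"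
proof -
  have *: "(max 0 (-x))\<^sup>2 = x\<^sup>2 - (max 0 x)\<^sup>2" for x :: real
    by (auto simp: max_def)
  show ?thesis
  proof (cases "a = b")
    case False
    then show ?thesis unfolding pos_avg_eq *
      by (simp add: divide_simps) (simp add: algebra_simps power2_eq_square)
  qed (auto simp: pos_avg_eq)
qed

lemma pos_avg_bounds: "0 \<le> pos_avg a b" "pos_avg a b \<le> max 0 (max a b)"
proof -
  have i: "(\<lambda>t. max 0 (a + t * (b - a))) integrable_on {0..1}"
    by (intro integrable_continuous_interval continuous_intros)
  show "0 \<le> pos_avg a b" unfolding pos_avg_def
    by (rule integral_nonneg[OF i]) simp
  have "a + t * (b - a) \<le> max a b" if "0 \<le> t" "t \<le> 1" for t
    using convex_bound_le[of a "max a b" b "1 - t" t] that by (simp add: algebra_simps)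
  then have "pos_avg a b \<le> integral {0..1} (\<lambda>t::real. max 0 (max a b))"
    unfolding pos_avg_def by (intro integral_le[OF i]) (auto simp: max.coboundedI2)
  then show "pos_avg a b \<le> max 0 (max a b)" by simp
qed

text \<open>The integrand is 1-Lipschitz in a common shift of both end values. On opposite edges of
  a rectangle the values of L differ by such a shift.\<close>

lemma pos_avg_lipschitz: "\<bar>pos_avg (a + r) (b + r) - pos_avg a b\<bar> \<le> \<bar>r\<bar>"
proof -
  have i: "(\<lambda>t. max 0 (a + t * (b - a))) integrable_on {0..1}" for a b :: real
    by (intro integrable_continuous_interval continuous_intros)
  have "pos_avg (a + r) (b + r) - pos_avg a b
      = integral {0..1} (\<lambda>t. max 0 (a + r + t * (b + r - (a + r))) - max 0 (a + t * (b - a)))"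
    unfolding pos_avg_def by (rule integral_diff[symmetric]) (rule i)+
  also have "\<bar>\<dots>\<bar> \<le> integral {0..1} (\<lambda>t::real. \<bar>r\<bar>)"
    unfolding real_norm_def[symmetric]
    by (intro integral_norm_bound_integral integrable_diff i) auto
  finally show ?thesis by simp
qed

subsection \<open>The gradient inequality on rectangles\<close>

text \<open>The normal derivative of the interpolant of max(0, L) on a rectangle with sides W and H,
  multiplied by W^2 H^2 / (4 (W^2 + H^2)). Here \<alpha>, \<beta> are half the increments of L along
  the sides, c is L at the centre, (\<xi>, \<eta>) are the coordinates of the point relative to the
  centre in units of the half sides, p = W^2 / (W^2 + H^2) and q = H^2 / (W^2 + H^2). The means
  \<open>u0\<close>, ..., \<open>u3\<close> belong to the edges in cyclic order from the
  bottom.\<close>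

definition rect_form :: "real \<Rightarrow> real \<Rightarrow> real \<Rightarrow> real \<Rightarrow> real \<Rightarrow> real \<Rightarrow> real \<Rightarrow> real" where
  "rect_form p q \<alpha> \<beta> c \<xi> \<eta> =
    (let u0 = pos_avg (c - \<alpha> - \<beta>) (c + \<alpha> - \<beta>); u1 = pos_avg (c + \<alpha> - \<beta>) (c + \<alpha> + \<beta>);
         u2 = pos_avg (c + \<alpha> + \<beta>) (c - \<alpha> + \<beta>); u3 = pos_avg (c - \<alpha> + \<beta>) (c - \<alpha> - \<beta>)
     in q * \<alpha> * (u1 - u3) / 2 + p * \<beta> * (u2 - u0) / 2
        + 3 / 2 * p * q * (u1 + u3 - u0 - u2) * (\<alpha> * \<xi> - \<beta> * \<eta>))"

text \<open>Reflection in the vertical axis of the rectangle exchanges \<open>u1\<close> and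
  \<open>u3\<close>. Together with the exchange of the axes it reduces everything to \<alpha>,
  \<beta> \<ge> 0.\<close>

lemma rect_form_reflect_x: "rect_form p q (- \<alpha>) \<beta> c (- \<xi>) \<eta> = rect_form p q \<alpha> \<beta> c \<xi> \<eta>"
proof -
  have e: "c - - \<alpha> - \<beta> = c + \<alpha> - \<beta>" "c + - \<alpha> - \<beta> = c - \<alpha> - \<beta>" "c + - \<alpha> + \<beta> = c - \<alpha> + \<beta>" "c - - \<alpha> + \<beta> = c + \<alpha> + \<beta>"
    by simp_all
  show ?thesis
    unfolding rect_form_def Let_def e
      pos_avg_sym[of "c + \<alpha> - \<beta>" "c - \<alpha> - \<beta>"] pos_avg_sym[of "c - \<alpha> - \<beta>" "c - \<alpha> + \<beta>"]
      pos_avg_sym[of "c - \<alpha> + \<beta>" "c + \<alpha> + \<beta>"] pos_avg_sym[of "c + \<alpha> + \<beta>" "c + \<alpha> - \<beta>"]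
    by (simp add: algebra_simps)
qed

lemma rect_form_swap: "rect_form q p \<beta> \<alpha> c \<eta> \<xi> = rect_form p q \<alpha> \<beta> c \<xi> \<eta>"
proof -
  have e: "c - \<beta> - \<alpha> = c - \<alpha> - \<beta>" "c + \<beta> - \<alpha> = c - \<alpha> + \<beta>" "c + \<beta> + \<alpha> = c + \<alpha> + \<beta>" "c - \<beta> + \<alpha> = c + \<alpha> - \<beta>"
    by simp_all
  show ?thesis
    unfolding rect_form_def Let_def e
      pos_avg_sym[of "c - \<alpha> - \<beta>" "c - \<alpha> + \<beta>"] pos_avg_sym[of "c - \<alpha> + \<beta>" "c + \<alpha> + \<beta>"]
      pos_avg_sym[of "c + \<alpha> + \<beta>" "c + \<alpha> - \<beta>"] pos_avg_sym[of "c + \<alpha> - \<beta>" "c - \<alpha> - \<beta>"]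
    by (simp add: field_simps)
qed

lemma rect_form_reflect_y: "rect_form p q \<alpha> (- \<beta>) c \<xi> (- \<eta>) = rect_form p q \<alpha> \<beta> c \<xi> \<eta>"
  by (metis rect_form_swap rect_form_reflect_x)

text \<open>Replacing L by -L replaces the interpolant w of max(0, L) by w - L. Its derivative along
  -n is 1 minus the old one, and q \<alpha>^2 + p \<beta>^2 is the value of the form that
  corresponds to 1. So a lower bound for all data yields the upper bound.\<close>

lemma rect_form_minus:
  "rect_form p q (- \<alpha>) (- \<beta>) (- c) \<xi> \<eta> = q * \<alpha>\<^sup>2 + p * \<beta>\<^sup>2 - rect_form p q \<alpha> \<beta> c \<xi> \<eta>"
proof -
  have e: "- c - - \<alpha> - - \<beta> = - (c - \<alpha> - \<beta>)" "- c + - \<alpha> - - \<beta> = - (c + \<alpha> - \<beta>)"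
     "- c + - \<alpha> + - \<beta> = - (c + \<alpha> + \<beta>)" "- c - - \<alpha> + - \<beta> = - (c - \<alpha> + \<beta>)" by simp_all
  show ?thesis
    unfolding rect_form_def Let_def e pos_avg_minus
    by (simp add: field_simps power2_eq_square)
qed

lemma four_pq_le: "4 * (p * q) \<le> (p + q)\<^sup>2" for p q :: real
  using sum_squares_ge_zero[of "p - q" 0] by (simp add: power2_eq_square algebra_simps)

text \<open>The line cuts off one vertex: L is nonpositive at the other three, so only two edge
  means survive, both proportional to the square of m = c + \<alpha> + \<beta>. The remaining factor
  is controlled by min(\<alpha>, \<beta>), because m is at most twice that minimum.\<close>

lemma rect_form_corner:
  assumes pq: "0 \<le> p" "0 \<le> q" "p + q = 1" and ab: "0 \<le> \<alpha>" "0 \<le> \<beta>"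
    and c: "c + \<alpha> - \<beta> \<le> 0" "c - \<alpha> + \<beta> \<le> 0" "0 \<le> c + \<alpha> + \<beta>"
    and xy: "\<bar>\<xi>\<bar> \<le> 1" "\<bar>\<eta>\<bar> \<le> 1" "c + \<alpha> * \<xi> + \<beta> * \<eta> = 0"
  shows "0 \<le> rect_form p q \<alpha> \<beta> c \<xi> \<eta>" "rect_form p q \<alpha> \<beta> c \<xi> \<eta> \<le> q * \<alpha>\<^sup>2 + p * \<beta>\<^sup>2"
proof -
  define m where "m = c + \<alpha> + \<beta>"
  have m: "0 \<le> m" "m \<le> 2 * \<alpha>" "m \<le> 2 * \<beta>" using c by (auto simp: m_def)
  \<comment> \<open>At the cut-off vertex \<alpha> \<xi> - \<beta> \<eta> equals \<alpha> - \<beta>;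
    on the part of the line inside the rectangle the deviation \<tau> from this value is at most
    m.\<close>
  define \<tau> where "\<tau> = \<alpha> * \<xi> - \<beta> * \<eta> - (\<alpha> - \<beta>)"
  have "\<alpha> * \<xi> \<le> \<alpha>" "\<beta> * \<eta> \<le> \<beta>" using xy ab by (auto simp: abs_le_iff intro: mult_left_le)
  then have \<tau>: "\<bar>\<tau>\<bar> \<le> m" using xy(3) unfolding \<tau>_def m_def by linarith
  have u: "pos_avg (c - \<alpha> - \<beta>) (c + \<alpha> - \<beta>) = 0" "pos_avg (c - \<alpha> + \<beta>) (c - \<alpha> - \<beta>) = 0"
    using c ab by (auto simp: pos_avg_eq max_def)
  let ?Q = "q * \<alpha>\<^sup>2 + p * \<beta>\<^sup>2"
  have Q: "0 \<le> ?Q" using pq by simp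
  have "0 \<le> rect_form p q \<alpha> \<beta> c \<xi> \<eta> \<and> rect_form p q \<alpha> \<beta> c \<xi> \<eta> \<le> ?Q"
  proof (cases "\<alpha> = 0 \<or> \<beta> = 0")
    case True
    then have "m = 0" using m by auto
    then have "pos_avg (c + \<alpha> - \<beta>) (c + \<alpha> + \<beta>) = 0" "pos_avg (c + \<alpha> + \<beta>) (c - \<alpha> + \<beta>) = 0"
      using c by (auto simp: pos_avg_eq m_def max_def)
    then show ?thesis unfolding rect_form_def Let_def u using Q by simp
  next
    case False
    then have ab': "0 < \<alpha>" "0 < \<beta>" using ab by auto
    have u1: "pos_avg (c + \<alpha> - \<beta>) (c + \<alpha> + \<beta>) = m\<^sup>2 / (4 * \<beta>)"
      using ab' c m by (simp add: pos_avg_eq max_def m_def)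
    have u2: "pos_avg (c + \<alpha> + \<beta>) (c - \<alpha> + \<beta>) = m\<^sup>2 / (4 * \<alpha>)"
      unfolding pos_avg_sym[of "c + \<alpha> + \<beta>"]
      using ab' c m by (simp add: pos_avg_eq max_def m_def)
    define R where "R = ?Q + 3 * (p * q) * ((\<alpha> - \<beta>) * (\<alpha> - \<beta> + \<tau>))"
    have G: "rect_form p q \<alpha> \<beta> c \<xi> \<eta> = m\<^sup>2 / (8 * \<alpha> * \<beta>) * R"
    proof -
      have "rect_form p q \<alpha> \<beta> c \<xi> \<eta> = q * \<alpha> * (m\<^sup>2 / (4 * \<beta>)) / 2 + p * \<beta> * (m\<^sup>2 / (4 * \<alpha>)) / 2
        + 3 / 2 * p * q * (m\<^sup>2 / (4 * \<beta>) - m\<^sup>2 / (4 * \<alpha>)) * (\<alpha> - \<beta> + \<tau>)"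
        unfolding rect_form_def Let_def u u1 u2 \<tau>_def by simp
      also have "\<dots> = m\<^sup>2 / (8 * \<alpha> * \<beta>) * R"
        unfolding R_def using ab' by (simp add: divide_simps) (simp add: algebra_simps power2_eq_square)
      finally show ?thesis .
    qed
    have pq4: "4 * (p * q) \<le> 1" "0 \<le> p * q" using four_pq_le[of p q] pq by auto
    let ?M = "min \<alpha> \<beta>"
    have Qmin: "?M\<^sup>2 \<le> ?Q"
    proof -
      have "q * ?M\<^sup>2 \<le> q * \<alpha>\<^sup>2" "p * ?M\<^sup>2 \<le> p * \<beta>\<^sup>2"
        using pq ab by (auto intro!: mult_left_mono power_mono)
      then have "(p + q) * ?M\<^sup>2 \<le> ?Q" by (simp add: algebra_simps)
      then show ?thesis using pq by simp
    qed
    have prod: "- (?M\<^sup>2) \<le> (\<alpha> - \<beta>) * (\<alpha> - \<beta> + \<tau>)"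
    proof -
      \<comment> \<open>Completing the square: the product is at least -(\<tau> / 2)^2, and |\<tau>|
        / 2 is at most min(\<alpha>, \<beta>).\<close>
      have "0 \<le> ((\<alpha> - \<beta>) + \<tau> / 2)\<^sup>2" by simp
      then have "- ((\<tau> / 2)\<^sup>2) \<le> (\<alpha> - \<beta>) * (\<alpha> - \<beta> + \<tau>)"
        by (simp add: power2_eq_square algebra_simps)
      moreover have "\<bar>\<tau> / 2\<bar> \<le> \<bar>?M\<bar>" using \<tau> m by auto
      then have "(\<tau> / 2)\<^sup>2 \<le> ?M\<^sup>2" by (rule abs_le_square_iff[THEN iffD1])
      ultimately show ?thesis by linarith
    qed
    have "3 * (p * q) * (- (?M\<^sup>2)) \<le> 3 * (p * q) * ((\<alpha> - \<beta>) * (\<alpha> - \<beta> + \<tau>))"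
      using prod pq4 by (intro mult_left_mono) auto
    moreover have "4 * (p * q) * ?M\<^sup>2 \<le> 1 * ?M\<^sup>2" using pq4 by (intro mult_right_mono) auto
    moreover have "0 \<le> (p * q) * ?M\<^sup>2" using pq4 by simp
    ultimately have R0: "0 \<le> R" unfolding R_def using Qmin by linarith
    have R1: "?M * R \<le> 2 * max \<alpha> \<beta> * ?Q"
    proof -
      \<comment> \<open>Here x stands for the larger and y for the smaller of \<alpha>, \<beta>; the
        case \<alpha> < \<beta> follows by exchanging p with q and changing the sign of
        \<tau>.\<close>
      have key: "y * ((q * x\<^sup>2 + p * y\<^sup>2) + 3 * (p * q) * ((x - y) * (x - y + t))) \<le> 2 * x * (q * x\<^sup>2 + p * y\<^sup>2)"
        if y: "0 < y" "y \<le> x" and t: "t \<le> 2 * y" and pq: "0 \<le> p" "0 \<le> q" "p + q = 1" for x y p q t :: real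
      proof -
        have xyt: "(x - y) * (x - y + t) \<le> (x - y) * (x + y)"
          using y t by (intro mult_left_mono) auto
        have "3 * (p * q) * ((x - y) * (x - y + t)) \<le> 3 * (p * q) * ((x - y) * (x + y))"
          by (rule mult_left_mono[OF xyt]) (use pq in auto)
        also have "\<dots> \<le> 3 * q * ((x - y) * (x + y))"
        proof -
          have "p * q \<le> q" using pq by (intro mult_left_le_one_le) auto
          then show ?thesis using y by (intro mult_right_mono) auto
        qed
        finally have 1: "y * (3 * (p * q) * ((x - y) * (x - y + t))) \<le> y * (3 * q * ((x - y) * (x + y)))"
          using y by (intro mult_left_mono) auto
        have "0 \<le> 2 * x * x\<^sup>2 - y * x\<^sup>2 - 3 * (y * ((x - y) * (x + y)))"
        proof -
          have "2 * x * x\<^sup>2 - y * x\<^sup>2 - 3 * (y * ((x - y) * (x + y))) = 2 * x^3 - 4 * y * x\<^sup>2 + 3 * y^3"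
            by (simp add: power2_eq_square power3_eq_cube algebra_simps)
          \<comment> \<open>For fixed x the cubic is least on y \<ge> 0 at y = 2 x / 3, with value
            2/9 x^3; subtracting this minimum leaves a double root.\<close>
          also have "\<dots> = 3 * (y + 4 / 3 * x) * (y - 2 / 3 * x)\<^sup>2 + 2 / 9 * x^3"
            by (simp add: power2_eq_square power3_eq_cube field_simps)
          also have "\<dots> \<ge> 0" using y by (intro add_nonneg_nonneg mult_nonneg_nonneg) auto
          finally show ?thesis .
        qed
        then have 2: "0 \<le> q * (2 * x * x\<^sup>2 - y * x\<^sup>2 - 3 * (y * ((x - y) * (x + y))))" using pq by simp
        have 3: "0 \<le> (2 * x - y) * (p * y\<^sup>2)" using pq y by simp
        from 1 2 3 show ?thesis by (simp add: algebra_simps)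
      qed
      show ?thesis
      proof (cases "\<beta> \<le> \<alpha>")
        case True
        then show ?thesis using key[of \<beta> \<alpha> \<tau> p q] ab' pq \<tau> m unfolding R_def by (simp add: min_def max_def)
      next
        case False
        have e: "(\<beta> - \<alpha>) * (\<beta> - \<alpha> + - \<tau>) = (\<alpha> - \<beta>) * (\<alpha> - \<beta> + \<tau>)" by (simp add: algebra_simps)
        show ?thesis using key[of \<alpha> \<beta> "- \<tau>" q p] False ab' pq \<tau> m unfolding R_def e
          by (simp add: min_def max_def algebra_simps)
      qed
    qed
    have "m\<^sup>2 / (8 * \<alpha> * \<beta>) * R \<le> ?Q"
    proof -
      have "m\<^sup>2 \<le> (2 * ?M)\<^sup>2" using m by (intro power_mono) auto
      then have "m\<^sup>2 * R \<le> (2 * ?M)\<^sup>2 * R" using R0 by (intro mult_right_mono)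
      also have "\<dots> = 4 * ?M * (?M * R)" by (simp add: power2_eq_square)
      also have "\<dots> \<le> 4 * ?M * (2 * max \<alpha> \<beta> * ?Q)"
        using R1 ab by (intro mult_left_mono) auto
      also have "\<dots> = 8 * \<alpha> * \<beta> * ?Q" by (simp add: min_def max_def)
      finally show ?thesis using ab' by (simp add: divide_simps mult.commute)
    qed
    then show ?thesis unfolding G using R0 ab' by auto
  qed
  then show "0 \<le> rect_form p q \<alpha> \<beta> c \<xi> \<eta>" "rect_form p q \<alpha> \<beta> c \<xi> \<eta> \<le> ?Q" by auto
qed

text \<open>The line separates the vertical edges: L is nonnegative on the right one and nonpositive
  on the left one. Then \<open>u3\<close> = 0 and \<open>u1\<close> = \<sigma>, the value of L at
  the midpoint of the right edge. With the least favourable \<kappa> inserted, a Cauchy-Schwarz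
  inequality in p, q and an arithmetic-geometric mean inequality in \<sigma> remain.\<close>

lemma rect_form_opposite:
  assumes pq: "0 \<le> p" "0 \<le> q" "p + q = 1" and ab: "0 \<le> \<alpha>" "0 \<le> \<beta>"
    and c: "0 \<le> c + \<alpha> - \<beta>" "c - \<alpha> + \<beta> \<le> 0"
    and xy: "\<bar>\<xi>\<bar> \<le> 1" "\<bar>\<eta>\<bar> \<le> 1" "c + \<alpha> * \<xi> + \<beta> * \<eta> = 0"
  shows "0 \<le> rect_form p q \<alpha> \<beta> c \<xi> \<eta>"
proof (cases "\<alpha> = 0")
  case True
  then have "\<beta> = 0" "c = 0" using c ab by auto
  then show ?thesis using True by (simp add: rect_form_def pos_avg_eq)
next
  case False
  define \<sigma> where "\<sigma> = c + \<alpha>"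
  have a: "0 < \<alpha>" using False ab by auto
  have s: "\<beta> \<le> \<sigma>" "\<sigma> + \<beta> \<le> 2 * \<alpha>" "0 \<le> \<sigma>" using c ab by (auto simp: \<sigma>_def)
  have l: "c - \<alpha> - \<beta> = \<sigma> - \<beta> - 2 * \<alpha>" "c + \<alpha> - \<beta> = \<sigma> - \<beta>" "c + \<alpha> + \<beta> = \<sigma> + \<beta>" "c - \<alpha> + \<beta> = \<sigma> + \<beta> - 2 * \<alpha>"
    by (auto simp: \<sigma>_def)
  have u0: "pos_avg (\<sigma> - \<beta> - 2 * \<alpha>) (\<sigma> - \<beta>) = (\<sigma> - \<beta>)\<^sup>2 / (4 * \<alpha>)"
    using s a ab by (simp add: pos_avg_eq max_def)
  have u1: "pos_avg (\<sigma> - \<beta>) (\<sigma> + \<beta>) = \<sigma>"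
    using s ab by (simp add: pos_avg_eq max_def) (simp add: divide_simps, simp add: power2_eq_square algebra_simps)
  have u2: "pos_avg (\<sigma> + \<beta>) (\<sigma> + \<beta> - 2 * \<alpha>) = (\<sigma> + \<beta>)\<^sup>2 / (4 * \<alpha>)"
    unfolding pos_avg_sym[of "\<sigma> + \<beta>"] using s a ab by (simp add: pos_avg_eq max_def)
  have u3: "pos_avg (\<sigma> + \<beta> - 2 * \<alpha>) (\<sigma> - \<beta> - 2 * \<alpha>) = 0"
    using s a ab by (simp add: pos_avg_eq max_def)
  define \<kappa> where "\<kappa> = \<alpha> * \<xi> - \<beta> * \<eta>"
  \<comment> \<open>On L = 0 the quantity \<kappa> equals -c - 2 \<beta> \<eta>, which is least for
    \<eta> = 1.\<close>
  have k: "\<alpha> - \<sigma> - 2 * \<beta> \<le> \<kappa>"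
  proof -
    have "\<beta> * \<eta> \<le> \<beta>" using xy ab by (auto simp: abs_le_iff intro: mult_left_le)
    then show ?thesis using xy(3) unfolding \<kappa>_def \<sigma>_def by linarith
  qed
  define V where "V = 2 * \<alpha> * \<sigma> - \<sigma>\<^sup>2 - \<beta>\<^sup>2"
  have V0: "0 \<le> V"
  proof -
    have "\<beta> * \<beta> \<le> \<sigma> * (2 * \<alpha> - \<sigma>)" using s ab by (intro mult_mono) auto
    then show ?thesis by (simp add: V_def power2_eq_square algebra_simps)
  qed
  have "2 * \<alpha> * rect_form p q \<alpha> \<beta> c \<xi> \<eta> = q * \<alpha>\<^sup>2 * \<sigma> + p * \<beta>\<^sup>2 * \<sigma> + 3 / 2 * (p * q) * (V * \<kappa>)"
    unfolding rect_form_def Let_def l u0 u1 u2 u3 V_def \<kappa>_def[symmetric]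
    using a by (simp add: field_simps power2_eq_square)
  moreover have "3 / 2 * (p * q) * (V * (\<alpha> - \<sigma> - 2 * \<beta>)) \<le> 3 / 2 * (p * q) * (V * \<kappa>)"
    using pq V0 k by (intro mult_left_mono) auto
  moreover have "0 \<le> q * \<alpha>\<^sup>2 * \<sigma> + p * \<beta>\<^sup>2 * \<sigma> + 3 / 2 * (p * q) * (V * (\<alpha> - \<sigma> - 2 * \<beta>))"
  proof (cases "\<sigma> = 0")
    case True
    then show ?thesis using s ab by (simp add: V_def)
  next
    case False
    then have s0: "0 < \<sigma>" using s by auto
    \<comment> \<open>Because p + q = 1, the gap is the square of q \<alpha> - p \<beta>.\<close>
    have CS: "p * q * (\<alpha> + \<beta>)\<^sup>2 \<le> q * \<alpha>\<^sup>2 + p * \<beta>\<^sup>2"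
    proof -
      have "0 \<le> (q * \<alpha> - p * \<beta>)\<^sup>2" by simp
      moreover have "(q * \<alpha>\<^sup>2 + p * \<beta>\<^sup>2) * (p + q) - p * q * (\<alpha> + \<beta>)\<^sup>2 = (q * \<alpha> - p * \<beta>)\<^sup>2"
        by (simp add: power2_eq_square algebra_simps)
      ultimately have "p * q * (\<alpha> + \<beta>)\<^sup>2 \<le> (q * \<alpha>\<^sup>2 + p * \<beta>\<^sup>2) * (p + q)" by linarith
      then show ?thesis using pq by simp
    qed
    have VX: "3 / 2 * (V * (\<sigma> + 2 * \<beta> - \<alpha>)) \<le> \<sigma> * (\<alpha> + \<beta>)\<^sup>2"
    proof -
      \<comment> \<open>Factoring \<sigma> out of V leaves X \<le> 2 \<alpha> - \<sigma>, and the
        sum of 2 \<alpha> - \<sigma> and \<sigma> + 2 \<beta> - \<alpha> is free of \<sigma>; this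
        gives the bound ((\<alpha> + 2 \<beta>) / 2)^2 for their product.\<close>
      define X where "X = 2 * \<alpha> - \<sigma> - \<beta>\<^sup>2 / \<sigma>"
      have X: "V = \<sigma> * X" unfolding V_def X_def using s0 by (simp add: field_simps power2_eq_square)
      have X0: "0 \<le> X" using V0 X s0 by (simp add: zero_le_mult_iff)
      have "X * (\<sigma> + 2 * \<beta> - \<alpha>) \<le> ((\<alpha> + 2 * \<beta>) / 2)\<^sup>2"
      proof -
        have "X * (\<sigma> + 2 * \<beta> - \<alpha>) \<le> (2 * \<alpha> - \<sigma>) * (\<sigma> + 2 * \<beta> - \<alpha>) \<or> \<sigma> + 2 * \<beta> - \<alpha> \<le> 0"
          using s0 unfolding X_def by (auto intro!: mult_right_mono)
        moreover have "(2 * \<alpha> - \<sigma>) * (\<sigma> + 2 * \<beta> - \<alpha>) \<le> ((\<alpha> + 2 * \<beta>) / 2)\<^sup>2"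
          using sum_squares_ge_zero[of "(2 * \<alpha> - \<sigma>) - (\<sigma> + 2 * \<beta> - \<alpha>)" 0]
          by (simp add: power2_eq_square field_simps)
        moreover have "X * (\<sigma> + 2 * \<beta> - \<alpha>) \<le> 0" if "\<sigma> + 2 * \<beta> - \<alpha> \<le> 0"
          using X0 that by (simp add: mult_nonneg_nonpos)
        moreover have "0 \<le> ((\<alpha> + 2 * \<beta>) / 2)\<^sup>2" by simp
        ultimately show ?thesis by linarith
      qed
      moreover have "3 / 2 * ((\<alpha> + 2 * \<beta>) / 2)\<^sup>2 \<le> (\<alpha> + \<beta>)\<^sup>2"
      proof -
        have "\<beta> * \<beta> \<le> \<alpha> * \<beta>" using s ab by (intro mult_right_mono) auto
        moreover have "\<alpha> * \<beta> \<le> \<alpha> * \<alpha>" using s ab by (intro mult_left_mono) auto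
        moreover have "3 / 2 * ((\<alpha> + 2 * \<beta>) / 2)\<^sup>2 = 3 / 8 * (\<alpha> * \<alpha>) + 3 / 2 * (\<alpha> * \<beta>) + 3 / 2 * (\<beta> * \<beta>)"
          "(\<alpha> + \<beta>)\<^sup>2 = \<alpha> * \<alpha> + 2 * (\<alpha> * \<beta>) + \<beta> * \<beta>"
          by (simp_all add: power2_eq_square field_simps)
        moreover have "0 \<le> \<alpha> * \<alpha>" by simp
        ultimately show ?thesis by linarith
      qed
      ultimately have "3 / 2 * (X * (\<sigma> + 2 * \<beta> - \<alpha>)) \<le> (\<alpha> + \<beta>)\<^sup>2" by linarith
      then have "\<sigma> * (3 / 2 * (X * (\<sigma> + 2 * \<beta> - \<alpha>))) \<le> \<sigma> * (\<alpha> + \<beta>)\<^sup>2" using s0 by simp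
      then show ?thesis unfolding X by (simp add: algebra_simps)
    qed
    have "p * q * (3 / 2 * (V * (\<sigma> + 2 * \<beta> - \<alpha>))) \<le> p * q * (\<sigma> * (\<alpha> + \<beta>)\<^sup>2)"
      using VX pq by (intro mult_left_mono) auto
    also have "\<dots> = \<sigma> * (p * q * (\<alpha> + \<beta>)\<^sup>2)" by simp
    also have "\<dots> \<le> \<sigma> * (q * \<alpha>\<^sup>2 + p * \<beta>\<^sup>2)" using CS s by (intro mult_left_mono) auto
    finally show ?thesis by (simp add: algebra_simps)
  qed
  ultimately have "0 \<le> 2 * \<alpha> * rect_form p q \<alpha> \<beta> c \<xi> \<eta>" by linarith
  then show ?thesis using a by (simp add: zero_le_mult_iff)
qed

text \<open>After reflections \<alpha>, \<beta> \<ge> 0, and the line meets the rectangle, so L is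
  nonpositive at the lower left and nonnegative at the upper right vertex. The signs at the other
  two vertices leave four patterns. Three vertices on the positive side is the corner case for -L;
  separation of the horizontal edges is the opposite case with the axes exchanged.\<close>

lemma rect_form_nonneg:
  assumes pq: "0 \<le> p" "0 \<le> q" "p + q = 1"
    and xy: "\<bar>\<xi>\<bar> \<le> 1" "\<bar>\<eta>\<bar> \<le> 1" "c + \<alpha> * \<xi> + \<beta> * \<eta> = 0"
  shows "0 \<le> rect_form p q \<alpha> \<beta> c \<xi> \<eta>"
proof -
  have main: "0 \<le> rect_form p q \<alpha> \<beta> c \<xi> \<eta>" 
    if pq: "0 \<le> p" "0 \<le> q" "p + q = 1" and xy: "\<bar>\<xi>\<bar> \<le> 1" "\<bar>\<eta>\<bar> \<le> 1" "c + \<alpha> * \<xi> + \<beta> * \<eta> = 0"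
      and ab: "0 \<le> \<alpha>" "0 \<le> \<beta>" for p q \<xi> \<eta> c \<alpha> \<beta> :: real
  proof -
    have "\<bar>\<alpha> * \<xi>\<bar> \<le> \<alpha>" "\<bar>\<beta> * \<eta>\<bar> \<le> \<beta>" using xy ab by (auto simp: abs_mult intro: mult_left_le)
    then have c: "c - \<alpha> - \<beta> \<le> 0" "0 \<le> c + \<alpha> + \<beta>" using xy(3) by linarith+
    consider "c + \<alpha> - \<beta> \<le> 0" "c - \<alpha> + \<beta> \<le> 0" | "0 \<le> c + \<alpha> - \<beta>" "0 \<le> c - \<alpha> + \<beta>"
      | "0 \<le> c + \<alpha> - \<beta>" "c - \<alpha> + \<beta> \<le> 0" | "c + \<alpha> - \<beta> \<le> 0" "0 \<le> c - \<alpha> + \<beta>" by linarith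
    then show ?thesis
    proof cases
      case 1
      then show ?thesis using rect_form_corner(1)[OF pq ab _ _ c(2) xy] by simp
    next
      case 2
      \<comment> \<open>The upper bound of the corner case for -L, after a half turn of the
        rectangle, is the lower bound wanted here.\<close>
      have "rect_form p q \<alpha> \<beta> (- c) (- \<xi>) (- \<eta>) \<le> q * \<alpha>\<^sup>2 + p * \<beta>\<^sup>2"
        by (rule rect_form_corner(2)[OF pq ab]) (use 2 c xy in auto)
      moreover have "rect_form p q \<alpha> \<beta> (- c) (- \<xi>) (- \<eta>) = rect_form p q (- \<alpha>) (- \<beta>) (- c) \<xi> \<eta>"
        using rect_form_reflect_x[of p q \<alpha> \<beta> "- c" "- \<xi>" "- \<eta>"]
          rect_form_reflect_y[of p q "- \<alpha>" \<beta> "- c" \<xi> "- \<eta>"] by simp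
      ultimately show ?thesis unfolding rect_form_minus by simp
    next
      case 3
      then show ?thesis using rect_form_opposite[OF pq ab _ _ xy] by simp
    next
      case 4
      have "0 \<le> rect_form q p \<beta> \<alpha> c \<eta> \<xi>"
        by (rule rect_form_opposite) (use 4 pq ab xy in auto)
      then show ?thesis by (simp add: rect_form_swap)
    qed
  qed
  have "0 \<le> rect_form p q \<bar>\<alpha>\<bar> \<bar>\<beta>\<bar> c (if \<alpha> < 0 then - \<xi> else \<xi>) (if \<beta> < 0 then - \<eta> else \<eta>)"
    by (rule main[OF pq]) (use xy in auto)
  also have "\<dots> = rect_form p q \<alpha> \<beta> c \<xi> \<eta>"
    by (simp add: abs_if rect_form_reflect_x rect_form_reflect_y)
  finally show ?thesis .
qed

lemma rect_form_le:
  assumes pq: "0 \<le> p" "0 \<le> q" "p + q = 1"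
    and xy: "\<bar>\<xi>\<bar> \<le> 1" "\<bar>\<eta>\<bar> \<le> 1" "c + \<alpha> * \<xi> + \<beta> * \<eta> = 0"
  shows "rect_form p q \<alpha> \<beta> c \<xi> \<eta> \<le> q * \<alpha>\<^sup>2 + p * \<beta>\<^sup>2"
proof -
  have "- c + - \<alpha> * \<xi> + - \<beta> * \<eta> = - (c + \<alpha> * \<xi> + \<beta> * \<eta>)" by (simp add: algebra_simps)
  then have "- c + - \<alpha> * \<xi> + - \<beta> * \<eta> = 0" using xy(3) by simp
  from rect_form_nonneg[OF pq xy(1,2) this] show ?thesis by (simp add: rect_form_minus)
qed

subsection \<open>Unisolvence and the interpolant of the positive part\<close>

text \<open>The planar cross product. It serves as the determinant of a triangle and, for a unit
  vector e in the first slot, as the signed component orthogonal to e.\<close>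

definition cr :: "pt \<Rightarrow> pt \<Rightarrow> real" where
  "cr a b = a$1 * b$2 - a$2 * b$1"

definition rect_vertices :: "real \<Rightarrow> real \<Rightarrow> real \<Rightarrow> real \<Rightarrow> pt list" where
  "rect_vertices x0 x1 y0 y1 = [pt2 x0 y0, pt2 x1 y0, pt2 x1 y1, pt2 x0 y1]"

definition is_triangle :: "pt list \<Rightarrow> bool" where
  "is_triangle P \<longleftrightarrow> (\<exists>a b c. P = [a, b, c] \<and> cr (b - a) (c - a) \<noteq> 0)"

definition is_rectangle :: "pt list \<Rightarrow> bool" where
  "is_rectangle P \<longleftrightarrow> (\<exists>x0 x1 y0 y1. P = rect_vertices x0 x1 y0 y1 \<and> x0 < x1 \<and> y0 < y1)"

abbreviation (input) mesh_cell :: "pt list \<Rightarrow> bool" where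
  "mesh_cell P \<equiv> is_triangle P \<or> is_rectangle P"

lemma pt2_nth [simp]: "pt2 x y $ 1 = x" "pt2 x y $ 2 = y"
  by (simp_all add: pt2_def)

lemma all_less_3: "(\<forall>i<3. Q i) \<longleftrightarrow> Q 0 \<and> Q (Suc 0) \<and> Q (Suc (Suc 0))"
  by (auto simp: numeral_3_eq_3 less_Suc_eq)

lemma all_less_4: "(\<forall>i<4. Q i) \<longleftrightarrow> Q 0 \<and> Q (Suc 0) \<and> Q (Suc (Suc 0)) \<and> Q (Suc (Suc (Suc 0)))"
  by (auto simp: eval_nat_numeral less_Suc_eq)

abbreviation (input) edge_mean :: "(pt \<Rightarrow> real) \<Rightarrow> pt list \<Rightarrow> nat \<Rightarrow> real" where
  "edge_mean f P i \<equiv> edge_avg f (vtx P i) (vtx P (Suc i))"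

lemma edge_avg_pol_affine: "edge_avg (pol a b c 0) P Q = (pol a b c 0 P + pol a b c 0 Q) / 2"
  by (simp add: edge_avg_pol) (simp add: pol_def field_simps)

lemma triangle_edge_mean:
  "(\<forall>i<length [A, B, C]. edge_mean f [A, B, C] i = u i) \<longleftrightarrow>
     edge_avg f A B = u 0 \<and> edge_avg f B C = u (Suc 0) \<and> edge_avg f C A = u (Suc (Suc 0))"
proof -
  have "length [A, B, C] = 3" by simp
  then show ?thesis by (simp only: all_less_3) (simp add: vtx_def)
qed

lemma rect_edge_mean:
  "(\<forall>i<length (rect_vertices x0 x1 y0 y1). edge_mean f (rect_vertices x0 x1 y0 y1) i = u i) \<longleftrightarrow>
     edge_avg f (pt2 x0 y0) (pt2 x1 y0) = u 0 \<and> edge_avg f (pt2 x1 y0) (pt2 x1 y1) = u (Suc 0) \<and>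
     edge_avg f (pt2 x1 y1) (pt2 x0 y1) = u (Suc (Suc 0)) \<and>
     edge_avg f (pt2 x0 y1) (pt2 x0 y0) = u (Suc (Suc (Suc 0)))"
proof -
  have "length (rect_vertices x0 x1 y0 y1) = 4" by (simp add: rect_vertices_def)
  then show ?thesis by (simp only: all_less_4) (simp add: vtx_def rect_vertices_def)
qed

lemma affine_values_exist:
  assumes "cr (B - A) (C - A) \<noteq> 0"
  shows "\<exists>a b c. pol a b c 0 A = u \<and> pol a b c 0 B = v \<and> pol a b c 0 C = w"
proof -
  define d where "d = cr (B - A) (C - A)"
  define b where "b = ((v - u) * (C - A)$2 - (w - u) * (B - A)$2) / d"
  define c where "c = ((w - u) * (B - A)$1 - (v - u) * (C - A)$1) / d"
  have d0: "d \<noteq> 0" using assms by (simp add: d_def)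
  have bd: "b * d = (v - u) * (C - A)$2 - (w - u) * (B - A)$2" "c * d = (w - u) * (B - A)$1 - (v - u) * (C - A)$1"
    using d0 by (auto simp: b_def c_def)
  have "d * (b * (B - A)$1 + c * (B - A)$2) = (b * d) * (B - A)$1 + (c * d) * (B - A)$2"
    "d * (b * (C - A)$1 + c * (C - A)$2) = (b * d) * (C - A)$1 + (c * d) * (C - A)$2"
    by (simp_all add: algebra_simps)
  then have "d * (b * (B - A)$1 + c * (B - A)$2) = d * (v - u)"
    "d * (b * (C - A)$1 + c * (C - A)$2) = d * (w - u)"
    unfolding bd by (simp_all add: d_def cr_def algebra_simps)
  then have "b * (B - A)$1 + c * (B - A)$2 = v - u" "b * (C - A)$1 + c * (C - A)$2 = w - u"
    using d0 by auto
  then show ?thesis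
    by (intro exI[of _ "u - b * A$1 - c * A$2"] exI[of _ b] exI[of _ c]) (auto simp: pol_def algebra_simps)
qed

lemma affine_values_unique:
  assumes "cr (B - A) (C - A) \<noteq> 0" "pol a b c 0 A = 0" "pol a b c 0 B = 0" "pol a b c 0 C = 0"
  shows "a = 0 \<and> b = 0 \<and> c = 0"
proof -
  have 1: "b * (B - A)$1 + c * (B - A)$2 = 0" "b * (C - A)$1 + c * (C - A)$2 = 0"
    using assms(2-4) by (auto simp: pol_def algebra_simps)
  have "b * cr (B - A) (C - A) = (b * (B - A)$1 + c * (B - A)$2) * (C - A)$2 - (b * (C - A)$1 + c * (C - A)$2) * (B - A)$2"
    "c * cr (B - A) (C - A) = (b * (C - A)$1 + c * (C - A)$2) * (B - A)$1 - (b * (B - A)$1 + c * (B - A)$2) * (C - A)$1"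
    unfolding cr_def by algebra+
  then have "b = 0" "c = 0" unfolding 1 using assms(1) by auto
  then show ?thesis using assms(2) by (simp add: pol_def)
qed

text \<open>These combinations make the system triangular: the alternating sum isolates d, and the
  opposite differences then give the slopes at the centre. The factor of d is the squared diagonal,
  so d is controlled by the diagonal however thin the rectangle is.\<close>

lemma rect_mean_relations:
  fixes x0 x1 y0 y1 a b c d :: real
  defines "f \<equiv> pol a b c d"
  defines "u0 \<equiv> edge_avg f (pt2 x0 y0) (pt2 x1 y0)" and "u1 \<equiv> edge_avg f (pt2 x1 y0) (pt2 x1 y1)"
    and "u2 \<equiv> edge_avg f (pt2 x1 y1) (pt2 x0 y1)" and "u3 \<equiv> edge_avg f (pt2 x0 y1) (pt2 x0 y0)"
  shows "u1 - u3 = (x1 - x0) * (b + d * (x0 + x1))"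
    "u2 - u0 = (y1 - y0) * (c - d * (y0 + y1))"
    "3 * (u1 + u3 - u0 - u2) = d * ((x1 - x0)\<^sup>2 + (y1 - y0)\<^sup>2)"
  unfolding u0_def u1_def u2_def u3_def f_def edge_avg_pol
  by (simp_all add: field_simps power2_eq_square)

lemma rect_bottom_mean:
  "edge_avg (pol a b c d) (pt2 x0 y0) (pt2 x1 y0)
     = a + b * (x0 + x1) / 2 + c * y0 + d * ((x0\<^sup>2 + x0 * x1 + x1\<^sup>2) / 3 - y0\<^sup>2)"
  by (simp add: edge_avg_pol field_simps power2_eq_square)

lemma unisolvent_exists:
  assumes "mesh_cell P"
  shows "\<exists>f\<in>PiT (length P). \<forall>i<length P. edge_mean f P i = u i"
  using assms
proof
  assume "is_triangle P"
  then obtain A B C where P: "P = [A, B, C]" and d: "cr (B - A) (C - A) \<noteq> 0"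
    unfolding is_triangle_def by auto
  \<comment> \<open>For affine functions an edge mean is a midpoint value, so a vertex value is the
    sum of the means on its two edges minus the mean on the opposite edge.\<close>
  obtain a b c where f: "pol a b c 0 A = u 0 + u 2 - u 1" "pol a b c 0 B = u 0 + u 1 - u 2"
    "pol a b c 0 C = u 1 + u 2 - u 0"
    using affine_values_exist[OF d] by metis
  have "pol a b c 0 \<in> PiT (length P)" unfolding PiT_iff by auto
  moreover have "\<forall>i<length P. edge_mean (pol a b c 0) P i = u i"
    unfolding P triangle_edge_mean unfolding edge_avg_pol_affine f by (simp add: numeral_2_eq_2)
  ultimately show ?thesis by blast
next
  assume "is_rectangle P"
  then obtain x0 x1 y0 y1 where P: "P = rect_vertices x0 x1 y0 y1" and xy: "x0 < x1" "y0 < y1"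
    unfolding is_rectangle_def by auto
  define d where "d = 3 * (u 1 + u 3 - u 0 - u 2) / ((x1 - x0)\<^sup>2 + (y1 - y0)\<^sup>2)"
  define b where "b = (u 1 - u 3) / (x1 - x0) - d * (x0 + x1)"
  define c where "c = (u 2 - u 0) / (y1 - y0) + d * (y0 + y1)"
  define a where "a = u 0 - (b * (x0 + x1) / 2 + c * y0 + d * ((x0\<^sup>2 + x0 * x1 + x1\<^sup>2) / 3 - y0\<^sup>2))"
  have s0: "(x1 - x0)\<^sup>2 + (y1 - y0)\<^sup>2 \<noteq> 0" using xy by (simp add: sum_power2_eq_zero_iff)
  note r = rect_mean_relations[where a=a and b=b and c=c and d=d and ?x0.0=x0 and ?x1.0=x1 and ?y0.0=y0 and ?y1.0=y1]
  have e0: "edge_avg (pol a b c d) (pt2 x0 y0) (pt2 x1 y0) = u 0"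
    unfolding rect_bottom_mean by (simp add: a_def)
  have "(x1 - x0) * (b + d * (x0 + x1)) = u 1 - u 3" using xy by (simp add: b_def)
  note e1 = r(1)[unfolded this]
  have "(y1 - y0) * (c - d * (y0 + y1)) = u 2 - u 0" using xy by (simp add: c_def)
  note e2 = r(2)[unfolded this]
  have "d * ((x1 - x0)\<^sup>2 + (y1 - y0)\<^sup>2) = 3 * (u 1 + u 3 - u 0 - u 2)" using s0 by (simp add: d_def)
  note e3 = r(3)[unfolded this]
  have "\<forall>i<length P. edge_mean (pol a b c d) P i = u i"
    unfolding P rect_edge_mean using e0 e1 e2 e3 by (simp add: eval_nat_numeral)
  moreover have "pol a b c d \<in> PiT (length P)" unfolding PiT_iff P rect_vertices_def by auto
  ultimately show ?thesis by blast
qed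

lemma unisolvent_unique:
  assumes "mesh_cell P"
    and f: "f \<in> PiT (length P)" "\<And>i. i < length P \<Longrightarrow> edge_mean f P i = 0"
  shows "f = (\<lambda>X. 0)"
  using assms(1)
proof
  assume "is_triangle P"
  then obtain A B C where P: "P = [A, B, C]" and det: "cr (B - A) (C - A) \<noteq> 0"
    unfolding is_triangle_def by auto
  obtain a b c where fe: "f = pol a b c 0" using f(1) unfolding PiT_iff P by auto
  have "\<forall>i<length P. edge_mean f P i = 0" using f(2) by auto
  then have "(pol a b c 0 A + pol a b c 0 B) = 0" "(pol a b c 0 B + pol a b c 0 C) = 0" "(pol a b c 0 C + pol a b c 0 A) = 0"
    unfolding P fe triangle_edge_mean unfolding edge_avg_pol_affine by auto
  then have "pol a b c 0 A = 0" "pol a b c 0 B = 0" "pol a b c 0 C = 0" by linarith+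
  from affine_values_unique[OF det this] show ?thesis by (auto simp: fe pol_def)
next
  assume "is_rectangle P"
  then obtain x0 x1 y0 y1 where P: "P = rect_vertices x0 x1 y0 y1" and xy: "x0 < x1" "y0 < y1"
    unfolding is_rectangle_def by auto
  obtain a b c d where fe: "f = pol a b c d" using f(1) unfolding PiT_iff by auto
  have s0: "(x1 - x0)\<^sup>2 + (y1 - y0)\<^sup>2 \<noteq> 0" using xy by (simp add: sum_power2_eq_zero_iff)
  have "\<forall>i<length P. edge_mean f P i = 0" using f(2) by auto
  then have z: "edge_avg (pol a b c d) (pt2 x0 y0) (pt2 x1 y0) = 0" "edge_avg (pol a b c d) (pt2 x1 y0) (pt2 x1 y1) = 0"
     "edge_avg (pol a b c d) (pt2 x1 y1) (pt2 x0 y1) = 0" "edge_avg (pol a b c d) (pt2 x0 y1) (pt2 x0 y0) = 0"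
    unfolding P rect_edge_mean fe by auto
  note r = rect_mean_relations[where a=a and b=b and c=c and d=d and ?x0.0=x0 and ?x1.0=x1 and ?y0.0=y0 and ?y1.0=y1, unfolded z]
  have d: "d = 0" using r(3) s0 by auto
  have b: "b = 0" using r(1) d xy by simp
  have c: "c = 0" using r(2) d xy by simp
  have "a = 0" using rect_bottom_mean[of a b c d x0 y0 x1] z d b c by simp
  then show ?thesis using b c d by (auto simp: fe pol_def)
qed

lemma PiT_eqI:
  assumes P: "mesh_cell P" and f: "f \<in> PiT (length P)" and g: "g \<in> PiT (length P)"
    and e: "\<And>i. i < length P \<Longrightarrow> edge_mean f P i = edge_mean g P i"
  shows "f = g"
proof -
  have m: "(\<lambda>X. (-1) * g X) \<in> PiT (length P)" by (rule PiT_scale[OF g])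
  have "(\<lambda>X. f X + (-1) * g X) = (\<lambda>X. 0)"
    by (rule unisolvent_unique[OF P PiT_add[OF f m]]) (subst edge_avg_add[OF f m], subst edge_avg_scale, simp add: e)
  then show ?thesis by (auto simp: fun_eq_iff)
qed

text \<open>Unisolvence makes the definite description in \<open>shape_fn\<close> proper.\<close>

lemma shape_fn:
  assumes P: "mesh_cell P"
  shows "shape_fn P i \<in> PiT (length P)"
    and "j < length P \<Longrightarrow> edge_mean (shape_fn P i) P j = (if i = j then 1 else 0)"
proof -
  have "\<exists>!f. f \<in> PiT (length P) \<and> (\<forall>j<length P. edge_mean f P j = (if i = j then 1 else 0))"
    using unisolvent_exists[OF P, of "\<lambda>j. if i = j then 1 else 0"] PiT_eqI[OF P] by (intro ex_ex1I) auto
  from theI'[OF this] show "shape_fn P i \<in> PiT (length P)"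
    and "j < length P \<Longrightarrow> edge_mean (shape_fn P i) P j = (if i = j then 1 else 0)"
    unfolding shape_fn_def by auto
qed

lemma edge_mean_shape_sum:
  assumes P: "mesh_cell P" and "j < length P"
  shows "edge_mean (\<lambda>X. \<Sum>i<length P. x i * shape_fn P i X) P j = x j"
  using assms by (simp add: edge_avg_sum[OF _ shape_fn(1)[OF P]] shape_fn(2)[OF P] if_distrib[of "\<lambda>y. _ * y"] cong: if_cong)

lemma PiT_shape_expansion:
  assumes P: "mesh_cell P" and f: "f \<in> PiT (length P)"
  shows "f = (\<lambda>X. \<Sum>i<length P. edge_mean f P i * shape_fn P i X)"
  by (rule PiT_eqI[OF P f PiT_sum[OF shape_fn(1)[OF P]]]) (simp add: edge_mean_shape_sum[OF P])

text \<open>The gradient of a Crouzeix-Raviart interpolant is the mean of the gradient, so \<theta>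
  must be the fraction of the area where the affine function is positive. One positive vertex is
  computed directly; two positive vertices are its complement.\<close>

lemma triangle_pos_avg:
  "\<exists>\<theta> \<kappa>. 0 \<le> \<theta> \<and> \<theta> \<le> 1 \<and> pos_avg a b = \<theta> * ((a + b) / 2) + \<kappa> \<and>
     pos_avg b c = \<theta> * ((b + c) / 2) + \<kappa> \<and> pos_avg c a = \<theta> * ((c + a) / 2) + \<kappa>" (is "?P a b c")
proof -
  have nonneg: "pos_avg x y = (x + y) / 2" if "0 \<le> x" "0 \<le> y" for x y :: real
    using that by (auto simp: pos_avg_eq divide_simps) (simp add: power2_eq_square algebra_simps)
  have nonpos: "pos_avg x y = 0" if "x \<le> 0" "y \<le> 0" for x y :: real
    using that by (auto simp: pos_avg_eq)
  have one: "?P a b c" if "a > 0" "b \<le> 0" "c \<le> 0" for a b c :: real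
  proof -
    \<comment> \<open>The cut-off triangle is the whole one scaled by a / (a - b) and a / (a - c)
      along the two edges at the positive vertex. The constant is then forced by the vanishing mean
      on the opposite edge.\<close>
    define \<theta> where "\<theta> = a\<^sup>2 / ((a - b) * (a - c))"
    have "a * a \<le> (a - b) * (a - c)" using that by (intro mult_mono) auto
    then have "\<theta> \<le> 1" using that by (simp add: \<theta>_def divide_simps power2_eq_square)
    moreover have "0 \<le> \<theta>" using that by (simp add: \<theta>_def)
    moreover have "pos_avg a b = a\<^sup>2 / (2 * (a - b))" "pos_avg c a = a\<^sup>2 / (2 * (a - c))"
      using that by (auto simp: pos_avg_eq max_def divide_simps) (simp_all add: algebra_simps)
    moreover have "pos_avg b c = 0" using that nonpos by auto
    moreover have "a\<^sup>2 / (2 * (a - b)) = \<theta> * ((a + b) / 2) + - \<theta> * ((b + c) / 2)"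
       "a\<^sup>2 / (2 * (a - c)) = \<theta> * ((c + a) / 2) + - \<theta> * ((b + c) / 2)"
      using that by (simp_all add: \<theta>_def divide_simps) (simp_all add: algebra_simps)
    ultimately show ?thesis by (intro exI[of _ \<theta>] exI[of _ "- \<theta> * ((b + c) / 2)"]) auto
  qed
  have neg: "?P a b c" if n: "?P (- a) (- b) (- c)" for a b c
  proof -
    from n obtain \<theta> \<kappa> where t: "0 \<le> \<theta>" "\<theta> \<le> 1" "pos_avg (- a) (- b) = \<theta> * ((- a + - b) / 2) + \<kappa>"
      "pos_avg (- b) (- c) = \<theta> * ((- b + - c) / 2) + \<kappa>" "pos_avg (- c) (- a) = \<theta> * ((- c + - a) / 2) + \<kappa>" by blast
    have e: "p = (1 - \<theta>) * ((x + y) / 2) + \<kappa>" if "p - (x + y) / 2 = \<theta> * ((- x + - y) / 2) + \<kappa>" for p x y :: real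
      using that by (simp add: field_simps)
    show ?thesis
      using t unfolding pos_avg_minus
      by (intro exI[of _ "1 - \<theta>"] exI[of _ \<kappa>] conjI e) auto
  qed
  have rot: "?P b c a \<Longrightarrow> ?P a b c" for a b c by blast
  consider "0 \<le> a" "0 \<le> b" "0 \<le> c" | "a \<le> 0" "b \<le> 0" "c \<le> 0"
    | "a > 0" "b \<le> 0" "c \<le> 0" | "b > 0" "c \<le> 0" "a \<le> 0" | "c > 0" "a \<le> 0" "b \<le> 0"
    | "a < 0" "b \<ge> 0" "c \<ge> 0" | "b < 0" "c \<ge> 0" "a \<ge> 0" | "c < 0" "a \<ge> 0" "b \<ge> 0" by linarith
  then show ?thesis
  proof cases
    case 1
    then show ?thesis by (intro exI[of _ 1] exI[of _ 0]) (auto simp: nonneg)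
  next
    case 2
    then show ?thesis by (intro exI[of _ 0]) (auto simp: nonpos)
  next
    case 3
    then show ?thesis by (rule one)
  next
    case 4
    then show ?thesis using one[of b c a] rot by blast
  next
    case 5
    then show ?thesis using one[of c a b] rot by blast
  next
    case 6
    then show ?thesis using neg one[of "- a" "- b" "- c"] by auto
  next
    case 7
    then show ?thesis using neg[of a b c] rot[of "-a" "-b" "-c"] one[of "- b" "- c" "- a"] by auto
  next
    case 8
    then show ?thesis using neg[of a b c] rot[of "-a" "-b" "-c"] rot[of "-b" "-c" "-a"] one[of "- c" "- a" "- b"] by auto
  qed
qed

definition pos_interp :: "pt list \<Rightarrow> pt \<Rightarrow> pt \<Rightarrow> pt \<Rightarrow> real" where
  "pos_interp P n D = (\<lambda>X. \<Sum>i<length P. pos_avg (n \<bullet> (vtx P i - D)) (n \<bullet> (vtx P (Suc i) - D)) * shape_fn P i X)"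

lemma pos_interp:
  assumes P: "mesh_cell P"
  shows "pos_interp P n D \<in> PiT (length P)"
    and "i < length P \<Longrightarrow> edge_mean (pos_interp P n D) P i = pos_avg (n \<bullet> (vtx P i - D)) (n \<bullet> (vtx P (Suc i) - D))"
  unfolding pos_interp_def by (rule PiT_sum[OF shape_fn(1)[OF P]]) (rule edge_mean_shape_sum[OF P])

lemma triangle_gradient:
  assumes "is_triangle P"
  shows "\<exists>\<theta>. 0 \<le> \<theta> \<and> \<theta> \<le> 1 \<and> (\<forall>F v. dderiv (pos_interp P n D) F v = \<theta> * (n \<bullet> v))"
proof -
  obtain A B C where P: "P = [A, B, C]" and det: "cr (B - A) (C - A) \<noteq> 0"
    using assms unfolding is_triangle_def by auto
  obtain \<theta> \<kappa> where t: "0 \<le> \<theta>" "\<theta> \<le> 1"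
    "pos_avg (n \<bullet> (A - D)) (n \<bullet> (B - D)) = \<theta> * ((n \<bullet> (A - D) + n \<bullet> (B - D)) / 2) + \<kappa>"
    "pos_avg (n \<bullet> (B - D)) (n \<bullet> (C - D)) = \<theta> * ((n \<bullet> (B - D) + n \<bullet> (C - D)) / 2) + \<kappa>"
    "pos_avg (n \<bullet> (C - D)) (n \<bullet> (A - D)) = \<theta> * ((n \<bullet> (C - D) + n \<bullet> (A - D)) / 2) + \<kappa>"
    using triangle_pos_avg by metis
  have aff: "(\<lambda>X. \<theta> * (n \<bullet> (X - D))) \<in> PiT (length P)" by (rule PiT_scale[OF PiT_affine])
  define w where "w = (\<lambda>X. \<theta> * (n \<bullet> (X - D)) + \<kappa>)"
  have w: "w \<in> PiT (length P)" unfolding w_def by (rule PiT_add[OF aff PiT_const])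
  have wa: "edge_avg w X Y = \<theta> * ((n \<bullet> (X - D) + n \<bullet> (Y - D)) / 2) + \<kappa>" for X Y
    unfolding w_def edge_avg_add[OF aff PiT_const] edge_avg_scale edge_avg_affine by (simp add: edge_avg_def)
  have "\<forall>i<length P. edge_mean w P i = pos_avg (n \<bullet> (vtx P i - D)) (n \<bullet> (vtx P (Suc i) - D))"
    unfolding P triangle_edge_mean unfolding wa using t by (simp add: vtx_def)
  then have e: "pos_interp P n D = w"
    by (intro PiT_eqI[of P]) (use assms pos_interp(1)[of P n D] pos_interp(2)[of P _ n D] w in auto)
  have "dderiv w F v = \<theta> * (n \<bullet> v)" for F v
    unfolding w_def dderiv_add[OF aff PiT_const] dderiv_scale[OF PiT_affine] dderiv_const dderiv_affine by simp
  then show ?thesis unfolding e using t by blast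
qed

lemma norm_pt: "(norm (n::pt))\<^sup>2 = (n$1)\<^sup>2 + (n$2)\<^sup>2"
  by (simp add: norm_vec_def L2_set_def sum_2)

text \<open>\<open>b\<close> and \<open>c\<close> are the slopes at the centre, bounded by the
  Lipschitz estimate for opposite edges, and \<open>d\<close> is bounded through the squared
  diagonal; no bound involves the aspect ratio. The last clause is the inequality for
  \<open>rect_form\<close>, translated back to points of the line L = 0.\<close>

lemma rect_gradient:
  fixes x0 x1 y0 y1 :: real and n D :: pt
  defines "P \<equiv> rect_vertices x0 x1 y0 y1"
  defines "R \<equiv> sqrt ((x1 - x0)\<^sup>2 + (y1 - y0)\<^sup>2)"
  assumes xy: "x0 < x1" "y0 < y1" and n: "norm n = 1" and D: "x0 \<le> D$1" "D$1 \<le> x1" "y0 \<le> D$2" "D$2 \<le> y1"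
  obtains b c d where "\<And>F v. dderiv (pos_interp P n D) F v
        = b * v$1 + c * v$2 + 2 * d * ((F$1 - (x0 + x1) / 2) * v$1 - (F$2 - (y0 + y1) / 2) * v$2)"
    "\<bar>b\<bar> \<le> 1" "\<bar>c\<bar> \<le> 1" "\<bar>d\<bar> * R \<le> 6"
    "\<And>F. x0 \<le> F$1 \<Longrightarrow> F$1 \<le> x1 \<Longrightarrow> y0 \<le> F$2 \<Longrightarrow> F$2 \<le> y1 \<Longrightarrow> n \<bullet> (F - D) = 0 \<Longrightarrow>
        0 \<le> dderiv (pos_interp P n D) F n \<and> dderiv (pos_interp P n D) F n \<le> 1"
proof -
  let ?G = "dderiv (pos_interp P n D)"
  have Pr: "mesh_cell P" unfolding is_rectangle_def P_def using xy by auto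
  define L where "L X = n \<bullet> (X - D)" for X
  have LX: "L X = n$1 * (X$1 - D$1) + n$2 * (X$2 - D$2)" for X
    by (simp add: L_def inner_vec_def sum_2)
  define l0 l1 l2 l3 where l: "l0 = L (pt2 x0 y0)" "l1 = L (pt2 x1 y0)" "l2 = L (pt2 x1 y1)" "l3 = L (pt2 x0 y1)"
  have n1: "(n$1)\<^sup>2 + (n$2)\<^sup>2 = 1" using norm_pt[of n] n by simp
  have n2: "\<bar>n$1\<bar> \<le> 1" "\<bar>n$2\<bar> \<le> 1" using component_le_norm_cart[of n] n by auto
  define W H where WH: "W = x1 - x0" "H = y1 - y0"
  have pos: "0 < W" "0 < H" using xy by (auto simp: WH)
  have R2: "R\<^sup>2 = W\<^sup>2 + H\<^sup>2" by (simp add: R_def WH)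
  have R0: "0 < R" using pos by (simp add: R_def WH[symmetric] sum_power2_gt_zero_iff)
  obtain a b c d where w: "pos_interp P n D = pol a b c d"
    using pos_interp(1)[OF Pr, of n D] unfolding PiT_iff by auto
  have "\<forall>i<length P. edge_mean (pos_interp P n D) P i = pos_avg (L (vtx P i)) (L (vtx P (Suc i)))"
    using pos_interp(2)[OF Pr, of _ n D] by (auto simp: L_def)
  then have u: "edge_avg (pol a b c d) (pt2 x0 y0) (pt2 x1 y0) = pos_avg l0 l1"
      "edge_avg (pol a b c d) (pt2 x1 y0) (pt2 x1 y1) = pos_avg l1 l2"
      "edge_avg (pol a b c d) (pt2 x1 y1) (pt2 x0 y1) = pos_avg l2 l3"
      "edge_avg (pol a b c d) (pt2 x0 y1) (pt2 x0 y0) = pos_avg l3 l0"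
    unfolding P_def rect_edge_mean w[unfolded P_def] by (auto simp: vtx_def rect_vertices_def l)
  define b' c' where bc: "b' = b + d * (x0 + x1)" "c' = c - d * (y0 + y1)"
  note r = rect_mean_relations[where a=a and b=b and c=c and d=d and ?x0.0=x0 and ?x1.0=x1 and ?y0.0=y0 and ?y1.0=y1,
      unfolded u WH[symmetric] bc[symmetric]]
  have grad: "?G F v
        = b' * v$1 + c' * v$2 + 2 * d * ((F$1 - (x0 + x1) / 2) * v$1 - (F$2 - (y0 + y1) / 2) * v$2)" for F v
    unfolding w dderiv_pol bc by (simp add: field_simps)
  have ls: "l1 = l0 + n$1 * W" "l2 = l3 + n$1 * W" "l3 = l0 + n$2 * H" "l2 = l1 + n$2 * H"
    by (auto simp: l LX WH algebra_simps)
  have "\<bar>pos_avg l1 l2 - pos_avg l3 l0\<bar> \<le> \<bar>n$1 * W\<bar>"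
    using pos_avg_lipschitz[of l0 "n$1 * W" l3] unfolding ls(1,2) by (simp add: pos_avg_sym)
  also have "\<dots> \<le> W" using n2 pos by (auto simp: abs_mult intro: mult_left_le_one_le)
  finally have "W * \<bar>b'\<bar> \<le> W * 1" unfolding r(1) using pos by (simp add: abs_mult)
  then have b1: "\<bar>b'\<bar> \<le> 1" using pos by simp
  have "\<bar>pos_avg l2 l3 - pos_avg l0 l1\<bar> \<le> \<bar>n$2 * H\<bar>"
    using pos_avg_lipschitz[of l0 "n$2 * H" l1] unfolding ls(3,4) by (simp add: pos_avg_sym)
  also have "\<dots> \<le> H" using n2 pos by (auto simp: abs_mult intro: mult_left_le_one_le)
  finally have "H * \<bar>c'\<bar> \<le> H * 1" unfolding r(2) using pos by (simp add: abs_mult)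
  then have c1: "\<bar>c'\<bar> \<le> 1" using pos by simp
  \<comment> \<open>D lies in the rectangle, so L is at most the diagonal R there and all four means
    lie in [0, R]. The alternating sum is then at most 2 R, whence |d| R^2 \<le> 6 R.\<close>
  have LR: "L X \<le> R" if "x0 \<le> X$1" "X$1 \<le> x1" "y0 \<le> X$2" "X$2 \<le> y1" for X
  proof -
    have "L X \<le> norm n * norm (X - D)" unfolding L_def by (rule norm_cauchy_schwarz)
    also have "norm (X - D) \<le> R"
    proof (rule power2_le_imp_le)
      have "((X - D)$1)\<^sup>2 \<le> W\<^sup>2" "((X - D)$2)\<^sup>2 \<le> H\<^sup>2"
        using that D pos by (auto simp: WH intro!: abs_le_square_iff[THEN iffD1])
      then show "(norm (X - D))\<^sup>2 \<le> R\<^sup>2" unfolding norm_pt R2 by linarith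
    qed (use R0 in auto)
    finally show ?thesis using n by simp
  qed
  have lR: "l0 \<le> R" "l1 \<le> R" "l2 \<le> R" "l3 \<le> R" unfolding l using xy by (auto intro!: LR)
  have m: "0 \<le> pos_avg x y \<and> pos_avg x y \<le> R" if "x \<le> R" "y \<le> R" for x y
    using pos_avg_bounds[of x y] that R0 by auto
  have "\<bar>pos_avg l1 l2 + pos_avg l3 l0 - pos_avg l0 l1 - pos_avg l2 l3\<bar> \<le> 2 * R"
    using m[of l1 l2] m[of l3 l0] m[of l0 l1] m[of l2 l3] lR by (auto simp: abs_le_iff)
  then have "\<bar>d * R\<^sup>2\<bar> \<le> 6 * R" using r(3) unfolding R2 by (auto simp: abs_le_iff)
  then have "R * (\<bar>d\<bar> * R) \<le> R * 6" using R0 by (simp add: abs_mult power2_eq_square mult_ac)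
  then have d1: "\<bar>d\<bar> * R \<le> 6" using R0 by simp
  have line: "0 \<le> ?G F n \<and> ?G F n \<le> 1"
    if F: "x0 \<le> F$1" "F$1 \<le> x1" "y0 \<le> F$2" "F$2 \<le> y1" "n \<bullet> (F - D) = 0" for F
  proof -
    define S where "S = W\<^sup>2 + H\<^sup>2"
    have S0: "0 < S" using pos by (simp add: S_def sum_power2_gt_zero_iff)
    \<comment> \<open>The weights and normalised coordinates for which \<open>rect_form\<close>
      equals \<open>Q\<close> times the normal derivative.\<close>
    define p q where pq: "p = W\<^sup>2 / S" "q = H\<^sup>2 / S"
    have pq1: "0 \<le> p" "0 \<le> q" "p + q = 1" using S0 by (auto simp: pq add_divide_distrib[symmetric] S_def)
    define \<alpha> \<beta> \<xi> \<eta> z where defs: "\<alpha> = n$1 * W / 2" "\<beta> = n$2 * H / 2" "\<xi> = (F$1 - (x0 + x1) / 2) / (W / 2)"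
      "\<eta> = (F$2 - (y0 + y1) / 2) / (H / 2)" "z = L (pt2 ((x0 + x1) / 2) ((y0 + y1) / 2))"
    have xe: "\<bar>\<xi>\<bar> \<le> 1" "\<bar>\<eta>\<bar> \<le> 1" using F pos by (auto simp: defs WH abs_le_iff divide_simps)
    have ae: "\<alpha> * \<xi> = n$1 * (F$1 - (x0 + x1) / 2)" "\<beta> * \<eta> = n$2 * (F$2 - (y0 + y1) / 2)"
      using pos by (auto simp: defs)
    have ze: "z + \<alpha> * \<xi> + \<beta> * \<eta> = 0"
      using F(5) unfolding ae defs(5) L_def[symmetric] LX by (simp add: algebra_simps)
    have le: "z - \<alpha> - \<beta> = l0" "z + \<alpha> - \<beta> = l1" "z + \<alpha> + \<beta> = l2" "z - \<alpha> + \<beta> = l3"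
      by (auto simp: defs l LX WH field_simps)
    define Q where "Q = W\<^sup>2 * H\<^sup>2 / (4 * S)"
    have Q0: "0 < Q" using pos S0 by (simp add: Q_def)
    have G: "rect_form p q \<alpha> \<beta> z \<xi> \<eta> = Q * ?G F n"
    proof -
      have "rect_form p q \<alpha> \<beta> z \<xi> \<eta> = q * \<alpha> * (W * b') / 2 + p * \<beta> * (H * c') / 2
          + p * q / 2 * (3 * (pos_avg l1 l2 + pos_avg l3 l0 - pos_avg l0 l1 - pos_avg l2 l3)) * (\<alpha> * \<xi> - \<beta> * \<eta>)"
        unfolding rect_form_def Let_def le r(1,2) by simp
      also have "p * q / 2 * (3 * (pos_avg l1 l2 + pos_avg l3 l0 - pos_avg l0 l1 - pos_avg l2 l3)) = p * q * S * d / 2"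
        unfolding r(3) S_def by simp
      also have "p * q * S = 4 * Q" unfolding pq Q_def using S0 by (simp add: field_simps)
      also have "q * \<alpha> * (W * b') / 2 = Q * (b' * n$1)" unfolding pq Q_def defs using S0
        by (simp add: field_simps power2_eq_square)
      also have "p * \<beta> * (H * c') / 2 = Q * (c' * n$2)" unfolding pq Q_def defs using S0
        by (simp add: field_simps power2_eq_square)
      finally show ?thesis unfolding grad ae by (simp add: algebra_simps)
    qed
    \<comment> \<open>Since n is a unit vector, the upper bound of the form is exactly
      \<open>Q\<close>.\<close>
    have Qe: "q * \<alpha>\<^sup>2 + p * \<beta>\<^sup>2 = Q * 1"
      unfolding n1[symmetric] pq Q_def defs using S0 by (simp add: field_simps power2_eq_square)
    have "0 \<le> Q * ?G F n" "Q * ?G F n \<le> Q * 1"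
      using rect_form_nonneg[OF pq1 xe ze] rect_form_le[OF pq1 xe ze] unfolding G Qe by auto
    then show ?thesis using Q0 by (simp add: zero_le_mult_iff)
  qed
  show ?thesis by (rule that[OF grad b1 c1 d1 line])
qed

subsection \<open>Boundary of an element and the two sides of the line\<close>

lemma inner_pt: "(a::pt) \<bullet> b = a$1 * b$1 + a$2 * b$2"
  by (simp add: inner_vec_def sum_2)

lemma pt_eqI: "X$1 = Y$1 \<Longrightarrow> X$2 = Y$2 \<Longrightarrow> X = (Y::pt)"
  by (simp add: vec_eq_iff forall_2)

lemma segment_horizontal:
  assumes "x0 \<le> x1"
  shows "closed_segment (pt2 x0 y) (pt2 x1 y) = {X. x0 \<le> X$1 \<and> X$1 \<le> x1 \<and> X$2 = y}"
proof (intro set_eqI iffI)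
  fix X assume "X \<in> closed_segment (pt2 x0 y) (pt2 x1 y)"
  then obtain u where u: "0 \<le> u" "u \<le> 1" "X = (1 - u) *\<^sub>R pt2 x0 y + u *\<^sub>R pt2 x1 y"
    unfolding closed_segment_def by auto
  then have "X$1 = x0 + u * (x1 - x0)" "X$2 = y" unfolding u(3) by (auto simp: algebra_simps)
  moreover have "u * (x1 - x0) \<le> x1 - x0" "0 \<le> u * (x1 - x0)" using u assms by (auto intro: mult_left_le_one_le)
  ultimately show "X \<in> {X. x0 \<le> X$1 \<and> X$1 \<le> x1 \<and> X$2 = y}" by auto
next
  fix X :: pt assume X: "X \<in> {X. x0 \<le> X$1 \<and> X$1 \<le> x1 \<and> X$2 = y}"
  show "X \<in> closed_segment (pt2 x0 y) (pt2 x1 y)"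
  proof (cases "x0 = x1")
    case True
    then have "X = pt2 x0 y" using X by (intro pt_eqI) auto
    then show ?thesis by simp
  next
    case False
    then have p: "x0 < x1" using assms by simp
    define u where "u = (X$1 - x0) / (x1 - x0)"
    have u: "0 \<le> u" "u \<le> 1" "u * (x1 - x0) = X$1 - x0" using X p by (auto simp: u_def)
    have "X = (1 - u) *\<^sub>R pt2 x0 y + u *\<^sub>R pt2 x1 y"
      by (rule pt_eqI) (use X u(3) in \<open>auto simp: algebra_simps\<close>)
    then show ?thesis unfolding in_segment using u by blast
  qed
qed

lemma segment_vertical:
  assumes "y0 \<le> y1"
  shows "closed_segment (pt2 x y0) (pt2 x y1) = {X. y0 \<le> X$2 \<and> X$2 \<le> y1 \<and> X$1 = x}"
proof (intro set_eqI iffI)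
  fix X assume "X \<in> closed_segment (pt2 x y0) (pt2 x y1)"
  then obtain u where u: "0 \<le> u" "u \<le> 1" "X = (1 - u) *\<^sub>R pt2 x y0 + u *\<^sub>R pt2 x y1"
    unfolding closed_segment_def by auto
  then have "X$2 = y0 + u * (y1 - y0)" "X$1 = x" unfolding u(3) by (auto simp: algebra_simps)
  moreover have "u * (y1 - y0) \<le> y1 - y0" "0 \<le> u * (y1 - y0)" using u assms by (auto intro: mult_left_le_one_le)
  ultimately show "X \<in> {X. y0 \<le> X$2 \<and> X$2 \<le> y1 \<and> X$1 = x}" by auto
next
  fix X :: pt assume X: "X \<in> {X. y0 \<le> X$2 \<and> X$2 \<le> y1 \<and> X$1 = x}"
  show "X \<in> closed_segment (pt2 x y0) (pt2 x y1)"
  proof (cases "y0 = y1")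
    case True
    then have "X = pt2 x y0" using X by (intro pt_eqI) auto
    then show ?thesis by simp
  next
    case False
    then have p: "y0 < y1" using assms by simp
    define u where "u = (X$2 - y0) / (y1 - y0)"
    have u: "0 \<le> u" "u \<le> 1" "u * (y1 - y0) = X$2 - y0" using X p by (auto simp: u_def)
    have "X = (1 - u) *\<^sub>R pt2 x y0 + u *\<^sub>R pt2 x y1"
      by (rule pt_eqI) (use X u(3) in \<open>auto simp: algebra_simps\<close>)
    then show ?thesis unfolding in_segment using u by blast
  qed
qed

lemma length_rect_vertices [simp]: "length (rect_vertices x0 x1 y0 y1) = 4"
  by (simp add: rect_vertices_def)

lemma rect_edges:
  assumes "x0 \<le> x1" "y0 \<le> y1"
  shows "edge (rect_vertices x0 x1 y0 y1) 0 = {X. x0 \<le> X$1 \<and> X$1 \<le> x1 \<and> X$2 = y0}"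
    "edge (rect_vertices x0 x1 y0 y1) (Suc 0) = {X. y0 \<le> X$2 \<and> X$2 \<le> y1 \<and> X$1 = x1}"
    "edge (rect_vertices x0 x1 y0 y1) (Suc (Suc 0)) = {X. x0 \<le> X$1 \<and> X$1 \<le> x1 \<and> X$2 = y1}"
    "edge (rect_vertices x0 x1 y0 y1) (Suc (Suc (Suc 0))) = {X. y0 \<le> X$2 \<and> X$2 \<le> y1 \<and> X$1 = x0}"
proof -
  have "edge (rect_vertices x0 x1 y0 y1) (Suc (Suc 0)) = closed_segment (pt2 x0 y1) (pt2 x1 y1)"
    "edge (rect_vertices x0 x1 y0 y1) (Suc (Suc (Suc 0))) = closed_segment (pt2 x0 y0) (pt2 x0 y1)"
    by (simp_all add: edge_def vtx_def rect_vertices_def closed_segment_commute)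
  then show "edge (rect_vertices x0 x1 y0 y1) (Suc (Suc 0)) = {X. x0 \<le> X$1 \<and> X$1 \<le> x1 \<and> X$2 = y1}"
    "edge (rect_vertices x0 x1 y0 y1) (Suc (Suc (Suc 0))) = {X. y0 \<le> X$2 \<and> X$2 \<le> y1 \<and> X$1 = x0}"
    by (simp_all add: segment_horizontal segment_vertical assms)
qed (simp_all add: edge_def vtx_def rect_vertices_def segment_horizontal segment_vertical assms)

lemma elem_rect:
  assumes "x0 \<le> x1" "y0 \<le> y1"
  shows "elem (rect_vertices x0 x1 y0 y1) = cbox (pt2 x0 y0) (pt2 x1 y1)"
proof
  show "elem (rect_vertices x0 x1 y0 y1) \<subseteq> cbox (pt2 x0 y0) (pt2 x1 y1)"
    unfolding elem_def
    by (rule hull_minimal) (use assms in \<open>auto simp: rect_vertices_def mem_box_cart forall_2 convex_box\<close>)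
  have c: "convex (elem (rect_vertices x0 x1 y0 y1))" unfolding elem_def by (rule convex_convex_hull)
  have v: "pt2 x0 y0 \<in> elem (rect_vertices x0 x1 y0 y1)" "pt2 x1 y0 \<in> elem (rect_vertices x0 x1 y0 y1)"
     "pt2 x1 y1 \<in> elem (rect_vertices x0 x1 y0 y1)" "pt2 x0 y1 \<in> elem (rect_vertices x0 x1 y0 y1)"
    unfolding elem_def by (auto simp: rect_vertices_def intro: hull_inc)
  show "cbox (pt2 x0 y0) (pt2 x1 y1) \<subseteq> elem (rect_vertices x0 x1 y0 y1)"
  proof
    fix X assume "X \<in> cbox (pt2 x0 y0) (pt2 x1 y1)"
    then have X: "x0 \<le> X$1" "X$1 \<le> x1" "y0 \<le> X$2" "X$2 \<le> y1" by (auto simp: mem_box_cart forall_2)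
    have b: "pt2 (X$1) y0 \<in> closed_segment (pt2 x0 y0) (pt2 x1 y0)" "pt2 (X$1) y1 \<in> closed_segment (pt2 x0 y1) (pt2 x1 y1)"
      using X assms by (auto simp: segment_horizontal)
    have "pt2 (X$1) y0 \<in> elem (rect_vertices x0 x1 y0 y1)" "pt2 (X$1) y1 \<in> elem (rect_vertices x0 x1 y0 y1)"
      using b closed_segment_subset[OF v(1) v(2) c] closed_segment_subset[OF v(4) v(3) c] by auto
    moreover have "X \<in> closed_segment (pt2 (X$1) y0) (pt2 (X$1) y1)"
      using X assms by (auto simp: segment_vertical)
    ultimately show "X \<in> elem (rect_vertices x0 x1 y0 y1)"
      using closed_segment_subset[OF _ _ c] by blast
  qed
qed

lemma UN_less_3: "(\<Union>i<3. f i) = f 0 \<union> f (Suc 0) \<union> f (Suc (Suc 0))"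
  by (auto simp: eval_nat_numeral less_Suc_eq)

lemma UN_less_4: "(\<Union>i<4. f i) = f 0 \<union> f (Suc 0) \<union> f (Suc (Suc 0)) \<union> f (Suc (Suc (Suc 0)))"
  by (auto simp: eval_nat_numeral less_Suc_eq)

lemma frontier_elem:
  assumes "mesh_cell P"
  shows "frontier (elem P) = (\<Union>i<length P. edge P i)"
  using assms
proof
  assume "is_triangle P"
  then obtain A B C where P: "P = [A, B, C]" unfolding is_triangle_def by auto
  have "frontier (elem P) = closed_segment A B \<union> closed_segment B C \<union> closed_segment C A"
    unfolding elem_def P using frontier_of_triangle[of A B C] by simp
  also have "\<dots> = (\<Union>i<3. edge P i)"
    unfolding UN_less_3 by (simp add: edge_def vtx_def P)
  finally show ?thesis by (simp add: P numeral_3_eq_3)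
next
  assume "is_rectangle P"
  then obtain x0 x1 y0 y1 where P: "P = rect_vertices x0 x1 y0 y1" and xy: "x0 < x1" "y0 < y1"
    unfolding is_rectangle_def by auto
  have ne: "box (pt2 x0 y0) (pt2 x1 y1) \<noteq> {}"
  proof -
    have "pt2 ((x0 + x1) / 2) ((y0 + y1) / 2) \<in> box (pt2 x0 y0) (pt2 x1 y1)"
      using xy by (auto simp: mem_box_cart forall_2)
    then show ?thesis by blast
  qed
  have "frontier (elem P) = cbox (pt2 x0 y0) (pt2 x1 y1) - box (pt2 x0 y0) (pt2 x1 y1)"
    using xy ne by (simp add: P elem_rect frontier_cbox)
  also have "\<dots> = (\<Union>i<4. edge P i)"
    unfolding UN_less_4 unfolding P rect_edges[OF less_imp_le[OF xy(1)] less_imp_le[OF xy(2)]] using xy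
    by (auto simp: mem_box_cart forall_2)
  finally show ?thesis by (simp add: P)
qed

lemma closed_elem: "closed (elem P)" and convex_elem: "convex (elem P)"
  unfolding elem_def by (auto intro: compact_imp_closed finite_imp_compact_convex_hull)

text \<open>A line that carries one edge of a nondegenerate cell meets the cell in that edge only.
  Combined with (H2) this excludes an edge with L = 0 at both ends, since D and E would both lie on
  it.\<close>

lemma zero_line_in_edge:
  assumes P: "mesh_cell P" and n: "n \<noteq> (0::pt)" and i: "i < length P"
    and z: "n \<bullet> (vtx P i - D) = 0" "n \<bullet> (vtx P (Suc i) - D) = 0"
    and X: "X \<in> elem P" "n \<bullet> (X - D) = 0"
  shows "X \<in> edge P i"
  using P
proof
  assume "is_triangle P"
  then obtain A B C where P: "P = [A, B, C]" and det: "cr (B - A) (C - A) \<noteq> 0"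
    unfolding is_triangle_def by auto
  have main: "X \<in> closed_segment A B"
    if det: "cr (B - A) (C - A) \<noteq> 0" and z: "n \<bullet> (A - D) = 0" "n \<bullet> (B - D) = 0" and X: "X \<in> convex hull {A, B, C}" for A B C
  proof -
    obtain u v w where uvw: "0 \<le> u" "0 \<le> v" "0 \<le> w" "u + v + w = 1" "X = u *\<^sub>R A + v *\<^sub>R B + w *\<^sub>R C"
      using X unfolding convex_hull_3 by auto
    have "n \<bullet> (X - D) = u * (n \<bullet> (A - D)) + v * (n \<bullet> (B - D)) + w * (n \<bullet> (C - D)) + (u + v + w - 1) * (n \<bullet> D)"
      unfolding uvw(5) by (simp add: inner_diff_right inner_add_right algebra_simps)
    \<comment> \<open>In barycentric coordinates L(X) is the weight of C times L(C). Nondegeneracy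
      makes L(C) nonzero, so the weight vanishes.\<close>
    then have wC: "w * (n \<bullet> (C - D)) = 0" using z assms(7) uvw(4) by simp
    have "n \<bullet> (C - D) \<noteq> 0"
    proof
      assume "n \<bullet> (C - D) = 0"
      then have "n \<bullet> (B - A) = 0" "n \<bullet> (C - A) = 0" using z by (auto simp: inner_diff_right)
      then have e: "n$1 * (B - A)$1 + n$2 * (B - A)$2 = 0" "n$1 * (C - A)$1 + n$2 * (C - A)$2 = 0"
        by (auto simp: inner_pt)
      have "n$1 * cr (B - A) (C - A) = (n$1 * (B - A)$1 + n$2 * (B - A)$2) * (C - A)$2 - (n$1 * (C - A)$1 + n$2 * (C - A)$2) * (B - A)$2"
        "n$2 * cr (B - A) (C - A) = (n$1 * (C - A)$1 + n$2 * (C - A)$2) * (B - A)$1 - (n$1 * (B - A)$1 + n$2 * (B - A)$2) * (C - A)$1"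
        unfolding cr_def by algebra+
      then have "n$1 = 0" "n$2 = 0" unfolding e using det by auto
      then show False using n by (auto intro: pt_eqI)
    qed
    then have "w = 0" using wC by simp
    then have "X = (1 - v) *\<^sub>R A + v *\<^sub>R B" "v \<le> 1" using uvw by (auto simp: eq_diff_eq)
    then show ?thesis using uvw(2) unfolding in_segment by blast
  qed
  have i3: "i = 0 \<or> i = Suc 0 \<or> i = Suc (Suc 0)" using i P by auto
  have h: "X \<in> convex hull {A, B, C}" "X \<in> convex hull {B, C, A}" "X \<in> convex hull {C, A, B}"
    using X(1) by (auto simp: elem_def P insert_commute)
  have d: "cr (C - B) (A - B) \<noteq> 0" "cr (A - C) (B - C) \<noteq> 0"
    using det by (auto simp: cr_def algebra_simps)
  show ?thesis using i3 z main[OF det _ _ h(1)] main[OF d(1) _ _ h(2)] main[OF d(2) _ _ h(3)]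
    by (auto simp: P edge_def vtx_def)
next
  assume "is_rectangle P"
  then obtain x0 x1 y0 y1 where P: "P = rect_vertices x0 x1 y0 y1" and xy: "x0 < x1" "y0 < y1"
    unfolding is_rectangle_def by auto
  have n12: "n$1 \<noteq> 0 \<or> n$2 \<noteq> 0" using n by (auto intro: pt_eqI)
  have Xb: "x0 \<le> X$1" "X$1 \<le> x1" "y0 \<le> X$2" "X$2 \<le> y1"
    using X(1) xy by (auto simp: P elem_rect mem_box_cart forall_2)
  have L: "n \<bullet> (Y - D) = n$1 * (Y$1 - D$1) + n$2 * (Y$2 - D$2)" for Y by (simp add: inner_pt)
  have i4: "i = 0 \<or> i = Suc 0 \<or> i = Suc (Suc 0) \<or> i = Suc (Suc (Suc 0))" using i P by auto
  have hor: "X$2 = y" if "n$1 * (x0 - D$1) + n$2 * (y - D$2) = 0" "n$1 * (x1 - D$1) + n$2 * (y - D$2) = 0" for y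
  proof -
    have "n$1 * (x1 - x0) = (n$1 * (x1 - D$1) + n$2 * (y - D$2)) - (n$1 * (x0 - D$1) + n$2 * (y - D$2))"
      by algebra
    then have n1: "n$1 = 0" using xy that by simp
    then have "n$2 * (X$2 - y) = 0" using that X(2) unfolding L by auto
    then show ?thesis using n1 n12 by simp
  qed
  have ver: "X$1 = x" if "n$1 * (x - D$1) + n$2 * (y0 - D$2) = 0" "n$1 * (x - D$1) + n$2 * (y1 - D$2) = 0" for x
  proof -
    have "n$2 * (y1 - y0) = (n$1 * (x - D$1) + n$2 * (y1 - D$2)) - (n$1 * (x - D$1) + n$2 * (y0 - D$2))"
      by algebra
    then have n1: "n$2 = 0" using xy that by simp
    then have "n$1 * (X$1 - x) = 0" using that X(2) unfolding L by auto
    then show ?thesis using n1 n12 by simp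
  qed
  note e = rect_edges[OF less_imp_le[OF xy(1)] less_imp_le[OF xy(2)]]
  have v: "vtx P 0 = pt2 x0 y0" "vtx P (Suc 0) = pt2 x1 y0" "vtx P (Suc (Suc 0)) = pt2 x1 y1"
    "vtx P (Suc (Suc (Suc 0))) = pt2 x0 y1" "vtx P (Suc (Suc (Suc (Suc 0)))) = pt2 x0 y0"
    by (simp_all add: P vtx_def rect_vertices_def)
  from i4 show ?thesis
    using z Xb hor[of y0] hor[of y1] ver[of x0] ver[of x1]
    by (elim disjE) (simp_all add: P[symmetric] e[folded P] L v)
qed

text \<open>A boundary point with L > 0 is joined along its edge to a vertex with L > 0, and
  adjacent vertices of this kind along their common edge. For diagonal vertices of a rectangle, A +
  C = B + E prevents L from being positive at A and C and nonpositive at both B and E.\<close>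

lemma connected_positive_frontier:
  assumes P: "mesh_cell P"
  shows "connected {X \<in> frontier (elem P). (n::pt) \<bullet> (X - D) > 0}"
proof -
  define W where "W = {X \<in> frontier (elem P). n \<bullet> (X - D) > 0}"
  have seg: "connected_component W X Y"
    if i: "i < length P" "X \<in> edge P i" "Y \<in> edge P i" and p: "n \<bullet> (X - D) > 0" "n \<bullet> (Y - D) > 0" for i X Y
  proof -
    have "closed_segment X Y \<subseteq> edge P i"
      using i by (auto simp: edge_def subset_closed_segment)
    moreover have "closed_segment X Y \<subseteq> {Z. n \<bullet> Z > n \<bullet> D}"
      using p by (intro closed_segment_subset) (auto simp: inner_diff_right convex_halfspace_gt)
    ultimately have "closed_segment X Y \<subseteq> W"
      using i(1) unfolding W_def frontier_elem[OF P] by (auto simp: inner_diff_right)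
    then show ?thesis unfolding connected_component_def
      by (intro exI[of _ "closed_segment X Y"]) auto
  qed
  have adj: "connected_component W (vtx P i) (vtx P (Suc i))"
    if "i < length P" "n \<bullet> (vtx P i - D) > 0" "n \<bullet> (vtx P (Suc i) - D) > 0" for i
    using seg[OF that(1) _ _ that(2,3)] by (simp add: edge_def)
  have vert: "connected_component W (vtx P i) (vtx P j)"
    if "i < length P" "j < length P" "n \<bullet> (vtx P i - D) > 0" "n \<bullet> (vtx P j - D) > 0" for i j
    using P
  proof
    assume "is_triangle P"
    then obtain A B C where P3: "P = [A, B, C]" unfolding is_triangle_def by auto
    let ?L = "\<lambda>X. n \<bullet> (X - D) > 0"
    have ab: "?L A \<Longrightarrow> ?L B \<Longrightarrow> connected_component W A B" "?L B \<Longrightarrow> ?L C \<Longrightarrow> connected_component W B C"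
      "?L C \<Longrightarrow> ?L A \<Longrightarrow> connected_component W C A"
      using adj[of 0] adj[of 1] adj[of 2] by (auto simp: P3 vtx_def)
    have r: "?L X \<Longrightarrow> X \<in> {A, B, C} \<Longrightarrow> connected_component W X X" for X
      using seg[of 0 A A] seg[of 0 B B] seg[of 1 C C] by (auto simp: P3 vtx_def edge_def)
    have "vtx P i \<in> {A, B, C}" "vtx P j \<in> {A, B, C}" using that P3 nth_mem[of i P] nth_mem[of j P] by (auto simp: vtx_def)
    then show ?thesis using ab r that(3,4) connected_component_sym[of W] by auto
  next
    assume "is_rectangle P"
    then obtain x0 x1 y0 y1 where "P = rect_vertices x0 x1 y0 y1" unfolding is_rectangle_def by auto
    moreover have "pt2 x0 y0 + pt2 x1 y1 = pt2 x1 y0 + pt2 x0 y1" by (rule pt_eqI) auto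
    ultimately obtain A B C E where P4: "P = [A, B, C, E]" and sum: "A + C = B + E"
      unfolding rect_vertices_def by blast
    let ?L = "\<lambda>X. n \<bullet> (X - D) > 0"
    have "n \<bullet> (A - D) + n \<bullet> (C - D) = n \<bullet> (A + C) - 2 * (n \<bullet> D)"
      by (simp add: inner_diff_right inner_add_right)
    also have "\<dots> = n \<bullet> (B - D) + n \<bullet> (E - D)"
      unfolding sum by (simp add: inner_diff_right inner_add_right)
    finally have s: "?L A \<Longrightarrow> ?L C \<Longrightarrow> ?L B \<or> ?L E" "?L B \<Longrightarrow> ?L E \<Longrightarrow> ?L A \<or> ?L C" by linarith+
    have ab: "?L A \<Longrightarrow> ?L B \<Longrightarrow> connected_component W A B" "?L B \<Longrightarrow> ?L C \<Longrightarrow> connected_component W B C"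
      "?L C \<Longrightarrow> ?L E \<Longrightarrow> connected_component W C E" "?L E \<Longrightarrow> ?L A \<Longrightarrow> connected_component W E A"
      using adj[of 0] adj[of 1] adj[of 2] adj[of 3] by (auto simp: P4 vtx_def)
    have ac: "?L A \<Longrightarrow> ?L C \<Longrightarrow> connected_component W A C" "?L B \<Longrightarrow> ?L E \<Longrightarrow> connected_component W B E"
      using s ab connected_component_trans[of W] connected_component_sym[of W] by blast+
    have r: "?L X \<Longrightarrow> X \<in> {A, B, C, E} \<Longrightarrow> connected_component W X X" for X
      using seg[of 0 A A] seg[of 0 B B] seg[of 1 C C] seg[of 2 E E] by (auto simp: P4 vtx_def edge_def)
    have "vtx P i \<in> {A, B, C, E}" "vtx P j \<in> {A, B, C, E}" using that P4 nth_mem[of i P] nth_mem[of j P] by (auto simp: vtx_def)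
    then show ?thesis using ab ac r that(3,4) connected_component_sym[of W] by auto
  qed
  have tov: "\<exists>i<length P. n \<bullet> (vtx P i - D) > 0 \<and> connected_component W X (vtx P i)" if XW: "X \<in> W" for X
  proof -
    obtain i where i: "i < length P" "X \<in> edge P i" using XW frontier_elem[OF P] unfolding W_def by auto
    have Xp: "n \<bullet> (X - D) > 0" using XW by (simp add: W_def)
    have "0 < length P" using i(1) by linarith
    then have s: "Suc i mod length P < length P" "vtx P (Suc i mod length P) = vtx P (Suc i)"
      by (auto simp: vtx_def)
    consider "n \<bullet> (vtx P i - D) > 0" | "n \<bullet> (vtx P (Suc i) - D) > 0" | "n \<bullet> (vtx P i - D) \<le> 0" "n \<bullet> (vtx P (Suc i) - D) \<le> 0"
      by linarith
    then show ?thesis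
    proof cases
      case 1
      then show ?thesis using seg[OF i _ Xp] i by (auto simp: edge_def)
    next
      case 2
      then show ?thesis using seg[OF i _ Xp, of "vtx P (Suc i)"] s by (auto simp: edge_def)
    next
      case 3
      then have "edge P i \<subseteq> {Z. n \<bullet> Z \<le> n \<bullet> D}"
        unfolding edge_def by (intro closed_segment_subset) (auto simp: inner_diff_right convex_halfspace_le)
      then show ?thesis using i Xp by (auto simp: inner_diff_right)
    qed
  qed
  have "connected W"
    unfolding connected_iff_connected_component
  proof (intro ballI)
    fix X Y assume "X \<in> W" "Y \<in> W"
    then obtain i j where "i < length P" "n \<bullet> (vtx P i - D) > 0" "connected_component W X (vtx P i)"
       "j < length P" "n \<bullet> (vtx P j - D) > 0" "connected_component W Y (vtx P j)"
      using tov by metis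
    then show "connected_component W X Y"
      using vert[of i j] connected_component_trans[of W] connected_component_sym[of W] by blast
  qed
  then show ?thesis by (simp add: W_def)
qed

text \<open>Two closed sets that are complementary on a connected set cannot both meet it. This is
  applied with the normals n and -n, and the two constants come out independently of each
  other.\<close>

lemma frontier_side_constant:
  assumes P: "mesh_cell P" and cl: "closed U" "closed V"
    and compl: "\<And>X. X \<in> frontier (elem P) \<Longrightarrow> (n::pt) \<bullet> (X - D) \<noteq> 0 \<Longrightarrow> X \<in> U \<longleftrightarrow> X \<notin> V"
  shows "\<exists>s1 s2. (\<forall>X\<in>frontier (elem P). n \<bullet> (X - D) > 0 \<longrightarrow> (X \<in> U \<longleftrightarrow> s1)) \<and>
    (\<forall>X\<in>frontier (elem P). n \<bullet> (X - D) < 0 \<longrightarrow> (X \<in> U \<longleftrightarrow> s2))"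
proof -
  have one: "\<exists>s. \<forall>X\<in>frontier (elem P). m \<bullet> (X - D) > 0 \<longrightarrow> (X \<in> U \<longleftrightarrow> s)" if m: "m = n \<or> m = - n" for m
  proof -
    let ?W = "{X \<in> frontier (elem P). m \<bullet> (X - D) > 0}"
    have c: "connected ?W" by (rule connected_positive_frontier[OF P])
    have "X \<in> U \<longleftrightarrow> X \<notin> V" if "X \<in> ?W" for X
      using compl[of X] m that by auto
    then have "U \<inter> V \<inter> ?W = {}" "?W \<subseteq> U \<union> V" by blast+
    then have "U \<inter> ?W = {} \<or> V \<inter> ?W = {}"
      using c cl unfolding connected_closed by blast
    then show ?thesis
    proof
      assume "U \<inter> ?W = {}"
      then show ?thesis by (intro exI[of _ False]) auto
    next
      assume "V \<inter> ?W = {}"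
      then show ?thesis using \<open>?W \<subseteq> U \<union> V\<close> by (intro exI[of _ True]) auto
    qed
  qed
  from one[of n] one[of "- n"] show ?thesis by auto
qed

text \<open>Near a point off \<Gamma>, the part of the interior of T inside a small ball is convex
  and misses \<Gamma>, so connectedness puts it into a single subdomain.\<close>

lemma closure_sides_complementary:
  fixes T :: "pt set"
  assumes op: "open \<Omega>p" "open \<Omega>m" "\<Omega>p \<inter> \<Omega>m = {}" and un: "\<Omega> - \<Gamma> = \<Omega>p \<union> \<Omega>m" and G: "closed \<Gamma>"
    and T: "convex T" "closed T" "interior T \<noteq> {}" "interior T \<subseteq> \<Omega>" and X: "X \<in> T" "X \<notin> \<Gamma>"
  shows "X \<in> closure (T \<inter> \<Omega>m) \<longleftrightarrow> X \<notin> closure (T \<inter> \<Omega>p)"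
proof -
  have clint: "closure (interior T) = T"
    using convex_closure_interior[OF T(1,3)] T(2) by (simp add: closure_closed)
  obtain r where r: "0 < r" "ball X r \<inter> \<Gamma> = {}"
    using G X(2) open_contains_ball[of "- \<Gamma>"] by (auto simp: open_Compl) blast
  define B where "B = interior T \<inter> ball X r"
  have cB: "connected B" unfolding B_def
    by (intro convex_connected convex_Int convex_interior convex_ball T)
  have BU: "B \<subseteq> \<Omega>p \<union> \<Omega>m" using T(4) r(2) un unfolding B_def by blast
  have XB: "X \<in> closure B"
    using open_Int_closure_subset[of "ball X r" "interior T"] clint X(1) r(1) unfolding B_def by (auto simp: Int_commute)
  have one: "X \<in> closure (T \<inter> U) \<and> X \<notin> closure (T \<inter> V)"
    if BU: "B \<subseteq> U" and UV: "U \<inter> V = {}" "open V" for U V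
  proof
    have "B \<subseteq> T \<inter> U" using BU interior_subset unfolding B_def by blast
    then show "X \<in> closure (T \<inter> U)" using XB closure_mono by blast
    show "X \<notin> closure (T \<inter> V)"
    proof
      \<comment> \<open>A point of T near X in the open set V may lie on the boundary of T, but it
        is a limit of interior points of T, and these would eventually lie in V too.\<close>
      assume "X \<in> closure (T \<inter> V)"
      then have "X \<in> closure (ball X r \<inter> (T \<inter> V))"
        using open_Int_closure_subset[of "ball X r" "T \<inter> V"] r(1) by auto
      then have "ball X r \<inter> (T \<inter> V) \<noteq> {}" by auto
      then obtain Y where "Y \<in> T" and Y1: "Y \<in> ball X r \<inter> V" by blast
      then have Y: "Y \<in> ball X r \<inter> V" "Y \<in> closure (interior T)" using clint by simp_all
      have "(ball X r \<inter> V) \<inter> closure (interior T) \<subseteq> closure ((ball X r \<inter> V) \<inter> interior T)"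
        by (rule open_Int_closure_subset) (use UV in auto)
      then have "(ball X r \<inter> V) \<inter> interior T \<noteq> {}" using Y by auto
      then show False using BU UV unfolding B_def by blast
    qed
  qed
  have "\<Omega>p \<inter> B = {} \<or> \<Omega>m \<inter> B = {}"
    using cB op BU unfolding connected_def by blast
  then have "B \<subseteq> \<Omega>m \<or> B \<subseteq> \<Omega>p" using BU by blast
  then show ?thesis using one[of \<Omega>m \<Omega>p] one[of \<Omega>p \<Omega>m] op by blast
qed

text \<open>\<open>line_piece\<close> is defined through boundary points on the same side of the
  line, and membership in the closure of U is constant on each side. Off the line both closures thus
  have the same boundary trace, and the curve and line variants lead to the same edge means of the
  jump term.\<close>

lemma line_piece_closure:
  assumes T: "closed T" and s: "\<And>X. X \<in> frontier T \<Longrightarrow> n \<bullet> (X - D) > 0 \<Longrightarrow> X \<in> closure U \<longleftrightarrow> s1"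
    "\<And>X. X \<in> frontier T \<Longrightarrow> n \<bullet> (X - D) < 0 \<Longrightarrow> X \<in> closure U \<longleftrightarrow> s2" 
    and X: "X \<in> frontier T"
  shows "n \<bullet> (X - D) > 0 \<Longrightarrow> X \<in> closure (line_piece T U D n) \<longleftrightarrow> s1"
    "n \<bullet> (X - D) < 0 \<Longrightarrow> X \<in> closure (line_piece T U D n) \<longleftrightarrow> s2"
proof -
  have XT: "X \<in> T" using T X by (simp add: frontier_def)
  have sub: "X \<in> closure (line_piece T U D n)" if "X \<in> closure U" "n \<bullet> (X - D) \<noteq> 0"
  proof -
    have "(n \<bullet> (X - D)) * (n \<bullet> (X - D)) > 0" using that(2) by (auto simp: zero_less_mult_iff)
    then have "X \<in> line_piece T U D n" unfolding line_piece_def using XT X that by blast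
    then show ?thesis using closure_subset by blast
  qed
  \<comment> \<open>An open half-plane that contains a point of the closure contains a point of the
    piece itself; m = n and m = -n are the two sides.\<close>
  have ex: "\<exists>Y\<in>frontier T \<inter> closure U. m \<bullet> (Y - D) > 0"
    if "X \<in> closure (line_piece T U D n)" "m \<bullet> (X - D) > 0" "m = n \<or> m = - n" for m
  proof -
    have o: "open {Z. m \<bullet> Z > m \<bullet> D}" by (rule open_halfspace_gt)
    have "X \<in> {Z. m \<bullet> Z > m \<bullet> D}" using that by (simp add: inner_diff_right)
    then have "{Z. m \<bullet> Z > m \<bullet> D} \<inter> line_piece T U D n \<noteq> {}"
      using that(1) open_Int_closure_eq_empty[OF o] by blast
    then obtain Z where Z: "m \<bullet> (Z - D) > 0" "Z \<in> line_piece T U D n" by (auto simp: inner_diff_right)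
    then obtain Y where Y: "Y \<in> frontier T \<inter> closure U" "(n \<bullet> (Z - D)) * (n \<bullet> (Y - D)) > 0"
      unfolding line_piece_def by auto
    then have "(m \<bullet> (Z - D)) * (m \<bullet> (Y - D)) > 0" using that(3) by auto
    then have "m \<bullet> (Y - D) > 0" using Z(1) by (simp add: zero_less_mult_iff)
    then show ?thesis using Y by blast
  qed
  show "n \<bullet> (X - D) > 0 \<Longrightarrow> X \<in> closure (line_piece T U D n) \<longleftrightarrow> s1"
    using ex[of n] sub s(1) X by force
  show "n \<bullet> (X - D) < 0 \<Longrightarrow> X \<in> closure (line_piece T U D n) \<longleftrightarrow> s2"
    using ex[of "- n"] sub s(2) X by force
qed

subsection \<open>Flatness of short arcs\<close>

text \<open>For a unit vector e: every chord of C makes an angle of sine at most \<epsilon> with the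
  line spanned by e. The direction is unoriented, hence the absolute value.\<close>

definition in_cone :: "pt \<Rightarrow> real \<Rightarrow> pt set \<Rightarrow> bool" where
  "in_cone e \<epsilon> C \<longleftrightarrow> (\<forall>X\<in>C. \<forall>Y\<in>C. \<bar>cr e (X - Y)\<bar> \<le> \<epsilon> * norm (X - Y))"

lemma in_cone_subset: "in_cone e \<epsilon> C \<Longrightarrow> C' \<subseteq> C \<Longrightarrow> in_cone e \<epsilon> C'"
  unfolding in_cone_def by blast

lemma cr_add: "cr e (v + w) = cr e v + cr e w" and cr_diff: "cr e (v - w) = cr e v - cr e w"
  and cr_scale: "cr e (r *\<^sub>R v) = r * cr e v" and cr_scale_left: "cr (r *\<^sub>R e) v = r * cr e v" 
  and cr_self: "cr e e = 0"
  by (simp_all add: cr_def algebra_simps)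

lemma cr_inner_identity: "(cr a b)\<^sup>2 + (a \<bullet> b)\<^sup>2 = (norm a)\<^sup>2 * (norm b)\<^sup>2"
  unfolding norm_pt inner_pt cr_def by (simp add: power2_eq_square algebra_simps)

lemma abs_cr_le: "\<bar>cr a b\<bar> \<le> norm a * norm b"
proof (rule power2_le_imp_le)
  show "\<bar>cr a b\<bar>\<^sup>2 \<le> (norm a * norm b)\<^sup>2"
    using cr_inner_identity[of a b] zero_le_power2[of "a \<bullet> b"] unfolding power_mult_distrib power2_abs by linarith
qed simp

lemma continuous_on_cr [continuous_intros]: "continuous_on S f \<Longrightarrow> continuous_on S (\<lambda>x. cr e (f x))"
  unfolding cr_def by (intro continuous_intros)

text \<open>In the orthonormal frame of e, each of the two products that form the cross product has
  one small factor.\<close>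

lemma cr_common_direction:
  assumes e: "norm e = 1" and v: "\<bar>cr e v\<bar> \<le> \<epsilon> * norm v" and w: "\<bar>cr e w\<bar> \<le> \<epsilon> * norm w"
  shows "\<bar>cr v w\<bar> \<le> 2 * \<epsilon> * norm v * norm w"
proof -
  have "(norm e)\<^sup>2 * cr v w = (e \<bullet> v) * cr e w - cr e v * (e \<bullet> w)"
    unfolding norm_pt inner_pt cr_def by (simp add: power2_eq_square algebra_simps)
  then have "\<bar>cr v w\<bar> \<le> \<bar>e \<bullet> v\<bar> * \<bar>cr e w\<bar> + \<bar>cr e v\<bar> * \<bar>e \<bullet> w\<bar>"
    using e abs_triangle_ineq4[of "(e \<bullet> v) * cr e w" "cr e v * (e \<bullet> w)"] by (simp add: abs_mult)
  also have "\<dots> \<le> norm v * (\<epsilon> * norm w) + (\<epsilon> * norm v) * norm w"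
    using v w Cauchy_Schwarz_ineq2[of e v] Cauchy_Schwarz_ineq2[of e w] e by (intro add_mono mult_mono) auto
  finally show ?thesis by simp
qed

lemma C2_reg_paramD:
  assumes "C2_reg_param g g1 a b"
  shows "a < b" "\<And>s. s \<in> {a..b} \<Longrightarrow> (g has_vector_derivative g1 s) (at s within {a..b})"
    "\<And>s. s \<in> {a..b} \<Longrightarrow> g1 s \<noteq> 0" "continuous_on {a..b} g" "continuous_on {a..b} g1"
  using assms unfolding C2_reg_param_def by (auto intro: continuous_on_vector_derivative)

text \<open>Continuity of the derivative makes g nearly linear close to t: by the mean value
  inequality, chords deviate from their linear part by at most the oscillation of
  \<open>g1\<close>.\<close>

lemma local_cone:
  assumes g: "C2_reg_param g g1 a b" and t: "t \<in> {a..b}" and eps: "0 < \<epsilon>"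
  shows "\<exists>\<eta>>0. \<exists>e. norm e = 1 \<and> in_cone e \<epsilon> (g ` ({a..b} \<inter> {t-\<eta>..t+\<eta>}))"
proof -
  define m where "m = norm (g1 t)"
  have m: "0 < m" using C2_reg_paramD(3)[OF g t] by (simp add: m_def)
  define e where "e = (1 / m) *\<^sub>R g1 t"
  have e: "norm e = 1" "g1 t = m *\<^sub>R e" using m by (auto simp: e_def m_def)
  \<comment> \<open>The bound 1/2 keeps a chord at least half as long as its linear part, which
    costs a factor 2; the bound \<epsilon> / 2 compensates for it.\<close>
  define \<mu> where "\<mu> = min (\<epsilon> / 2) (1 / 2)"
  have mu: "0 < \<mu>" "\<mu> \<le> \<epsilon> / 2" "\<mu> \<le> 1 / 2" using eps by (auto simp: \<mu>_def)
  have "0 < \<mu> * m" using mu m by simp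
  then obtain d where d: "0 < d" "\<And>s. s \<in> {a..b} \<Longrightarrow> dist s t < d \<Longrightarrow> dist (g1 s) (g1 t) < \<mu> * m"
    using C2_reg_paramD(5)[OF g] t unfolding continuous_on_iff by metis
  define \<eta> where "\<eta> = d / 2"
  let ?J = "{a..b} \<inter> {t-\<eta>..t+\<eta>}"
  have near: "norm (g1 s - g1 t) \<le> \<mu> * m" if "s \<in> ?J" for s
    using d(2)[of s] that d(1) by (auto simp: \<eta>_def dist_norm abs_le_iff intro!: less_imp_le)
  have chord: "\<bar>cr e (g y - g x)\<bar> \<le> \<epsilon> * norm (g y - g x)" if "x \<in> ?J" "y \<in> ?J" for x y
  proof -
    have seg: "closed_segment x y \<subseteq> ?J"
      using that by (auto simp: closed_segment_eq_real_ivl split: if_splits)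
    have tJ: "t \<in> ?J" using t d(1) by (auto simp: \<eta>_def)
    define r where "r = g y - g x - (y - x) *\<^sub>R g1 t"
    have "norm r \<le> norm (y - x) * (\<mu> * m)"
      unfolding r_def
    proof (rule vector_differentiable_bound_linearization[of ?J g g1, OF _ seg near tJ])
      fix s assume "s \<in> ?J"
      then show "(g has_vector_derivative g1 s) (at s within ?J)"
        using has_vector_derivative_within_subset[OF C2_reg_paramD(2)[OF g]] by (metis Int_iff inf_le1)
    qed
    then have r: "norm r \<le> \<mu> * (m * \<bar>y - x\<bar>)" by (simp add: mult_ac)
    have gd: "g y - g x = ((y - x) * m) *\<^sub>R e + r" by (simp add: r_def e(2))
    have "\<bar>cr e (g y - g x)\<bar> = \<bar>cr e r\<bar>" unfolding gd by (simp add: cr_add cr_scale cr_self)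
    also have "\<dots> \<le> norm r" using abs_cr_le[of e r] e by simp
    finally have 1: "\<bar>cr e (g y - g x)\<bar> \<le> \<mu> * (m * \<bar>y - x\<bar>)" using r by linarith
    have "norm (((y - x) * m) *\<^sub>R e) - norm r \<le> norm (g y - g x)"
      unfolding gd using norm_triangle_ineq2[of "((y - x) * m) *\<^sub>R e" "- r"] by simp
    moreover have "norm (((y - x) * m) *\<^sub>R e) = m * \<bar>y - x\<bar>" using e m by (simp add: abs_mult)
    moreover have "\<mu> * (m * \<bar>y - x\<bar>) \<le> 1 / 2 * (m * \<bar>y - x\<bar>)" using mu m by (intro mult_right_mono) auto
    ultimately have 2: "m * \<bar>y - x\<bar> \<le> 2 * norm (g y - g x)" using r by linarith
    have "\<mu> * (m * \<bar>y - x\<bar>) \<le> \<epsilon> / 2 * (2 * norm (g y - g x))"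
      by (rule mult_mono[OF mu(2) 2]) (use m eps in auto)
    then show ?thesis using 1 by simp
  qed
  have "in_cone e \<epsilon> (g ` ?J)" unfolding in_cone_def using chord by blast
  moreover have "0 < \<eta>" using d(1) by (simp add: \<eta>_def)
  ultimately show ?thesis using e(1) by blast
qed

lemma partition_piece_right:
  fixes t :: "nat \<Rightarrow> real"
  assumes "t 0 \<le> x" "x < t k"
  shows "\<exists>i<k. t i \<le> x \<and> x < t (Suc i)"
  using assms(2) by (induction k) (use assms(1) in \<open>auto simp: less_Suc_eq not_less\<close>, metis not_le less_Suc_eq)

lemma partition_piece_left:
  fixes t :: "nat \<Rightarrow> real"
  assumes "t 0 < x" "x \<le> t k"
  shows "\<exists>i<k. t i < x \<and> x \<le> t (Suc i)"
  using assms(2) by (induction k) (use assms(1) in \<open>auto simp: less_Suc_eq not_less\<close>, metis not_le less_Suc_eq)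

text \<open>One-sided, since at a breakpoint only one-sided tangents are available; the piece is
  chosen half-open so that it extends to the right of x.\<close>

lemma path_cone_right:
  assumes g: "piecewise_C2_path g" and x: "0 \<le> x" "x < 1" and eps: "0 < \<epsilon>"
  shows "\<exists>\<eta>>0. \<exists>e. norm e = 1 \<and> in_cone e \<epsilon> (g ` {x..x+\<eta>})"
proof -
  obtain t k where t: "t 0 = 0" "t k = 1" "\<And>i. i < k \<Longrightarrow> \<exists>g1. C2_reg_param g g1 (t i) (t (Suc i))"
    using g unfolding piecewise_C2_path_def by blast
  obtain i where i: "i < k" "t i \<le> x" "x < t (Suc i)"
    using partition_piece_right[of t x k] t x by auto
  obtain g1 where g1: "C2_reg_param g g1 (t i) (t (Suc i))" using t(3)[OF i(1)] by blast
  obtain \<eta> e where e: "0 < \<eta>" "norm e = 1" "in_cone e \<epsilon> (g ` ({t i..t (Suc i)} \<inter> {x-\<eta>..x+\<eta>}))"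
    using local_cone[OF g1 _ eps, of x] i by auto
  define \<theta> where "\<theta> = min \<eta> (t (Suc i) - x)"
  have "{x..x+\<theta>} \<subseteq> {t i..t (Suc i)} \<inter> {x-\<eta>..x+\<eta>}" "0 < \<theta>" using i e(1) by (auto simp: \<theta>_def)
  then show ?thesis using in_cone_subset[OF e(3)] e(2) image_mono by metis
qed

lemma path_cone_left:
  assumes g: "piecewise_C2_path g" and x: "0 < x" "x \<le> 1" and eps: "0 < \<epsilon>"
  shows "\<exists>\<eta>>0. \<exists>e. norm e = 1 \<and> in_cone e \<epsilon> (g ` {x-\<eta>..x})"
proof -
  obtain t k where t: "t 0 = 0" "t k = 1" "\<And>i. i < k \<Longrightarrow> \<exists>g1. C2_reg_param g g1 (t i) (t (Suc i))"
    using g unfolding piecewise_C2_path_def by blast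
  obtain i where i: "i < k" "t i < x" "x \<le> t (Suc i)"
    using partition_piece_left[of t x k] t x by auto
  obtain g1 where g1: "C2_reg_param g g1 (t i) (t (Suc i))" using t(3)[OF i(1)] by blast
  obtain \<eta> e where e: "0 < \<eta>" "norm e = 1" "in_cone e \<epsilon> (g ` ({t i..t (Suc i)} \<inter> {x-\<eta>..x+\<eta>}))"
    using local_cone[OF g1 _ eps, of x] i by auto
  define \<theta> where "\<theta> = min \<eta> (x - t i)"
  have "{x-\<theta>..x} \<subseteq> {t i..t (Suc i)} \<inter> {x-\<eta>..x+\<eta>}" "0 < \<theta>" using i e(1) by (auto simp: \<theta>_def)
  then show ?thesis using in_cone_subset[OF e(3)] e(2) image_mono by metis
qed

text \<open>The local model of a corner: two branches, each of small angular spread. Closedness and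
  the single common point force an arc inside the union to change branch only at X.\<close>

definition two_cones :: "real \<Rightarrow> pt set \<Rightarrow> bool" where
  "two_cones \<epsilon> A \<longleftrightarrow> (\<exists>X C1 C2 e1 e2. closed C1 \<and> closed C2 \<and> norm e1 = 1 \<and> norm e2 = 1 \<and>
     in_cone e1 \<epsilon> C1 \<and> in_cone e2 \<epsilon> C2 \<and> A \<subseteq> C1 \<union> C2 \<and> C1 \<inter> C2 \<subseteq> {X})"

text \<open>By injectivity, parameters away from those of X have images at positive distance from X,
  so a small ball sees only the branches at X. At the base point of a closed path these are its
  first and last pieces; at an end of an open path the second set is {X} with an arbitrary
  direction.\<close>

lemma path_two_cones:
  assumes g: "piecewise_C2_path g" "simple_path g" and X: "X \<in> path_image g" and eps: "0 < \<epsilon>"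
  shows "\<exists>r>0. two_cones \<epsilon> (path_image g \<inter> ball X r)"
proof -
  have cont: "continuous_on {0..1} g" using g(2) by (simp add: simple_path_def path_def)
  have inj: "s = t \<or> (s = 0 \<and> t = 1) \<or> (s = 1 \<and> t = 0)" if "s \<in> {0..1}" "t \<in> {0..1}" "g s = g t" for s t
    using g(2) that unfolding simple_path_def loop_free_def by blast
  have single: "in_cone e \<epsilon> {X}" for e by (simp add: in_cone_def cr_def)
  have axis: "norm (axis 1 1 :: pt) = 1" by (simp add: norm_eq_1 inner_axis_axis)
  \<comment> \<open>\<open>K\<close> collects the discarded parameters; its image is compact and
    misses X.\<close>
  have fin: ?thesis
    if K: "closed K" "K \<subseteq> {0..1}" "X \<notin> g ` K" and C: "g ` ({0..1} - K) \<subseteq> C1 \<union> C2"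
      "closed C1" "closed C2" "norm e1 = 1" "norm e2 = 1" "in_cone e1 \<epsilon> C1" "in_cone e2 \<epsilon> C2" "C1 \<inter> C2 \<subseteq> {X}"
    for K C1 C2 e1 e2
  proof -
    have "compact K" using compact_Int_closed[OF compact_Icc K(1), of 0 1] K(2) by (simp add: Int_absorb1)
    then have "closed (g ` K)"
      using K(2) cont by (intro compact_imp_closed compact_continuous_image) (auto intro: continuous_on_subset)
    then have "open (- (g ` K))" by (simp add: open_Compl)
    then obtain r where r: "0 < r" "ball X r \<subseteq> - (g ` K)"
      using K(3) by (meson ComplI open_contains_ball)
    have "path_image g \<inter> ball X r \<subseteq> C1 \<union> C2"
      using r(2) C(1) unfolding path_image_def by blast
    then show ?thesis unfolding two_cones_def using r(1) C(2-) by blast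
  qed
  have clim: "closed (g ` {a..b})" if "0 \<le> a" "b \<le> 1" for a b
    using that by (intro compact_imp_closed compact_continuous_image continuous_on_subset[OF cont]) auto
  obtain x where x: "x \<in> {0..1}" "g x = X" using X unfolding path_image_def by auto
  \<comment> \<open>The bound 1/3 keeps the intervals at the two ends of a closed path apart, and
    staying below 1 makes injectivity applicable.\<close>
  have right: "\<exists>\<eta>>0. \<eta> \<le> 1/3 \<and> y + \<eta> < 1 \<and> (\<exists>e. norm e = 1 \<and> in_cone e \<epsilon> (g ` {y..y+\<eta>}))"
    if y: "0 \<le> y" "y < 1" for y
  proof -
    obtain \<eta> e where e: "0 < \<eta>" "norm e = 1" "in_cone e \<epsilon> (g ` {y..y+\<eta>})"
      using path_cone_right[OF g(1) y eps] by blast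
    define \<theta> where "\<theta> = min \<eta> (min (1/3) ((1 - y) / 2))"
    have "{y..y+\<theta>} \<subseteq> {y..y+\<eta>}" "0 < \<theta>" "\<theta> \<le> 1/3" using that e(1) by (auto simp: \<theta>_def)
    moreover have "y + \<theta> < 1" using that by (auto simp: \<theta>_def min_def field_simps)
    ultimately show ?thesis using in_cone_subset[OF e(3)] e(2) image_mono by metis
  qed
  have left: "\<exists>\<eta>>0. \<eta> \<le> 1/3 \<and> 0 < y - \<eta> \<and> (\<exists>e. norm e = 1 \<and> in_cone e \<epsilon> (g ` {y-\<eta>..y}))"
    if y: "0 < y" "y \<le> 1" for y
  proof -
    obtain \<eta> e where e: "0 < \<eta>" "norm e = 1" "in_cone e \<epsilon> (g ` {y-\<eta>..y})"
      using path_cone_left[OF g(1) y eps] by blast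
    define \<theta> where "\<theta> = min \<eta> (min (1/3) (y / 2))"
    have "{y-\<theta>..y} \<subseteq> {y-\<eta>..y}" "0 < \<theta>" "\<theta> \<le> 1/3" using that e(1) by (auto simp: \<theta>_def)
    moreover have "0 < y - \<theta>" using that by (auto simp: \<theta>_def min_def field_simps)
    ultimately show ?thesis using in_cone_subset[OF e(3)] e(2) image_mono by metis
  qed
  consider "0 < x" "x < 1" | "x = 0 \<or> x = 1" "g 0 = g 1" | "x = 0" "g 0 \<noteq> g 1" | "x = 1" "g 0 \<noteq> g 1"
    using x(1) by fastforce
  then show ?thesis
  proof cases
    case 1
    obtain \<eta>1 e1 where 1: "0 < \<eta>1" "0 < x - \<eta>1" "norm e1 = 1" "in_cone e1 \<epsilon> (g ` {x-\<eta>1..x})"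
      using left[of x] 1 by auto
    obtain \<eta>2 e2 where 2: "0 < \<eta>2" "x + \<eta>2 < 1" "norm e2 = 1" "in_cone e2 \<epsilon> (g ` {x..x+\<eta>2})"
      using right[of x] \<open>0 < x\<close> \<open>x < 1\<close> by auto
    show ?thesis
    proof (rule fin[of "{0..x-\<eta>1} \<union> {x+\<eta>2..1}" "g ` {x-\<eta>1..x}" "g ` {x..x+\<eta>2}" e1 e2])
      show "X \<notin> g ` ({0..x - \<eta>1} \<union> {x + \<eta>2..1})"
      proof
        assume "X \<in> g ` ({0..x - \<eta>1} \<union> {x + \<eta>2..1})"
        then obtain s where "s \<in> {0..x - \<eta>1} \<union> {x + \<eta>2..1}" "g s = g x" using x(2) by (metis imageE)
        then show False using inj[of s x] 1 2 x(1) by auto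
      qed
      show "g ` {x - \<eta>1..x} \<inter> g ` {x..x + \<eta>2} \<subseteq> {X}"
      proof
        fix Y assume "Y \<in> g ` {x - \<eta>1..x} \<inter> g ` {x..x + \<eta>2}"
        then obtain s t where st: "s \<in> {x - \<eta>1..x}" "t \<in> {x..x + \<eta>2}" "Y = g s" "g s = g t" by auto
        then have "s = t" using inj[of s t] 1 2 by auto
        then show "Y \<in> {X}" using st x(2) by auto
      qed
      show "g ` ({0..1} - ({0..x - \<eta>1} \<union> {x + \<eta>2..1})) \<subseteq> g ` {x - \<eta>1..x} \<union> g ` {x..x + \<eta>2}"
        unfolding image_Un[symmetric] by (rule image_mono) auto
    qed (use 1 2 clim in \<open>auto\<close>)
  next
    case 2
    obtain \<eta>1 e1 where 1: "0 < \<eta>1" "\<eta>1 \<le> 1/3" "norm e1 = 1" "in_cone e1 \<epsilon> (g ` {0..0+\<eta>1})"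
      using right[of 0] by auto
    obtain \<eta>2 e2 where 3: "0 < \<eta>2" "\<eta>2 \<le> 1/3" "norm e2 = 1" "in_cone e2 \<epsilon> (g ` {1-\<eta>2..1})"
      using left[of 1] by auto
    have X0: "g 0 = X" "g 1 = X" using 2 x by auto
    show ?thesis
    proof (rule fin[of "{\<eta>1..1-\<eta>2}" "g ` {0..\<eta>1}" "g ` {1-\<eta>2..1}" e1 e2])
      show "X \<notin> g ` {\<eta>1..1 - \<eta>2}"
      proof
        assume "X \<in> g ` {\<eta>1..1 - \<eta>2}"
        then obtain s where "s \<in> {\<eta>1..1 - \<eta>2}" "g s = g 0" using X0 by auto
        then show False using inj[of s 0] 1 3 by auto
      qed
      show "g ` {0..\<eta>1} \<inter> g ` {1 - \<eta>2..1} \<subseteq> {X}"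
      proof
        fix Y assume "Y \<in> g ` {0..\<eta>1} \<inter> g ` {1 - \<eta>2..1}"
        then obtain s t where st: "s \<in> {0..\<eta>1}" "t \<in> {1 - \<eta>2..1}" "Y = g s" "g s = g t" by auto
        then have "s = 0" using inj[of s t] 1 3 by auto
        then show "Y \<in> {X}" using st X0 by auto
      qed
    qed (use 1 3 clim in \<open>auto\<close>)
  next
    case 3
    obtain \<eta>1 e1 where 1: "0 < \<eta>1" "\<eta>1 \<le> 1/3" "norm e1 = 1" "in_cone e1 \<epsilon> (g ` {0..0+\<eta>1})"
      using right[of 0] by auto
    show ?thesis
    proof (rule fin[of "{\<eta>1..1}" "g ` {0..\<eta>1}" "{X}" e1 "axis 1 1"])
      show "X \<notin> g ` {\<eta>1..1}"
      proof
        assume "X \<in> g ` {\<eta>1..1}"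
        then obtain s where "s \<in> {\<eta>1..1}" "g s = g 0" using x 3 by auto
        then show False using inj[of s 0] 1 3 by auto
      qed
    qed (use 1 clim single axis in \<open>auto\<close>)
  next
    case 4
    obtain \<eta>1 e1 where 1: "0 < \<eta>1" "\<eta>1 \<le> 1/3" "norm e1 = 1" "in_cone e1 \<epsilon> (g ` {1-\<eta>1..1})"
      using left[of 1] by auto
    show ?thesis
    proof (rule fin[of "{0..1-\<eta>1}" "g ` {1-\<eta>1..1}" "{X}" e1 "axis 1 1"])
      show "X \<notin> g ` {0..1-\<eta>1}"
      proof
        assume "X \<in> g ` {0..1-\<eta>1}"
        then obtain s where "s \<in> {0..1-\<eta>1}" "g s = g 1" using x 4 by auto
        then show False using inj[of s 1] 1 4 by auto
      qed
    qed (use 1 clim single axis in \<open>auto\<close>)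
  qed
qed

text \<open>The Lebesgue number of the cover by such balls makes \<delta> independent of the
  position on \<Gamma>, hence of the mesh and the element.\<close>

lemma small_arcs_two_cones:
  assumes g: "piecewise_C2_path g" "simple_path g" and eps: "0 < \<epsilon>"
  shows "\<exists>\<delta>>0. \<forall>A. A \<subseteq> path_image g \<and> diameter A < \<delta> \<longrightarrow> two_cones \<epsilon> A"
proof -
  define \<C> where "\<C> = {ball X r | X r. 0 < r \<and> two_cones \<epsilon> (path_image g \<inter> ball X r)}"
  have cov: "\<exists>B\<in>\<C>. X \<in> B" if "X \<in> path_image g" for X
    using path_two_cones[OF g that eps] unfolding \<C>_def by (metis (mono_tags, lifting) centre_in_ball mem_Collect_eq)
  have ne: "\<C> \<noteq> {}" using cov[OF pathstart_in_path_image] by blast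
  have cp: "compact (path_image g)" using g(2) by (simp add: compact_simple_path_image)
  obtain \<delta> where d: "0 < \<delta>" "\<And>T. T \<subseteq> path_image g \<Longrightarrow> diameter T < \<delta> \<Longrightarrow> \<exists>B\<in>\<C>. T \<subseteq> B"
  proof (rule Lebesgue_number_lemma[OF cp ne])
    show "path_image g \<subseteq> \<Union>\<C>" using cov by blast
    show "open B" if "B \<in> \<C>" for B using that by (auto simp: \<C>_def)
  qed blast
  have "two_cones \<epsilon> A" if A: "A \<subseteq> path_image g" "diameter A < \<delta>" for A
  proof -
    obtain X r where "A \<subseteq> path_image g \<inter> ball X r" "two_cones \<epsilon> (path_image g \<inter> ball X r)"
      using d(2)[OF A] A(1) unfolding \<C>_def by blast
    then show ?thesis unfolding two_cones_def by (meson order_trans)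
  qed
  then show ?thesis using d(1) by blast
qed

text \<open>The cone is closed and invariant under scaling, so it contains the difference quotients
  together with their limit.\<close>

lemma derivative_in_cone:
  assumes d: "(\<gamma> has_vector_derivative v) (at s within {c..d})" and s: "s \<in> {c..d}" "c < d"
    and cone: "in_cone e \<epsilon> (\<gamma> ` {c..d})"
  shows "\<bar>cr e v\<bar> \<le> \<epsilon> * norm v"
proof -
  let ?F = "at s within {c..d}"
  have nt: "?F \<noteq> bot" using s by (simp add: trivial_limit_within islimpt_Icc)
  define Q where "Q y = (1 / (y - s)) *\<^sub>R (\<gamma> y - \<gamma> s)" for y
  have r: "((\<lambda>y. (1 / norm (y - s)) *\<^sub>R (\<gamma> y - (\<gamma> s + (y - s) *\<^sub>R v))) \<longlongrightarrow> 0) ?F"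
    using d unfolding has_vector_derivative_def has_derivative_within by auto
  have "((\<lambda>y. Q y - v) \<longlongrightarrow> 0) ?F"
  proof (rule Lim_null_comparison[OF _ tendsto_norm_zero[OF r]])
    show "\<forall>\<^sub>F y in ?F. norm (Q y - v) \<le> norm ((1 / norm (y - s)) *\<^sub>R (\<gamma> y - (\<gamma> s + (y - s) *\<^sub>R v)))"
      unfolding eventually_at_filter
    proof (rule always_eventually, intro allI impI)
      fix y assume "y \<noteq> s" "y \<in> {c..d}"
      then have "Q y - v = (1 / (y - s)) *\<^sub>R (\<gamma> y - (\<gamma> s + (y - s) *\<^sub>R v))"
        unfolding Q_def by (simp add: scaleR_diff_right scaleR_add_right)
      then show "norm (Q y - v) \<le> norm ((1 / norm (y - s)) *\<^sub>R (\<gamma> y - (\<gamma> s + (y - s) *\<^sub>R v)))" by simp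
    qed
  qed
  then have lim: "(Q \<longlongrightarrow> v) ?F" by (simp add: LIM_zero_iff)
  have "closed {w. \<bar>cr e w\<bar> \<le> \<epsilon> * norm w}"
    by (intro closed_Collect_le continuous_intros)
  moreover have "\<forall>\<^sub>F y in ?F. Q y \<in> {w. \<bar>cr e w\<bar> \<le> \<epsilon> * norm w}"
    unfolding eventually_at_filter
  proof (rule always_eventually, intro allI impI)
    fix y assume y: "y \<noteq> s" "y \<in> {c..d}"
    have "\<bar>cr e (\<gamma> y - \<gamma> s)\<bar> \<le> \<epsilon> * norm (\<gamma> y - \<gamma> s)" using cone y s unfolding in_cone_def by blast
    then have "\<bar>1 / (y - s)\<bar> * \<bar>cr e (\<gamma> y - \<gamma> s)\<bar> \<le> \<bar>1 / (y - s)\<bar> * (\<epsilon> * norm (\<gamma> y - \<gamma> s))"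
      by (intro mult_left_mono) auto
    then show "Q y \<in> {w. \<bar>cr e w\<bar> \<le> \<epsilon> * norm w}"
      unfolding Q_def by (simp add: cr_scale abs_mult mult_ac)
  qed
  ultimately have "v \<in> {w. \<bar>cr e w\<bar> \<le> \<epsilon> * norm w}" using lim by (intro Lim_in_closed_set[OF _ _ nt])
  then show ?thesis by simp
qed

text \<open>The preimages of the two sets are closed and disjoint away from the one parameter of X;
  the intervals before and after it are connected, so each lies in one preimage.\<close>

lemma arc_splits:
  fixes \<gamma> :: "real \<Rightarrow> pt"
  assumes c: "continuous_on {a..b} \<gamma>" "inj_on \<gamma> {a..b}" "a < b" and cl: "closed C1" "closed C2"
    and sub: "\<gamma> ` {a..b} \<subseteq> C1 \<union> C2" "C1 \<inter> C2 \<subseteq> {X}"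
  shows "\<gamma> ` {a..b} \<subseteq> C1 \<or> \<gamma> ` {a..b} \<subseteq> C2 \<or> (\<exists>s. a < s \<and> s < b \<and>
     ((\<gamma> ` {a..s} \<subseteq> C1 \<and> \<gamma> ` {s..b} \<subseteq> C2) \<or> (\<gamma> ` {a..s} \<subseteq> C2 \<and> \<gamma> ` {s..b} \<subseteq> C1)))"
proof -
  define S1 S2 where "S1 = {a..b} \<inter> \<gamma> -` C1" and "S2 = {a..b} \<inter> \<gamma> -` C2"
  have S: "closed S1" "closed S2" unfolding S1_def S2_def
    by (auto intro!: continuous_closed_preimage c cl)
  have one: "J \<subseteq> S1 \<or> J \<subseteq> S2" if "connected J" "J \<subseteq> {a..b}" "X \<notin> \<gamma> ` J" for J
  proof -
    have "S1 \<inter> S2 \<inter> J = {}" using that(3) sub(2) unfolding S1_def S2_def by blast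
    moreover have "J \<subseteq> S1 \<union> S2" using that(2) sub(1) unfolding S1_def S2_def by blast
    moreover note that(1)
    ultimately have "S1 \<inter> J = {} \<or> S2 \<inter> J = {}" using S unfolding connected_closed by blast
    then show ?thesis using \<open>J \<subseteq> S1 \<union> S2\<close> by blast
  qed
  have sS: "\<gamma> ` J \<subseteq> C1 \<longleftrightarrow> J \<subseteq> S1" "\<gamma> ` J \<subseteq> C2 \<longleftrightarrow> J \<subseteq> S2" if "J \<subseteq> {a..b}" for J
    using that by (auto simp: S1_def S2_def)
  show ?thesis
  proof (cases "X \<in> \<gamma> ` {a..b}")
    case False
    then show ?thesis using one[of "{a..b}"] sS[of "{a..b}"] by auto
  next
    case True
    then obtain s where s: "s \<in> {a..b}" "\<gamma> s = X" by auto
    have nX: "X \<notin> \<gamma> ` {a..<s}" "X \<notin> \<gamma> ` {s<..b}"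
      using s c(2) by (auto dest!: inj_onD)
    have l: "{a..s} \<subseteq> S1 \<or> {a..s} \<subseteq> S2" if "a < s"
    proof -
      have "{a..<s} \<subseteq> S1 \<or> {a..<s} \<subseteq> S2" using s nX by (intro one) auto
      then have "closure {a..<s} \<subseteq> S1 \<or> closure {a..<s} \<subseteq> S2" using S by (metis closure_minimal)
      then show ?thesis using that by simp
    qed
    have r: "{s..b} \<subseteq> S1 \<or> {s..b} \<subseteq> S2" if "s < b"
    proof -
      have "{s<..b} \<subseteq> S1 \<or> {s<..b} \<subseteq> S2" using s nX by (intro one) auto
      then have "closure {s<..b} \<subseteq> S1 \<or> closure {s<..b} \<subseteq> S2" using S by (metis closure_minimal)
      then show ?thesis using that by simp
    qed
    have u: "{a..b} = {a..s} \<union> {s..b}" using s by auto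
    consider "s = a" | "s = b" | "a < s" "s < b" using s by fastforce
    then show ?thesis
    proof cases
      case 1
      then show ?thesis using r c(3) sS[of "{a..b}"] by auto
    next
      case 2
      then show ?thesis using l c(3) sS[of "{a..b}"] by auto
    next
      case 3
      have "{a..s} \<subseteq> {a..b}" "{s..b} \<subseteq> {a..b}" using 3 by auto
      then show ?thesis using l[OF 3(1)] r[OF 3(2)] 3 sS[of "{a..b}"] sS[of "{a..s}"] sS[of "{s..b}"] u
        by (metis Un_least)
    qed
  qed
qed

text \<open>If the arc changes cone at a parameter x, its tangent there lies in both cones and can
  replace the two unrelated directions as a common reference. Each of the two comparisons doubles
  the constant, whence the factor 4.\<close>

lemma tangents_nearly_parallel:
  assumes g: "C2_reg_param \<gamma> \<gamma>1 a b" "inj_on \<gamma> {a..b}" and tc: "two_cones \<epsilon> (\<gamma> ` {a..b})" and eps: "0 \<le> \<epsilon>"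
    and st: "s \<in> {a..b}" "t \<in> {a..b}"
  shows "\<bar>cr (\<gamma>1 s) (\<gamma>1 t)\<bar> \<le> 4 * \<epsilon> * norm (\<gamma>1 s) * norm (\<gamma>1 t)"
proof -
  obtain X C1 C2 e1 e2 where C: "closed C1" "closed C2" "norm e1 = 1" "norm e2 = 1"
     "in_cone e1 \<epsilon> C1" "in_cone e2 \<epsilon> C2" "\<gamma> ` {a..b} \<subseteq> C1 \<union> C2" "C1 \<inter> C2 \<subseteq> {X}"
    using tc unfolding two_cones_def by blast
  note gD = C2_reg_paramD[OF g(1)]
  have cone: "\<bar>cr e (\<gamma>1 x)\<bar> \<le> \<epsilon> * norm (\<gamma>1 x)"
    if "in_cone e \<epsilon> C" "\<gamma> ` {c..d} \<subseteq> C" "{c..d} \<subseteq> {a..b}" "c < d" "x \<in> {c..d}" for c d x e C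
    by (rule derivative_in_cone[of \<gamma> _ x c d]) 
      (use that has_vector_derivative_within_subset[OF gD(2), of x "{c..d}"] in_cone_subset in auto)
  have weak: "\<bar>cr v w\<bar> \<le> 4 * \<epsilon> * norm v * norm w" if "\<bar>cr v w\<bar> \<le> 2 * \<epsilon> * norm v * norm w" for v w
  proof -
    have "0 \<le> 2 * \<epsilon> * norm v * norm w" using eps by simp
    then show ?thesis using that by linarith
  qed
  have whole: ?thesis if "in_cone e \<epsilon> C" "\<gamma> ` {a..b} \<subseteq> C" "norm e = 1" for e C
    by (rule weak, rule cr_common_direction[OF that(3)]) (use cone[OF that(1,2)] gD(1) st in auto)
  have split: ?thesis if "in_cone e \<epsilon> C" "in_cone e' \<epsilon> C'" "norm e = 1" "norm e' = 1"
     "\<gamma> ` {a..x} \<subseteq> C" "\<gamma> ` {x..b} \<subseteq> C'" "a < x" "x < b" for e e' C C' x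
  proof -
    have 1: "\<bar>cr e (\<gamma>1 y)\<bar> \<le> \<epsilon> * norm (\<gamma>1 y)" if "y \<in> {a..x}" for y
      by (rule cone[OF \<open>in_cone e \<epsilon> C\<close> \<open>\<gamma> ` {a..x} \<subseteq> C\<close>]) (use \<open>a < x\<close> \<open>x < b\<close> that in auto)
    have 2: "\<bar>cr e' (\<gamma>1 y)\<bar> \<le> \<epsilon> * norm (\<gamma>1 y)" if "y \<in> {x..b}" for y
      by (rule cone[OF \<open>in_cone e' \<epsilon> C'\<close> \<open>\<gamma> ` {x..b} \<subseteq> C'\<close>]) (use \<open>a < x\<close> \<open>x < b\<close> that in auto)
    have x: "x \<in> {a..b}" using that by auto
    define m where "m = norm (\<gamma>1 x)"
    have m: "0 < m" using gD(3)[OF x] by (simp add: m_def)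
    define f where "f = (1 / m) *\<^sub>R \<gamma>1 x"
    have f: "norm f = 1" using m by (simp add: f_def m_def)
    have "\<bar>cr (\<gamma>1 x) (\<gamma>1 y)\<bar> \<le> 2 * \<epsilon> * norm (\<gamma>1 x) * norm (\<gamma>1 y)" if "y \<in> {a..b}" for y
      using cr_common_direction[OF \<open>norm e = 1\<close> 1 1, of x y] cr_common_direction[OF \<open>norm e' = 1\<close> 2 2, of x y]
        that \<open>a < x\<close> \<open>x < b\<close> by fastforce
    then have "\<bar>cr f (\<gamma>1 y)\<bar> \<le> (2 * \<epsilon>) * norm (\<gamma>1 y)" if "y \<in> {a..b}" for y
      using that m unfolding f_def cr_scale_left m_def[symmetric] by (simp add: abs_mult divide_simps mult_ac)
    from cr_common_direction[OF f this[OF st(1)] this[OF st(2)]] show ?thesis by simp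
  qed
  from arc_splits[OF gD(4) g(2) gD(1) C(1,2) C(7,8)]
  show ?thesis
    using whole[OF C(5) _ C(3)] whole[OF C(6) _ C(4)] split[OF C(5,6,3,4)] split[OF C(6,5,4,3)] by blast
qed

text \<open>The component of the tangent along e never vanishes, so by connectedness it keeps the
  sign it has at \<open>s0\<close>; then 2 \<epsilon> (e . \<gamma>) plus or minus
  \<open>cr e\<close> of \<gamma> is nondecreasing. Bounding by the signed component of the chord
  records, for positive \<epsilon>, that the arc advances along e.\<close>

lemma chords_in_cone:
  assumes g: "C2_reg_param \<gamma> \<gamma>1 a b"
    and par: "\<And>s t. s \<in> {a..b} \<Longrightarrow> t \<in> {a..b} \<Longrightarrow> \<bar>cr (\<gamma>1 s) (\<gamma>1 t)\<bar> \<le> \<epsilon> * norm (\<gamma>1 s) * norm (\<gamma>1 t)"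
    and eps: "0 \<le> \<epsilon>" "\<epsilon> \<le> 1 / 2" and s0: "s0 \<in> {a..b}" and e: "e = (1 / norm (\<gamma>1 s0)) *\<^sub>R \<gamma>1 s0"
    and st: "s \<in> {a..b}" "t \<in> {a..b}" "s \<le> t"
  shows "\<bar>cr e (\<gamma> t - \<gamma> s)\<bar> \<le> 2 * \<epsilon> * (e \<bullet> (\<gamma> t - \<gamma> s))"
proof -
  note gD = C2_reg_paramD[OF g]
  have m0: "0 < norm (\<gamma>1 s0)" using gD(3)[OF s0] by simp
  have ne: "norm e = 1" using m0 by (simp add: e)
  have cre: "\<bar>cr e (\<gamma>1 x)\<bar> \<le> \<epsilon> * norm (\<gamma>1 x)" if "x \<in> {a..b}" for x
    using par[OF s0 that] m0 unfolding e cr_scale_left by (simp add: abs_mult divide_simps mult_ac)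
  have half: "norm (\<gamma>1 x) / 2 \<le> \<bar>e \<bullet> \<gamma>1 x\<bar>" if "x \<in> {a..b}" for x
  proof -
    have "\<bar>cr e (\<gamma>1 x)\<bar> \<le> 1 / 2 * norm (\<gamma>1 x)"
      using cre[OF that] mult_right_mono[OF eps(2) norm_ge_zero[of "\<gamma>1 x"]] by linarith
    then have "\<bar>cr e (\<gamma>1 x)\<bar>\<^sup>2 \<le> (norm (\<gamma>1 x) / 2)\<^sup>2" by (intro power_mono) auto
    moreover have four: "(2::real)\<^sup>2 = 4" by simp
    ultimately have "(norm (\<gamma>1 x) / 2)\<^sup>2 \<le> \<bar>e \<bullet> \<gamma>1 x\<bar>\<^sup>2"
      using cr_inner_identity[of e "\<gamma>1 x"] zero_le_power2[of "norm (\<gamma>1 x)"]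
      unfolding ne power_mult_distrib power_divide power2_abs one_power2 mult_1 four by linarith
    then show ?thesis by (rule power2_le_imp_le) simp
  qed
  have nz: "e \<bullet> \<gamma>1 x \<noteq> 0" if "x \<in> {a..b}" for x using half[OF that] gD(3)[OF that] by auto
  have pos: "0 < e \<bullet> \<gamma>1 x" if x: "x \<in> {a..b}" for x
  proof (rule ccontr)
    assume "\<not> 0 < e \<bullet> \<gamma>1 x"
    then have xn: "e \<bullet> \<gamma>1 x < 0" using nz[OF x] by linarith
    have p0: "0 < e \<bullet> \<gamma>1 s0" using m0 by (simp add: e)
    have cont: "continuous_on {a..b} (\<lambda>x. e \<bullet> \<gamma>1 x)" by (intro continuous_intros gD)
    have "connected ((\<lambda>x. e \<bullet> \<gamma>1 x) ` {a..b})" by (rule connected_continuous_image[OF cont]) simp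
    then have "0 \<in> (\<lambda>x. e \<bullet> \<gamma>1 x) ` {a..b}"
      using connectedD_interval[of "(\<lambda>x. e \<bullet> \<gamma>1 x) ` {a..b}" "e \<bullet> \<gamma>1 x" "e \<bullet> \<gamma>1 s0" 0] xn p0 x s0 by auto
    then show False using nz by auto
  qed
  have slope: "\<bar>cr e (\<gamma>1 x)\<bar> \<le> 2 * \<epsilon> * (e \<bullet> \<gamma>1 x)" if "x \<in> {a..b}" for x
  proof -
    have "norm (\<gamma>1 x) \<le> 2 * (e \<bullet> \<gamma>1 x)" using half[OF that] pos[OF that] by simp
    then have "\<epsilon> * norm (\<gamma>1 x) \<le> \<epsilon> * (2 * (e \<bullet> \<gamma>1 x))" using eps by (intro mult_left_mono)
    then show ?thesis using cre[OF that] by simp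
  qed
  have mono: "2 * \<epsilon> * (e \<bullet> \<gamma> s) + k * cr e (\<gamma> s) \<le> 2 * \<epsilon> * (e \<bullet> \<gamma> t) + k * cr e (\<gamma> t)" if k: "\<bar>k\<bar> = 1" for k
  proof (rule DERIV_nonneg_imp_increasing_open[OF st(3)])
    show "continuous_on {s..t} (\<lambda>x. 2 * \<epsilon> * (e \<bullet> \<gamma> x) + k * cr e (\<gamma> x))"
      using st by (intro continuous_intros continuous_on_subset[OF gD(4)]) auto
    fix x assume x: "s < x" "x < t"
    then have xab: "x \<in> {a..b}" "a < x" "x < b" using st by auto
    have d: "(\<gamma> has_vector_derivative \<gamma>1 x) (at x)"
      using gD(2)[OF xab(1)] at_within_Icc_at[OF xab(2,3)] by simp
    have bl: "bounded_linear (\<lambda>v. 2 * \<epsilon> * (e \<bullet> v) + k * cr e v)"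
      unfolding cr_def by (intro bounded_linear_intros bounded_linear_vec_nth)
    have "((\<lambda>x. 2 * \<epsilon> * (e \<bullet> \<gamma> x) + k * cr e (\<gamma> x)) has_vector_derivative (2 * \<epsilon> * (e \<bullet> \<gamma>1 x) + k * cr e (\<gamma>1 x))) (at x)"
      by (rule bounded_linear.has_vector_derivative[OF bl d])
    moreover have "0 \<le> 2 * \<epsilon> * (e \<bullet> \<gamma>1 x) + k * cr e (\<gamma>1 x)"
      using slope[OF xab(1)] k by (auto simp: abs_if split: if_splits)
    ultimately show "\<exists>y. ((\<lambda>x. 2 * \<epsilon> * (e \<bullet> \<gamma> x) + k * cr e (\<gamma> x)) has_real_derivative y) (at x) \<and> 0 \<le> y"
      by (auto simp: has_real_derivative_iff_has_vector_derivative)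
  qed
  show ?thesis using mono[of 1] mono[of "-1"] by (simp add: cr_diff inner_diff_right abs_le_iff algebra_simps)
qed

subsection \<open>Gradient bounds along the curve and the reduced system\<close>

text \<open>For a unit vector e this is the inner product computed in the orthonormal frame of e and
  its rotation by a right angle.\<close>

lemma cr_inner_expand: "(norm e)\<^sup>2 * (v \<bullet> w) = (e \<bullet> v) * (e \<bullet> w) + cr e v * cr e w"
  unfolding norm_pt inner_pt cr_def by (simp add: power2_eq_square algebra_simps)

text \<open>A coordinate that is extremal at an interior parameter has zero derivative; this is
  applied where the arc touches a side of the rectangle from inside.\<close>

lemma touching_tangent:
  assumes g: "C2_reg_param \<gamma> \<gamma>1 a b" and s: "a < s" "s < b" 
    and ext: "(\<forall>y\<in>{a..b}. \<gamma> y $ i \<le> \<gamma> s $ i) \<or> (\<forall>y\<in>{a..b}. \<gamma> s $ i \<le> \<gamma> y $ i)"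
  shows "\<gamma>1 s $ i = 0"
proof -
  have "(\<gamma> has_vector_derivative \<gamma>1 s) (at s)"
    using C2_reg_paramD(2)[OF g, of s] at_within_Icc_at[OF s] s by simp
  then have "((\<lambda>y. \<gamma> y $ i) has_vector_derivative \<gamma>1 s $ i) (at s)"
    by (rule bounded_linear.has_vector_derivative[OF bounded_linear_vec_nth])
  then have d: "((\<lambda>y. \<gamma> y $ i) has_real_derivative \<gamma>1 s $ i) (at s)"
    by (simp add: has_real_derivative_iff_has_vector_derivative)
  define r where "r = min (s - a) (b - s)"
  have r: "0 < r" "\<And>y. \<bar>s - y\<bar> < r \<Longrightarrow> y \<in> {a..b}" using s by (auto simp: r_def abs_less_iff)
  from ext show ?thesis
  proof
    assume "\<forall>y\<in>{a..b}. \<gamma> y $ i \<le> \<gamma> s $ i"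
    then show ?thesis using DERIV_local_max[OF d r(1)] r(2) by blast
  next
    assume "\<forall>y\<in>{a..b}. \<gamma> s $ i \<le> \<gamma> y $ i"
    then show ?thesis using DERIV_local_min[OF d r(1)] r(2) by blast
  qed
qed

text \<open>Exact bounds are known for the derivative along n at points of the line DE. Replacing v
  by its component along n costs 28 \<kappa> after division by n . v, and replacing F by a suitable
  point Y of the line costs 72 \<kappa>; with \<kappa> = 2 \<epsilon> the total is 200
  \<epsilon>.\<close>

lemma rect_curve_gradient:
  fixes x0 x1 y0 y1 :: real and n D E F v :: pt
  defines "P \<equiv> rect_vertices x0 x1 y0 y1"
  assumes xy: "x0 < x1" "y0 < y1" and n: "norm n = 1" "n \<bullet> (E - D) = 0" "D \<noteq> E"
    and g: "C2_reg_param \<gamma> \<gamma>1 a b" "\<gamma> ` {a..b} \<subseteq> elem P"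
    and par: "\<And>s t. s \<in> {a..b} \<Longrightarrow> t \<in> {a..b} \<Longrightarrow> \<bar>cr (\<gamma>1 s) (\<gamma>1 t)\<bar> \<le> \<epsilon> * norm (\<gamma>1 s) * norm (\<gamma>1 t)"
    and eps: "0 \<le> \<epsilon>" "\<epsilon> \<le> 1 / 4"
    and D: "D \<in> frontier (elem P)" "sD \<in> {a..b}" "\<gamma> sD = D" and E: "E \<in> frontier (elem P)" "sE \<in> {a..b}" "\<gamma> sE = E"
    and F: "sF \<in> {a..b}" "\<gamma> sF = F" "F \<noteq> D" "F \<noteq> E"
    and v: "norm v = 1" "v \<bullet> \<gamma>1 sF = 0" "n \<bullet> v > 0"
  shows "- (200 * \<epsilon>) \<le> dderiv (pos_interp P n D) F v / (n \<bullet> v)"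
    "dderiv (pos_interp P n D) F v / (n \<bullet> v) \<le> 1 + 200 * \<epsilon>"
proof -
  let ?G = "dderiv (pos_interp P n D)"
  define R where "R = sqrt ((x1 - x0)\<^sup>2 + (y1 - y0)\<^sup>2)"
  have R2: "R\<^sup>2 = (x1 - x0)\<^sup>2 + (y1 - y0)\<^sup>2" by (simp add: R_def)
  have R0: "0 \<le> R" by (simp add: R_def)
  have T: "elem P = {X. x0 \<le> X$1 \<and> X$1 \<le> x1 \<and> y0 \<le> X$2 \<and> X$2 \<le> y1}"
    using xy by (auto simp: P_def elem_rect mem_box_cart forall_2)
  have inT: "D \<in> elem P" "E \<in> elem P" "F \<in> elem P" using g(2) D E F by auto
  have distT: "norm (X - Y) \<le> R" if "X \<in> elem P" "Y \<in> elem P" for X Y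
  proof (rule power2_le_imp_le[OF _ R0])
    have "((X - Y)$1)\<^sup>2 \<le> (x1 - x0)\<^sup>2" "((X - Y)$2)\<^sup>2 \<le> (y1 - y0)\<^sup>2"
      using that xy unfolding T by (auto intro!: abs_le_square_iff[THEN iffD1])
    then show "(norm (X - Y))\<^sup>2 \<le> R\<^sup>2" unfolding norm_pt R2 by linarith
  qed
  have Db: "x0 \<le> D$1" "D$1 \<le> x1" "y0 \<le> D$2" "D$2 \<le> y1" using inT(1) unfolding T by auto
  obtain b' c d where grad: "\<And>F v. ?G F v
        = b' * v$1 + c * v$2 + 2 * d * ((F$1 - (x0 + x1) / 2) * v$1 - (F$2 - (y0 + y1) / 2) * v$2)"
    and bcd: "\<bar>b'\<bar> \<le> 1" "\<bar>c\<bar> \<le> 1" "\<bar>d\<bar> * R \<le> 6"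
    and line: "\<And>F. x0 \<le> F$1 \<Longrightarrow> F$1 \<le> x1 \<Longrightarrow> y0 \<le> F$2 \<Longrightarrow> F$2 \<le> y1 \<Longrightarrow> n \<bullet> (F - D) = 0 \<Longrightarrow>
        0 \<le> ?G F n \<and> ?G F n \<le> 1"
    by (rule rect_gradient[OF xy n(1) Db, folded P_def R_def]) (rule that, blast+)
  define \<kappa> where "\<kappa> = 2 * \<epsilon>"
  have k: "0 \<le> \<kappa>" "\<kappa> \<le> 1 / 2" using eps by (auto simp: \<kappa>_def)
  define e where "e = (1 / norm (\<gamma>1 sF)) *\<^sub>R \<gamma>1 sF"
  have m0: "0 < norm (\<gamma>1 sF)" using C2_reg_paramD(3)[OF g(1) F(1)] by simp
  have e1: "norm e = 1" using m0 by (simp add: e_def)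
  have cone: "\<bar>cr e (\<gamma> t - \<gamma> s)\<bar> \<le> \<kappa> * (e \<bullet> (\<gamma> t - \<gamma> s))" if "s \<in> {a..b}" "t \<in> {a..b}" "s \<le> t" for s t
    unfolding \<kappa>_def by (rule chords_in_cone[OF g(1) par eps(1) _ F(1) e_def that]) (use eps in auto)
  have coneabs: "\<bar>cr e (\<gamma> t - \<gamma> s)\<bar> \<le> \<kappa> * norm (\<gamma> t - \<gamma> s)" if "s \<in> {a..b}" "t \<in> {a..b}" for s t
  proof -
    have "\<bar>cr e (\<gamma> t - \<gamma> s)\<bar> \<le> \<kappa> * (e \<bullet> (\<gamma> t - \<gamma> s)) \<or> \<bar>cr e (\<gamma> t - \<gamma> s)\<bar> \<le> \<kappa> * (e \<bullet> (\<gamma> s - \<gamma> t))"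
      using cone[of s t] cone[of t s] that by (cases "s \<le> t") (auto simp: cr_diff abs_minus_commute)
    moreover have "\<kappa> * (e \<bullet> (\<gamma> t - \<gamma> s)) \<le> \<kappa> * norm (\<gamma> t - \<gamma> s)" "\<kappa> * (e \<bullet> (\<gamma> s - \<gamma> t)) \<le> \<kappa> * norm (\<gamma> t - \<gamma> s)"
      using norm_cauchy_schwarz[of e "\<gamma> t - \<gamma> s"] norm_cauchy_schwarz[of e "\<gamma> s - \<gamma> t"] e1 k(1)
      by (auto intro!: mult_left_mono simp: norm_minus_commute)
    ultimately show ?thesis by linarith
  qed
  have expand: "x \<bullet> y = (e \<bullet> x) * (e \<bullet> y) + cr e x * cr e y" for x y
    using cr_inner_expand[of e x y] e1 by simp
  \<comment> \<open>DE is a chord of the arc, hence nearly parallel to e, and n is orthogonal to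
    it.\<close>
  have ne: "\<bar>e \<bullet> n\<bar> \<le> \<kappa>"
  proof -
    let ?\<Delta> = "E - D"
    have p: "0 < norm ?\<Delta>" using n(3) by simp
    have "(norm ?\<Delta>)\<^sup>2 * (e \<bullet> n) = cr ?\<Delta> e * cr ?\<Delta> n"
      using cr_inner_expand[of ?\<Delta> e n] n(2) by (simp add: inner_commute)
    then have "(norm ?\<Delta>)\<^sup>2 * \<bar>e \<bullet> n\<bar> = \<bar>cr ?\<Delta> e\<bar> * \<bar>cr ?\<Delta> n\<bar>"
      by (metis abs_mult abs_power2 power2_abs abs_norm_cancel)
    also have "\<dots> \<le> (\<kappa> * norm ?\<Delta>) * norm ?\<Delta>"
    proof (rule mult_mono)
      have "\<bar>cr ?\<Delta> e\<bar> = \<bar>cr e ?\<Delta>\<bar>" by (simp add: cr_def abs_minus_commute mult.commute)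
      then show "\<bar>cr ?\<Delta> e\<bar> \<le> \<kappa> * norm ?\<Delta>" using coneabs[OF D(2) E(2)] D E by simp
      show "\<bar>cr ?\<Delta> n\<bar> \<le> norm ?\<Delta>" using abs_cr_le[of ?\<Delta> n] n by simp
    qed (use k in auto)
    finally have "(norm ?\<Delta>)\<^sup>2 * \<bar>e \<bullet> n\<bar> \<le> (norm ?\<Delta>)\<^sup>2 * \<kappa>" by (simp add: power2_eq_square mult_ac)
    then show ?thesis using p by simp
  qed
  have ev: "e \<bullet> v = 0" using v(2) by (simp add: e_def inner_commute)
  have nv2: "(n \<bullet> v)\<^sup>2 = 1 - (e \<bullet> n)\<^sup>2"
  proof -
    have "n \<bullet> v = cr e n * cr e v" using expand[of n v] ev by simp
    moreover have "(cr e v)\<^sup>2 = 1" using cr_inner_identity[of e v] e1 v ev by simp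
    moreover have "(cr e n)\<^sup>2 = 1 - (e \<bullet> n)\<^sup>2" using cr_inner_identity[of e n] e1 n by simp
    ultimately show ?thesis by (simp add: power_mult_distrib)
  qed
  have ne2: "(e \<bullet> n)\<^sup>2 \<le> \<kappa>\<^sup>2" using ne k by (intro abs_le_square_iff[THEN iffD1]) auto
  have nvh: "1 / 2 \<le> n \<bullet> v"
  proof (rule power2_le_imp_le)
    have "\<kappa>\<^sup>2 \<le> (1/2)\<^sup>2" using k by (intro power_mono) auto
    then show "(1 / 2)\<^sup>2 \<le> (n \<bullet> v)\<^sup>2" using ne2 unfolding nv2 by (simp add: power2_eq_square)
  qed (use v in auto)
  \<comment> \<open>The part of v orthogonal to n; its length is |e . n|.\<close>
  define w where "w = v - (n \<bullet> v) *\<^sub>R n"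
  have wn: "norm w \<le> \<kappa>"
  proof (rule power2_le_imp_le[OF _ k(1)])
    have "(norm w)\<^sup>2 = v \<bullet> v - 2 * (n \<bullet> v) * (n \<bullet> v) + (n \<bullet> v)\<^sup>2 * (n \<bullet> n)"
      unfolding w_def power2_norm_eq_inner by (simp add: inner_diff_left inner_diff_right inner_commute power2_eq_square)
    also have "\<dots> = (e \<bullet> n)\<^sup>2" using n v nv2 by (simp add: power2_norm_eq_inner[symmetric] power2_eq_square)
    finally show "(norm w)\<^sup>2 \<le> \<kappa>\<^sup>2" using ne2 by simp
  qed
  have comp: "\<bar>x$1\<bar> \<le> norm x" "\<bar>x$2\<bar> \<le> norm x" for x :: pt using component_le_norm_cart by auto
  have dR: "2 * \<bar>d\<bar> * (m * R) \<le> 12 * m" if "0 \<le> m" for m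
    using mult_left_mono[OF bcd(3), of "2 * m"] that by (simp add: mult_ac)
  have gw: "\<bar>?G F w\<bar> \<le> 14 * \<kappa>"
  proof -
    have WH: "x1 - x0 \<le> R" "y1 - y0 \<le> R"
      unfolding R_def by (auto intro!: real_le_rsqrt)
    have f: "\<bar>F$1 - (x0 + x1) / 2\<bar> \<le> R / 2" "\<bar>F$2 - (y0 + y1) / 2\<bar> \<le> R / 2"
      using inT(3) WH unfolding T by (auto simp: abs_le_iff field_simps)
    have w12: "\<bar>w$1\<bar> \<le> \<kappa>" "\<bar>w$2\<bar> \<le> \<kappa>" using comp[of w] wn by auto
    have "\<bar>(F$1 - (x0 + x1) / 2) * w$1 - (F$2 - (y0 + y1) / 2) * w$2\<bar> \<le> (R / 2) * \<kappa> + (R / 2) * \<kappa>"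
      using mult_mono[OF f(1) w12(1)] mult_mono[OF f(2) w12(2)] R0
        abs_triangle_ineq4[of "(F$1 - (x0 + x1) / 2) * w$1" "(F$2 - (y0 + y1) / 2) * w$2"]
      by (simp add: abs_mult)
    then have "2 * \<bar>d\<bar> * \<bar>(F$1 - (x0 + x1) / 2) * w$1 - (F$2 - (y0 + y1) / 2) * w$2\<bar> \<le> 2 * \<bar>d\<bar> * (\<kappa> * R)"
      by (intro mult_left_mono) (auto simp: mult.commute)
    then have 1: "\<bar>2 * d * ((F$1 - (x0 + x1) / 2) * w$1 - (F$2 - (y0 + y1) / 2) * w$2)\<bar> \<le> 12 * \<kappa>"
      using dR[OF k(1)] unfolding abs_mult by (simp add: mult_ac)
    have 2: "\<bar>b' * w$1\<bar> \<le> 1 * \<kappa>" "\<bar>c * w$2\<bar> \<le> 1 * \<kappa>"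
      unfolding abs_mult by (intro mult_mono bcd w12; simp)+
    show ?thesis unfolding grad using 1 2 by linarith
  qed
  \<comment> \<open>The derivative along n varies with the point only through the indefinite form
    x_1 n_1 - x_2 n_2 of the displacement. This form has to be small, not the displacement
    itself.\<close>
  have gdiff: "\<bar>?G F n - ?G Y n\<bar> \<le> 12 * m"
    if "\<bar>(F - Y)$1 * n$1 - (F - Y)$2 * n$2\<bar> \<le> m * R" "0 \<le> m" for Y m
  proof -
    have "?G F n - ?G Y n = 2 * d * ((F - Y)$1 * n$1 - (F - Y)$2 * n$2)"
      unfolding grad by (simp add: algebra_simps)
    then have "\<bar>?G F n - ?G Y n\<bar> = 2 * \<bar>d\<bar> * \<bar>(F - Y)$1 * n$1 - (F - Y)$2 * n$2\<bar>"
      by (simp add: abs_mult)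
    also have "\<dots> \<le> 2 * \<bar>d\<bar> * (m * R)" using that by (intro mult_left_mono) auto
    finally show ?thesis using dR[OF that(2)] by linarith
  qed
  have n12: "\<bar>n$1\<bar> \<le> 1" "\<bar>n$2\<bar> \<le> 1" using comp[of n] n by auto
  have "\<exists>Y\<in>elem P. n \<bullet> (Y - D) = 0 \<and> \<bar>(F - Y)$1 * n$1 - (F - Y)$2 * n$2\<bar> \<le> (6 * \<kappa>) * R"
  proof (cases "(sD \<le> sF \<and> sF \<le> sE) \<or> (sE \<le> sF \<and> sF \<le> sD)")
    case True
    have crz: "X = 0" if "e \<bullet> X = 0" "cr e X = 0" for X :: pt
      using cr_inner_identity[of e X] that e1 by simp
    \<comment> \<open>For \<epsilon> = 0 the bound \<open>cone\<close> carries no sign; weakening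
      the parallelism to 1/4 recovers that the arc advances along e.\<close>
    have pos: "e \<bullet> (\<gamma> t - \<gamma> s) \<ge> 0" if "s \<in> {a..b}" "t \<in> {a..b}" "s \<le> t" for s t
    proof -
      have par4: "\<bar>cr (\<gamma>1 s) (\<gamma>1 t)\<bar> \<le> 1 / 4 * norm (\<gamma>1 s) * norm (\<gamma>1 t)" if "s \<in> {a..b}" "t \<in> {a..b}" for s t
      proof -
        have "\<epsilon> * norm (\<gamma>1 s) * norm (\<gamma>1 t) \<le> 1 / 4 * norm (\<gamma>1 s) * norm (\<gamma>1 t)"
          using eps by (intro mult_right_mono) auto
        then show ?thesis using par[OF that] by linarith
      qed
      have "\<bar>cr e (\<gamma> t - \<gamma> s)\<bar> \<le> 2 * (1 / 4) * (e \<bullet> (\<gamma> t - \<gamma> s))"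
        by (rule chords_in_cone[OF g(1) par4 _ _ F(1) e_def that]) auto
      then show ?thesis by linarith
    qed
    have ED: "e \<bullet> (E - D) \<noteq> 0"
    proof
      assume z: "e \<bullet> (E - D) = 0"
      then have "e \<bullet> (\<gamma> sE - \<gamma> sD) = 0" "e \<bullet> (\<gamma> sD - \<gamma> sE) = 0" using D E by (auto simp: inner_diff_right)
      then have "cr e (E - D) = 0" using cone[OF D(2) E(2)] cone[OF E(2) D(2)] D E
        by (cases "sD \<le> sE") (auto simp: cr_diff)
      then show False using crz[OF z] n(3) by simp
    qed
    \<comment> \<open>Y will be the point of DE with the same component along e as F. The order of
      the parameters gives 0 \<le> t \<le> 1, and the orthogonal offset is at most 2 \<kappa>
      R.\<close>
    define t where "t = e \<bullet> (F - D) / (e \<bullet> (E - D))"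
    have t: "0 \<le> t" "t \<le> 1"
    proof -
      have split: "e \<bullet> (E - D) = e \<bullet> (F - D) + e \<bullet> (E - F)" by (simp add: inner_diff_right)
      from True show "0 \<le> t" "t \<le> 1"
        using pos[OF D(2) F(1)] pos[OF F(1) E(2)] pos[OF E(2) F(1)] pos[OF F(1) D(2)] D E F ED split
        by (auto simp: t_def divide_simps inner_diff_right)
    qed
    define Y where "Y = D + t *\<^sub>R (E - D)"
    have "Y \<in> closed_segment D E" unfolding Y_def in_segment using t
      by (intro exI[of _ t]) (auto simp: algebra_simps)
    then have YT: "Y \<in> elem P" using closed_segment_subset[OF inT(1,2) convex_elem] by blast
    have Yn: "n \<bullet> (Y - D) = 0" using n(2) by (simp add: Y_def)
    have FY: "F - Y = (F - D) - t *\<^sub>R (E - D)" by (simp add: Y_def)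
    have eY: "e \<bullet> (F - Y) = 0" unfolding FY using ED by (simp add: t_def inner_diff_right)
    have "\<bar>cr e (F - D)\<bar> \<le> \<kappa> * R"
      using coneabs[OF D(2) F(1)] D F mult_left_mono[OF distT[OF inT(3,1)] k(1)] by simp
    moreover have "\<bar>cr e (E - D)\<bar> \<le> \<kappa> * R"
      using coneabs[OF D(2) E(2)] D E mult_left_mono[OF distT[OF inT(2,1)] k(1)] by simp
    then have "t * \<bar>cr e (E - D)\<bar> \<le> 1 * (\<kappa> * R)" using t k R0 by (intro mult_mono) auto
    ultimately have "\<bar>cr e (F - Y)\<bar> \<le> 2 * \<kappa> * R"
      unfolding FY cr_diff[of e "F - D"] cr_scale
      using abs_triangle_ineq4[of "cr e (F - D)" "t * cr e (E - D)"] t by (simp add: abs_mult)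
    moreover have "(norm (F - Y))\<^sup>2 = \<bar>cr e (F - Y)\<bar>\<^sup>2"
      using cr_inner_identity[of e "F - Y"] eY e1 by simp
    then have "norm (F - Y) = \<bar>cr e (F - Y)\<bar>" by (rule power2_eq_imp_eq) auto
    ultimately have nFY: "\<bar>(F - Y)$1\<bar> \<le> 2 * \<kappa> * R" "\<bar>(F - Y)$2\<bar> \<le> 2 * \<kappa> * R"
      using comp[of "F - Y"] by linarith+
    have "\<bar>(F - Y)$1 * n$1\<bar> \<le> 2 * \<kappa> * R * 1" "\<bar>(F - Y)$2 * n$2\<bar> \<le> 2 * \<kappa> * R * 1"
      unfolding abs_mult using k R0 by (intro mult_mono nFY n12; simp)+
    then have "\<bar>(F - Y)$1 * n$1 - (F - Y)$2 * n$2\<bar> \<le> 4 * (\<kappa> * R)" by linarith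
    moreover have "0 \<le> \<kappa> * R" using k R0 by simp
    ultimately have "\<bar>(F - Y)$1 * n$1 - (F - Y)$2 * n$2\<bar> \<le> (6 * \<kappa>) * R" by linarith
    then show ?thesis using YT Yn by blast
  next
    case False
    \<comment> \<open>F is outside the parameter interval between D and E, so the endpoint nearer to
      it in parameter lies strictly between F and the other one, hence at an interior parameter of
      the arc.\<close>
    have "sD \<noteq> sF" "sE \<noteq> sF" "sD \<noteq> sE" using D E F n(3) by auto
    then obtain sX X where X: "a < sX" "sX < b" "\<gamma> sX = X" "X \<in> frontier (elem P)"
    proof -
      have "(a < sD \<and> sD < b) \<or> (a < sE \<and> sE < b)"
        using False D(2) E(2) F(1) \<open>sD \<noteq> sF\<close> \<open>sE \<noteq> sF\<close> \<open>sD \<noteq> sE\<close> by auto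
      then show ?thesis using that D E by blast
    qed
    have Pr: "mesh_cell P" unfolding is_rectangle_def P_def using xy by auto
    have "X$1 = x0 \<or> X$1 = x1 \<or> X$2 = y0 \<or> X$2 = y1"
      using X(4) unfolding frontier_elem[OF Pr] unfolding P_def length_rect_vertices UN_less_4
        rect_edges[OF less_imp_le[OF xy(1)] less_imp_le[OF xy(2)]] by auto
    then have tan: "\<gamma>1 sX $ 1 = 0 \<or> \<gamma>1 sX $ 2 = 0"
      using touching_tangent[OF g(1) X(1,2), of 1] touching_tangent[OF g(1) X(1,2), of 2] g(2) X(3)
      unfolding T by (auto simp: image_subset_iff)
    have sX: "sX \<in> {a..b}" using X by auto
    have mX: "0 < norm (\<gamma>1 sX)" using C2_reg_paramD(3)[OF g(1) sX] by simp
    have "\<bar>cr e (\<gamma>1 sX)\<bar> \<le> \<epsilon> * norm (\<gamma>1 sX)"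
      using par[OF F(1) sX] m0 unfolding e_def cr_scale_left by (simp add: abs_mult divide_simps mult_ac)
    then have ce: "\<bar>cr e (\<gamma>1 sX)\<bar> \<le> \<kappa> * norm (\<gamma>1 sX)"
      using eps mX mult_right_mono[of \<epsilon> \<kappa> "norm (\<gamma>1 sX)"] by (simp add: \<kappa>_def)
    have esmall: "\<bar>e$1\<bar> \<le> \<kappa> \<or> \<bar>e$2\<bar> \<le> \<kappa>"
      using tan
    proof
      assume z: "\<gamma>1 sX $ 1 = 0"
      then have "norm (\<gamma>1 sX) = \<bar>\<gamma>1 sX $ 2\<bar>" by (simp add: norm_vec_def L2_set_def sum_2)
      then have "\<bar>e$1\<bar> * norm (\<gamma>1 sX) \<le> \<kappa> * norm (\<gamma>1 sX)" using ce z by (simp add: cr_def abs_mult)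
      then show ?thesis using mX by simp
    next
      assume z: "\<gamma>1 sX $ 2 = 0"
      then have "norm (\<gamma>1 sX) = \<bar>\<gamma>1 sX $ 1\<bar>" by (simp add: norm_vec_def L2_set_def sum_2)
      then have "\<bar>e$2\<bar> * norm (\<gamma>1 sX) \<le> \<kappa> * norm (\<gamma>1 sX)" using ce z by (simp add: cr_def abs_mult)
      then show ?thesis using mX by simp
    qed
    have crn: "\<bar>cr e n\<bar> \<le> 1" using abs_cr_le[of e n] e1 n by simp
    have e12: "\<bar>e$1\<bar> \<le> 1" "\<bar>e$2\<bar> \<le> 1" using comp[of e] e1 by auto
    have ee: "(e$1)\<^sup>2 + (e$2)\<^sup>2 = 1" using norm_pt[of e] e1 by simp
    have n1e: "n$1 = (e \<bullet> n) * e$1 - cr e n * e$2" and n2e: "n$2 = (e \<bullet> n) * e$2 + cr e n * e$1"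
    proof -
      have "n$1 * ((e$1)\<^sup>2 + (e$2)\<^sup>2) = (e \<bullet> n) * e$1 - cr e n * e$2"
        "n$2 * ((e$1)\<^sup>2 + (e$2)\<^sup>2) = (e \<bullet> n) * e$2 + cr e n * e$1"
        by (simp_all add: inner_pt cr_def power2_eq_square algebra_simps)
      then show "n$1 = (e \<bullet> n) * e$1 - cr e n * e$2" "n$2 = (e \<bullet> n) * e$2 + cr e n * e$1" unfolding ee by auto
    qed
    have prod: "\<bar>x * y\<bar> \<le> \<kappa>" if "\<bar>x\<bar> \<le> \<kappa> \<and> \<bar>y\<bar> \<le> 1 \<or> \<bar>x\<bar> \<le> 1 \<and> \<bar>y\<bar> \<le> \<kappa>" for x y
      using that mult_mono[of "\<bar>x\<bar>" \<kappa> "\<bar>y\<bar>" 1] mult_mono[of "\<bar>x\<bar>" 1 "\<bar>y\<bar>" \<kappa>] k by (auto simp: abs_mult)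
    \<comment> \<open>e is nearly parallel to a coordinate axis and n is nearly orthogonal to e, so
      one component of n is small.\<close>
    have nsmall: "\<bar>n$1\<bar> \<le> 2 * \<kappa> \<or> \<bar>n$2\<bar> \<le> 2 * \<kappa>"
      using esmall
    proof
      assume "\<bar>e$1\<bar> \<le> \<kappa>"
      then have "\<bar>n$2\<bar> \<le> 2 * \<kappa>" unfolding n2e
        using prod[of "e \<bullet> n" "e$2"] prod[of "cr e n" "e$1"] ne crn e12 by linarith
      then show ?thesis ..
    next
      assume "\<bar>e$2\<bar> \<le> \<kappa>"
      then have "\<bar>n$1\<bar> \<le> 2 * \<kappa>" unfolding n1e
        using prod[of "e \<bullet> n" "e$1"] prod[of "cr e n" "e$2"] ne crn e12 by linarith
      then show ?thesis ..
    qed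
    have FD: "norm (F - D) \<le> R" by (rule distT[OF inT(3,1)])
    have cF: "\<bar>cr e (F - D)\<bar> \<le> \<kappa> * R"
      using coneabs[OF D(2) F(1)] D F mult_left_mono[OF FD k(1)] by simp
    have "\<bar>n \<bullet> (F - D)\<bar> \<le> \<bar>e \<bullet> n\<bar> * \<bar>e \<bullet> (F - D)\<bar> + \<bar>cr e n\<bar> * \<bar>cr e (F - D)\<bar>"
      unfolding expand[of n "F - D"] using abs_triangle_ineq[of "(e \<bullet> n) * (e \<bullet> (F - D))" "cr e n * cr e (F - D)"]
      by (simp add: abs_mult)
    also have "\<dots> \<le> \<kappa> * R + 1 * (\<kappa> * R)"
    proof (rule add_mono)
      have "\<bar>e \<bullet> (F - D)\<bar> \<le> R" using Cauchy_Schwarz_ineq2[of e "F - D"] e1 FD by simp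
      then show "\<bar>e \<bullet> n\<bar> * \<bar>e \<bullet> (F - D)\<bar> \<le> \<kappa> * R" using ne k by (intro mult_mono) auto
      show "\<bar>cr e n\<bar> * \<bar>cr e (F - D)\<bar> \<le> 1 * (\<kappa> * R)" using crn cF by (intro mult_mono) auto
    qed
    finally have nF: "\<bar>n$1 * (F - D)$1 + n$2 * (F - D)$2\<bar> \<le> 2 * (\<kappa> * R)" unfolding inner_pt by (simp add: mult.commute[of R])
    have FD12: "\<bar>(F - D)$1\<bar> \<le> R" "\<bar>(F - D)$2\<bar> \<le> R" using comp[of "F - D"] FD by auto
    \<comment> \<open>The sum of the two products is at most 2 \<kappa> R, since F - D is nearly
      parallel to the line, and one of the products is at most 2 \<kappa> R. Up to sign the
      difference is the sum minus twice that product, so 2 + 4 = 6. Thus Y = D serves even if F is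
      far from D.\<close>
    have "\<bar>(F - D)$1 * n$1 - (F - D)$2 * n$2\<bar> \<le> 6 * (\<kappa> * R)"
      using nsmall
    proof
      assume "\<bar>n$1\<bar> \<le> 2 * \<kappa>"
      then have "\<bar>n$1 * (F - D)$1\<bar> \<le> (2 * \<kappa>) * R"
        unfolding abs_mult using FD12 k by (intro mult_mono) auto
      then show ?thesis using nF by (simp add: mult_ac)
    next
      assume "\<bar>n$2\<bar> \<le> 2 * \<kappa>"
      then have "\<bar>n$2 * (F - D)$2\<bar> \<le> (2 * \<kappa>) * R"
        unfolding abs_mult using FD12 k by (intro mult_mono) auto
      then show ?thesis using nF by (simp add: mult_ac)
    qed
    then show ?thesis using inT(1) by (intro bexI[of _ D]) auto
  qed
  then obtain Y where Y: "Y \<in> elem P" "n \<bullet> (Y - D) = 0" "\<bar>(F - Y)$1 * n$1 - (F - Y)$2 * n$2\<bar> \<le> (6 * \<kappa>) * R"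
    by blast
  have "0 \<le> ?G Y n" "?G Y n \<le> 1"
    using line[of Y] Y(1,2) unfolding T by auto
  moreover have "\<bar>?G F n - ?G Y n\<bar> \<le> 12 * (6 * \<kappa>)"
    using gdiff[OF Y(3)] k by simp
  ultimately have gn: "- (72 * \<kappa>) \<le> ?G F n" "?G F n \<le> 1 + 72 * \<kappa>"
    by linarith+
  have "?G F v = (n \<bullet> v) * ?G F n + ?G F w"
    unfolding grad w_def by (simp add: algebra_simps)
  then have q: "?G F v / (n \<bullet> v) = ?G F n + ?G F w / (n \<bullet> v)"
    using v(3) by (simp add: field_simps)
  have "14 * \<kappa> \<le> 28 * \<kappa> * (n \<bullet> v)" using mult_left_mono[OF nvh, of "28 * \<kappa>"] k by simp
  then have "\<bar>?G F w\<bar> \<le> 28 * \<kappa> * (n \<bullet> v)" using gw by linarith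
  then have "\<bar>?G F w / (n \<bullet> v)\<bar> \<le> 28 * \<kappa>"
    using v(3) by (simp add: abs_divide pos_divide_le_eq)
  then show "- (200 * \<epsilon>) \<le> ?G F v / (n \<bullet> v)"
    "?G F v / (n \<bullet> v) \<le> 1 + 200 * \<epsilon>"
    unfolding q using gn unfolding \<kappa>_def by linarith+
qed

section \<open>From the coupling conditions to the rank-one system\<close>

lemma affine_of_coupling:
  assumes N: "N = 3 \<or> N = 4" and fg: "f \<in> PiT N" "g \<in> PiT N" and DE: "D \<noteq> E" and n: "norm n = 1" "n \<bullet> (E - D) = 0"
    and e: "g D = f D" "g E = f E" and d2: "N = 4 \<Longrightarrow> d2x g 0 = d2x f 0"
  shows "\<exists>c. g = (\<lambda>X. f X + c * (n \<bullet> (X - D)))"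
proof -
  obtain a b c d where f: "f = pol a b c d" "N = 3 \<longrightarrow> d = 0" using fg(1) unfolding PiT_iff by blast
  obtain a' b' c' d' where g: "g = pol a' b' c' d'" "N = 3 \<longrightarrow> d' = 0" using fg(2) unfolding PiT_iff by blast
  have dd: "d' = d" using N f(2) g(2) d2 by (auto simp: f(1) g(1) d2x_pol)
  define p q where "p = b' - b" and "q = c' - c"
  have diff: "g X - f X = (a' - a) + p * X$1 + q * X$2" for X
    unfolding f g dd pol_def p_def q_def by (simp add: algebra_simps)
  have nn: "(n$1)\<^sup>2 + (n$2)\<^sup>2 = 1" using norm_pt[of n] n by simp
  \<comment> \<open>The difference of the two pieces is affine and vanishes at D and E; in the plane
    its gradient (p, q) is therefore a multiple of n.\<close>
  have "p * (E - D)$1 + q * (E - D)$2 = 0" using diff[of D] diff[of E] e by (simp add: algebra_simps)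
  moreover have "n$1 * (E - D)$1 + n$2 * (E - D)$2 = 0" using n(2) by (simp add: inner_pt)
  ultimately have 1: "(p * n$2 - q * n$1) * (E - D)$1 = 0" "(p * n$2 - q * n$1) * (E - D)$2 = 0" by algebra+
  have "(E - D)$1 \<noteq> 0 \<or> (E - D)$2 \<noteq> 0" using DE by (auto intro: pt_eqI)
  then have 2: "p * n$2 = q * n$1" using 1 by auto
  define k where "k = p * n$1 + q * n$2"
  have pq: "p = k * n$1" "q = k * n$2" unfolding k_def using 2 nn by algebra+
  have "g X = f X + k * (n \<bullet> (X - D))" for X
  proof -
    have "(g X - f X) - (g D - f D) = k * (n \<bullet> (X - D))"
      unfolding diff pq by (simp add: inner_pt algebra_simps)
    then show ?thesis using e by simp
  qed
  then show ?thesis by blast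
qed

text \<open>Since \<delta> vanishes on \<open>Ip\<close>, the sum of \<gamma> \<delta> over
  \<open>Ic\<close> equals the sum over all edges, and c on \<open>Ic\<close> and v on
  \<open>Ip\<close> are restrictions of one solution of the full system. The abstract family
  \<delta> with the hypothesis \<open>avg\<close> keeps the geometry of the two variants out of the
  algebra.\<close>

lemma ife_system:
  fixes P :: "pt list" and n D E F w :: pt and v :: "nat \<Rightarrow> real" and \<delta> :: "nat \<Rightarrow> real"
  defines "\<psi> \<equiv> shape_fn P"
  defines "\<gamma> \<equiv> (\<lambda>i. dderiv (\<psi> i) F w)"
  assumes P: "mesh_cell P" and DE: "D \<noteq> E" and n: "norm n = 1" "n \<bullet> (E - D) = 0" "n \<bullet> w > 0"
    and beta: "\<beta>p > 0" "\<beta>m > 0"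
    and avg: "\<forall>i<length P. \<forall>f\<in>PiT (length P). \<forall>c.
        edge_mean (ife_fun Tpm f (\<lambda>X. f X + c * (n \<bullet> (X - D)))) P i = edge_mean f P i + c * \<delta> i"
    and k: "k = (1 / (\<beta>m / \<beta>p) - 1) / (n \<bullet> w)"
    and nz: "1 + k * (\<Sum>i<length P. \<gamma> i * \<delta> i) \<noteq> 0"
    and I: "Ip \<inter> Ic = {}" "Ip \<union> Ic = {..<length P}" "\<forall>i\<in>Ip. \<delta> i = 0"
    and b: "b = (\<lambda>i. v i - k * \<delta> i * (\<Sum>j\<in>Ip. \<gamma> j * v j))"
    and c: "c = (\<lambda>i. b i - k * (\<Sum>j\<in>Ic. \<gamma> j * b j) * \<delta> i / (1 + k * (\<Sum>j\<in>Ic. \<gamma> j * \<delta> j)))"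
    and c0: "c0 = k * ((\<Sum>i\<in>Ic. c i * \<gamma> i) + (\<Sum>i\<in>Ip. v i * \<gamma> i))"
    and \<phi>p: "\<phi>p = (\<lambda>X. (\<Sum>i\<in>Ic. c i * \<psi> i X) + (\<Sum>i\<in>Ip. v i * \<psi> i X))"
    and cond: "cond = (\<lambda>f g. is_IFE P D E F w \<beta>p \<beta>m f g \<and> (\<forall>i<length P. edge_mean (ife_fun Tpm f g) P i = v i))"
  shows "1 + k * (\<Sum>j\<in>Ic. \<gamma> j * \<delta> j) \<noteq> 0"
    "cond f g \<longleftrightarrow> f = \<phi>p \<and> g = (\<lambda>X. \<phi>p X + c0 * (n \<bullet> (X - D)))"
proof -
  let ?N = "length P"
  let ?L = "\<lambda>X. n \<bullet> (X - D)"
  have fin: "finite Ip" "finite Ic" using I(2) by (auto intro: finite_subset[of _ "{..<?N}"])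
  have split: "(\<Sum>i<?N. h i) = (\<Sum>i\<in>Ic. h i) + (\<Sum>i\<in>Ip. h i)" for h :: "nat \<Rightarrow> real"
    using I(1,2) fin sum.union_disjoint[of Ic Ip h] by (simp add: Int_commute Un_commute)
  define \<Delta> where "\<Delta> = (\<Sum>i<?N. \<gamma> i * \<delta> i)"
  have Dm: "(\<Sum>j\<in>Ic. \<gamma> j * \<delta> j) = \<Delta>" unfolding \<Delta>_def split using I(3) by simp
  show nz': "1 + k * (\<Sum>j\<in>Ic. \<gamma> j * \<delta> j) \<noteq> 0" using nz unfolding Dm \<Delta>_def .
  define S where "S = (\<Sum>i<?N. \<gamma> i * v i)"
  \<comment> \<open>The Sherman-Morrison solution for all edges at once; b and c perform the same
    elimination in two stages, after moving the known values on \<open>Ip\<close> to the right-hand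
    side.\<close>
  define x where "x i = v i - k * \<delta> i * (S / (1 + k * \<Delta>))" for i
  have nzD: "1 + k * \<Delta> \<noteq> 0" using nz unfolding \<Delta>_def .
  have cx: "c i = x i" for i
  proof -
    define Sp where "Sp = (\<Sum>j\<in>Ip. \<gamma> j * v j)"
    define Sm where "Sm = (\<Sum>j\<in>Ic. \<gamma> j * v j)"
    have "(\<Sum>j\<in>Ic. \<gamma> j * b j) = (\<Sum>j\<in>Ic. \<gamma> j * v j - k * Sp * (\<gamma> j * \<delta> j))"
      unfolding b Sp_def[symmetric] by (intro sum.cong) (auto simp: algebra_simps)
    also have "\<dots> = Sm - k * Sp * \<Delta>" by (simp add: sum_subtractf sum_distrib_left[symmetric] Sm_def Dm)
    finally have "c i = v i - k * \<delta> i * Sp - k * (Sm - k * Sp * \<Delta>) * \<delta> i / (1 + k * \<Delta>)"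
      unfolding c Dm by (simp add: b Sp_def)
    also have "\<dots> = v i - k * \<delta> i * ((Sm + Sp) / (1 + k * \<Delta>))" using nzD by (simp add: field_simps)
    also have "Sm + Sp = S" unfolding S_def split Sm_def Sp_def ..
    finally show ?thesis by (simp add: x_def)
  qed
  have xp: "v i = x i" if "i \<in> Ip" for i using I(3) that by (simp add: x_def)
  have phi: "\<phi>p = (\<lambda>X. \<Sum>i<?N. x i * \<psi> i X)"
    unfolding \<phi>p split by (rule ext) (simp add: cx xp cong: sum.cong)
  have c0x: "c0 = k * (\<Sum>i<?N. x i * \<gamma> i)"
    unfolding c0 split by (simp add: cx xp cong: sum.cong)
  have sP: "shape_fn P i \<in> PiT ?N" for i by (rule shape_fn(1)[OF P])
  have phiP: "\<phi>p \<in> PiT ?N" unfolding phi \<psi>_def by (rule PiT_sum[OF sP])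
  have phiavg: "edge_mean \<phi>p P i = x i" if "i < ?N" for i
    unfolding phi \<psi>_def by (rule edge_mean_shape_sum[OF P that])
  have phid: "dderiv \<phi>p F w = (\<Sum>i<?N. x i * \<gamma> i)"
    unfolding phi \<gamma>_def \<psi>_def by (rule dderiv_sum[OF _ sP]) simp
  have G: "(\<Sum>i<?N. x i * \<gamma> i) = S / (1 + k * \<Delta>)"
  proof -
    have "(\<Sum>i<?N. x i * \<gamma> i) = (\<Sum>i<?N. \<gamma> i * v i - k * (S / (1 + k * \<Delta>)) * (\<gamma> i * \<delta> i))"
      by (intro sum.cong) (auto simp: x_def algebra_simps)
    also have "\<dots> = S - k * (S / (1 + k * \<Delta>)) * \<Delta>"
      by (simp only: sum_subtractf sum_distrib_left[symmetric] S_def[symmetric] \<Delta>_def[symmetric])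
    also have "\<dots> = S / (1 + k * \<Delta>)" using nzD by (simp add: field_simps)
    finally show ?thesis .
  qed
  have N: "?N = 3 \<or> ?N = 4" using P unfolding is_triangle_def is_rectangle_def by (auto simp: rect_vertices_def)
  have aff: "(\<lambda>X. r * ?L X) \<in> PiT ?N" for r by (rule PiT_scale[OF PiT_affine])
  have jump: "dderiv (\<lambda>X. f X + r * ?L X) F w = dderiv f F w + r * (n \<bullet> w)" if "f \<in> PiT ?N" for f r
    unfolding dderiv_add[OF that aff] dderiv_scale[OF PiT_affine] dderiv_affine ..
  \<comment> \<open>k is made for this identity: k (n . w) is \<beta>^+ / \<beta>^- - 1, which turns
    (J2) into r = k times the derivative of f along w.\<close>
  have kn: "\<beta>m * (k * (n \<bullet> w)) = \<beta>p - \<beta>m" using n(3) beta by (simp add: k field_simps)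
  have J2: "\<beta>m * dderiv (\<lambda>X. f X + r * ?L X) F w = \<beta>p * dderiv f F w \<longleftrightarrow> r = k * dderiv f F w"
    if "f \<in> PiT ?N" for f r
  proof -
    have "\<beta>m * dderiv (\<lambda>X. f X + r * ?L X) F w = \<beta>p * dderiv f F w \<longleftrightarrow>
       \<beta>m * (n \<bullet> w) * r = (\<beta>m * (k * (n \<bullet> w))) * dderiv f F w"
      unfolding jump[OF that] kn by (auto simp: algebra_simps)
    also have "\<dots> \<longleftrightarrow> (\<beta>m * (n \<bullet> w)) * r = (\<beta>m * (n \<bullet> w)) * (k * dderiv f F w)" by (simp add: mult_ac)
    also have "\<dots> \<longleftrightarrow> r = k * dderiv f F w" using n(3) beta by (auto simp del: mult_cancel_left1) 
    finally show ?thesis .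
  qed
  show "cond f g \<longleftrightarrow> f = \<phi>p \<and> g = (\<lambda>X. \<phi>p X + c0 * ?L X)"
  proof
    assume cf: "cond f g"
    then have f: "f \<in> PiT ?N" and g: "g \<in> PiT ?N" and J: "\<And>X. X \<in> closed_segment D E \<Longrightarrow> g X = f X"
      "?N = 4 \<Longrightarrow> d2x g 0 = d2x f 0" and j2: "\<beta>m * dderiv g F w = \<beta>p * dderiv f F w"
      and av: "\<And>i. i < ?N \<Longrightarrow> edge_mean (ife_fun Tpm f g) P i = v i"
      unfolding cond is_IFE_def by auto
    obtain r where r: "g = (\<lambda>X. f X + r * ?L X)"
      using affine_of_coupling[OF N f g DE n(1,2) J(1) J(1) J(2)] by auto
    have rk: "r = k * dderiv f F w" using j2 J2[OF f, of r] unfolding r by blast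
    have fe: "f = (\<lambda>X. \<Sum>i<?N. edge_mean f P i * \<psi> i X)"
      unfolding \<psi>_def by (rule PiT_shape_expansion[OF P f])
    have fd: "dderiv f F w = (\<Sum>i<?N. edge_mean f P i * \<gamma> i)"
      unfolding \<gamma>_def \<psi>_def by (subst fe, unfold \<psi>_def, rule dderiv_sum[OF _ sP]) simp
    have eq: "edge_mean f P i = v i - r * \<delta> i" if "i < ?N" for i
      using avg[rule_format, OF that f, of r] av[OF that] unfolding r by simp
    have "dderiv f F w = (\<Sum>i<?N. \<gamma> i * v i - r * (\<gamma> i * \<delta> i))"
      unfolding fd by (intro sum.cong) (auto simp: eq algebra_simps)
    also have "\<dots> = S - r * \<Delta>" by (simp add: sum_subtractf sum_distrib_left[symmetric] S_def \<Delta>_def)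
    \<comment> \<open>The scalar unknown of the rank-one system: the derivative at F is determined
      before any single edge mean.\<close>
    finally have "dderiv f F w * (1 + k * \<Delta>) = S" unfolding rk by (simp add: algebra_simps)
    then have fS: "dderiv f F w = S / (1 + k * \<Delta>)" using nzD by (simp add: field_simps)
    have "edge_mean f P i = edge_mean \<phi>p P i" if "i < ?N" for i
      unfolding eq[OF that] phiavg[OF that] x_def rk fS by simp
    then have fp: "f = \<phi>p" by (rule PiT_eqI[OF P f phiP])
    moreover have "r = c0" unfolding rk fS c0x G ..
    ultimately show "f = \<phi>p \<and> g = (\<lambda>X. \<phi>p X + c0 * ?L X)" using r by simp
  next
    assume "f = \<phi>p \<and> g = (\<lambda>X. \<phi>p X + c0 * ?L X)"
    then have f: "f = \<phi>p" and g: "g = (\<lambda>X. \<phi>p X + c0 * ?L X)" by auto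
    have gP: "g \<in> PiT ?N" unfolding g by (rule PiT_add[OF phiP aff])
    have seg: "g X = f X" if X: "X \<in> closed_segment D E" for X
    proof -
      obtain u where "X = (1 - u) *\<^sub>R D + u *\<^sub>R E" using X unfolding in_segment by blast
      then have "X - D = u *\<^sub>R (E - D)" by (simp add: algebra_simps)
      then show ?thesis using n(2) by (simp add: f g)
    qed
    have d2: "d2x g X = d2x f X" for X
    proof -
      obtain p q r s where p: "\<phi>p = pol p q r s" using phiP unfolding PiT_iff by blast
      have "g = pol (p + c0 * (- (n \<bullet> D))) (q + c0 * n$1) (r + c0 * n$2) s"
        unfolding g p affine_pol pol_scale pol_add by simp
      then show ?thesis unfolding f p by (simp add: d2x_pol)
    qed
    have "\<beta>m * dderiv g F w = \<beta>p * dderiv f F w"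
      unfolding g f by (rule iffD2[OF J2[OF phiP]]) (simp add: c0x phid)
    moreover have "edge_mean (ife_fun Tpm f g) P i = v i" if "i < ?N" for i
    proof -
      have "edge_mean (ife_fun Tpm f g) P i = x i + c0 * \<delta> i"
        unfolding f g avg[rule_format, OF that phiP] phiavg[OF that] ..
      moreover have "c0 = k * (S / (1 + k * \<Delta>))" unfolding c0x G ..
      ultimately show ?thesis by (simp add: x_def)
    qed
    ultimately show "cond f g" unfolding cond is_IFE_def using phiP gP seg d2 by (simp add: f)
  qed
qed

subsection \<open>Assembling the immersed finite element functions\<close>

text \<open>Where l = 0 both sides vanish, so the flags have to describe A only off the
  line.\<close>

lemma sided_integrand:
  assumes "l > 0 \<Longrightarrow> (X \<in> A \<longleftrightarrow> s1)" "l < 0 \<Longrightarrow> (X \<in> A \<longleftrightarrow> s2)"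
  shows "(if X \<in> A then l else 0) = of_bool s1 * max 0 l + of_bool s2 * (l - max 0 (l::real))"
  using assms by (cases "l = 0") (auto simp: max_def)

text \<open>The flags select max(0, L), min(0, L), all of L, or nothing; the last two cover boundary
  pieces that lie on a common side of \<Gamma>.\<close>

definition sided_avg :: "bool \<Rightarrow> bool \<Rightarrow> real \<Rightarrow> real \<Rightarrow> real" where
  "sided_avg s1 s2 a b = of_bool s1 * pos_avg a b + of_bool s2 * ((a + b) / 2 - pos_avg a b)"

lemma sided_integral:
  fixes n P Q D :: pt
  assumes s: "\<And>X. X \<in> closed_segment P Q \<Longrightarrow> n \<bullet> (X - D) > 0 \<Longrightarrow> X \<in> A \<longleftrightarrow> s1"
    "\<And>X. X \<in> closed_segment P Q \<Longrightarrow> n \<bullet> (X - D) < 0 \<Longrightarrow> X \<in> A \<longleftrightarrow> s2"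
  shows "((\<lambda>t. if P + t *\<^sub>R (Q - P) \<in> A then n \<bullet> (P + t *\<^sub>R (Q - P) - D) else 0)
     has_integral sided_avg s1 s2 (n \<bullet> (P - D)) (n \<bullet> (Q - D))) {0..1}"
proof -
  define a b where "a = n \<bullet> (P - D)" and "b = n \<bullet> (Q - D)"
  have l: "n \<bullet> (P + t *\<^sub>R (Q - P) - D) = a + t * (b - a)" for t
    by (simp add: a_def b_def inner_diff_right inner_add_right algebra_simps)
  have pos: "((\<lambda>t. max 0 (a + t * (b - a))) has_integral pos_avg a b) {0..1}"
    unfolding pos_avg_def by (intro integrable_integral integrable_continuous_interval continuous_intros)
  have lin: "((\<lambda>t. a + t * (b - a)) has_integral (a + b) / 2) {0..1}"
  proof -
    have "(\<lambda>t. n \<bullet> (P + t *\<^sub>R (Q - P) - D)) integrable_on {0..1}"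
      by (rule PiT_integrable[OF PiT_affine])
    then have "((\<lambda>t. n \<bullet> (P + t *\<^sub>R (Q - P) - D)) has_integral edge_avg (\<lambda>X. n \<bullet> (X - D)) P Q) {0..1}"
      unfolding edge_avg_def by (rule integrable_integral)
    then show ?thesis unfolding edge_avg_affine l a_def b_def .
  qed
  have "((\<lambda>t. of_bool s1 * max 0 (a + t * (b - a)) + of_bool s2 * (a + t * (b - a) - max 0 (a + t * (b - a))))
     has_integral sided_avg s1 s2 a b) {0..1}"
    unfolding sided_avg_def by (intro has_integral_add has_integral_mult_right has_integral_diff pos lin)
  then show ?thesis unfolding a_def[symmetric] b_def[symmetric] l
  proof (rule has_integral_eq[rotated])
    fix t :: real assume t: "t \<in> {0..1}"
    have "P + t *\<^sub>R (Q - P) \<in> closed_segment P Q"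
      unfolding in_segment using t by (intro exI[of _ t]) (auto simp: algebra_simps)
    from sided_integrand[OF s[OF this]]
    show "of_bool s1 * max 0 (a + t * (b - a)) + of_bool s2 * (a + t * (b - a) - max 0 (a + t * (b - a)))
      = (if P + t *\<^sub>R (Q - P) \<in> A then a + t * (b - a) else 0)" unfolding l by simp
  qed
qed

lemma edge_part_avg_sided:
  fixes n P Q D :: pt
  assumes "\<And>X. X \<in> closed_segment P Q \<Longrightarrow> n \<bullet> (X - D) > 0 \<Longrightarrow> X \<in> A \<longleftrightarrow> s1"
    "\<And>X. X \<in> closed_segment P Q \<Longrightarrow> n \<bullet> (X - D) < 0 \<Longrightarrow> X \<in> A \<longleftrightarrow> s2"
  shows "edge_part_avg A (\<lambda>X. n \<bullet> (X - D)) P Q = sided_avg s1 s2 (n \<bullet> (P - D)) (n \<bullet> (Q - D))"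
proof -
  let ?S = "{t \<in> {0..1}. P + t *\<^sub>R (Q - P) \<in> A}"
  have "edge_part_avg A (\<lambda>X. n \<bullet> (X - D)) P Q = integral {0..1} (\<lambda>t. if t \<in> ?S then n \<bullet> (P + t *\<^sub>R (Q - P) - D) else 0)"
    unfolding edge_part_avg_def Henstock_Kurzweil_Integration.integral_restrict_Int
    by (rule arg_cong2[where f = integral]) auto
  also have "\<dots> = integral {0..1} (\<lambda>t. if P + t *\<^sub>R (Q - P) \<in> A then n \<bullet> (P + t *\<^sub>R (Q - P) - D) else 0)"
    by (rule Henstock_Kurzweil_Integration.integral_cong) simp
  also have "\<dots> = sided_avg s1 s2 (n \<bullet> (P - D)) (n \<bullet> (Q - D))"
    by (rule integral_unique[OF sided_integral[OF assms]])
  finally show ?thesis .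
qed

text \<open>The jump term contributes c times a mean determined by the flags alone. With equal flags
  this is the number that \<open>edge_part_avg\<close> assigns to T^-, whichever variant
  \<open>U\<close> comes from.\<close>

lemma edge_avg_ife_fun:
  fixes n P Q D :: pt
  assumes f: "f \<in> PiT N"
    and s: "\<And>X. X \<in> closed_segment P Q \<Longrightarrow> n \<bullet> (X - D) > 0 \<Longrightarrow> X \<in> closure U \<longleftrightarrow> s1"
    "\<And>X. X \<in> closed_segment P Q \<Longrightarrow> n \<bullet> (X - D) < 0 \<Longrightarrow> X \<in> closure U \<longleftrightarrow> s2"
  shows "edge_avg (ife_fun U f (\<lambda>X. f X + c * (n \<bullet> (X - D)))) P Q
     = edge_avg f P Q + c * sided_avg s1 s2 (n \<bullet> (P - D)) (n \<bullet> (Q - D))"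
proof -
  have "((\<lambda>t. f (P + t *\<^sub>R (Q - P)) + c * (if P + t *\<^sub>R (Q - P) \<in> closure U then n \<bullet> (P + t *\<^sub>R (Q - P) - D) else 0))
     has_integral edge_avg f P Q + c * sided_avg s1 s2 (n \<bullet> (P - D)) (n \<bullet> (Q - D))) {0..1}"
    unfolding edge_avg_def
    by (intro has_integral_add has_integral_mult_right sided_integral[OF s] integrable_integral PiT_integrable[OF f])
  moreover have "(\<lambda>t. f (P + t *\<^sub>R (Q - P)) + c * (if P + t *\<^sub>R (Q - P) \<in> closure U then n \<bullet> (P + t *\<^sub>R (Q - P) - D) else 0))
    = (\<lambda>t. ife_fun U f (\<lambda>X. f X + c * (n \<bullet> (X - D))) (P + t *\<^sub>R (Q - P)))"
    by (auto simp: ife_fun_def fun_eq_iff)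
  ultimately show ?thesis unfolding edge_avg_def[of "ife_fun U f _"] by (simp add: integral_unique)
qed

text \<open>The sum is the derivative of the interpolant of the selected part of L, and
  interpolation reproduces L itself, whose derivative along w is n . w.\<close>

lemma sided_gradient:
  assumes P: "mesh_cell P"
  shows "(\<Sum>i<length P. dderiv (shape_fn P i) F w * sided_avg s1 s2 (n \<bullet> (vtx P i - D)) (n \<bullet> (vtx P (Suc i) - D)))
    = of_bool s1 * dderiv (pos_interp P n D) F w + of_bool s2 * (n \<bullet> w - dderiv (pos_interp P n D) F w)"
proof -
  let ?N = "length P"
  let ?\<gamma> = "\<lambda>i. dderiv (shape_fn P i) F w"
  let ?p = "\<lambda>i. pos_avg (n \<bullet> (vtx P i - D)) (n \<bullet> (vtx P (Suc i) - D))"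
  let ?a = "\<lambda>i. (n \<bullet> (vtx P i - D) + n \<bullet> (vtx P (Suc i) - D)) / 2"
  have 1: "dderiv (pos_interp P n D) F w = (\<Sum>i<?N. ?p i * ?\<gamma> i)"
    unfolding pos_interp_def by (rule dderiv_sum[OF _ shape_fn(1)[OF P]]) simp
  have "(\<lambda>X. n \<bullet> (X - D)) = (\<lambda>X. \<Sum>i<?N. ?a i * shape_fn P i X)"
    using PiT_shape_expansion[OF P PiT_affine, of n D] unfolding edge_avg_affine .
  then have "n \<bullet> w = dderiv (\<lambda>X. \<Sum>i<?N. ?a i * shape_fn P i X) F w"
    using dderiv_affine[of n D F w] by simp
  also have "\<dots> = (\<Sum>i<?N. ?a i * ?\<gamma> i)" by (rule dderiv_sum[OF _ shape_fn(1)[OF P]]) simp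
  finally have 2: "n \<bullet> w = (\<Sum>i<?N. ?a i * ?\<gamma> i)" .
  show ?thesis unfolding 1 2 sided_avg_def
    by (cases s1; cases s2) (auto simp: sum_subtractf[symmetric] sum.distrib[symmetric] algebra_simps intro!: sum.cong)
qed

section \<open>Mesh elements, smallness of h and the final assembly\<close>

lemma mesh_element:
  assumes mesh: "cartesian_mesh tri \<Omega> h \<T>" and PT: "P \<in> \<T>"
  shows "mesh_cell P" "elem P \<subseteq> closure \<Omega>"
    "\<And>i. i < length P \<Longrightarrow> dist (vtx P i) (vtx P (Suc i)) \<le> h"
proof -
  obtain xg yg m n S dg where x: "strict_mono_on {..m} xg" and y: "strict_mono_on {..n::nat} yg"
    and S: "S \<subseteq> {..<m::nat} \<times> {..<n}"
    and cl: "closure \<Omega> = (\<Union>(i,j)\<in>S. cbox (pt2 (xg i) (yg j)) (pt2 (xg (Suc i)) (yg (Suc j))))"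
    and T: "\<T> = (if tri then (\<Union>(i,j)\<in>S. tri_elems xg yg (dg i j) i j) else (\<lambda>(i,j). rect_elem xg yg i j) ` S)"
    using mesh unfolding cartesian_mesh_def by blast
  show "\<And>i. i < length P \<Longrightarrow> dist (vtx P i) (vtx P (Suc i)) \<le> h"
    using mesh PT unfolding cartesian_mesh_def by blast
  have "\<exists>i j. (i, j) \<in> S \<and> (if tri then P \<in> tri_elems xg yg (dg i j) i j else P = rect_elem xg yg i j)"
    using PT unfolding T by (auto split: if_splits)
  then obtain i j where ij: "(i, j) \<in> S" and P: "if tri then P \<in> tri_elems xg yg (dg i j) i j else P = rect_elem xg yg i j"
    by blast
  define x0 x1 y0 y1 where xy: "x0 = xg i" "x1 = xg (Suc i)" "y0 = yg j" "y1 = yg (Suc j)"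
  have "i < m" "j < n" using ij S by auto
  then have lt: "x0 < x1" "y0 < y1"
    unfolding xy using strict_mono_onD[OF x, of i "Suc i"] strict_mono_onD[OF y, of j "Suc j"] by auto
  have box: "cbox (pt2 x0 y0) (pt2 x1 y1) \<subseteq> closure \<Omega>" using ij unfolding cl xy by blast
  have rect: "rect_elem xg yg i j = rect_vertices x0 x1 y0 y1" by (simp add: rect_elem_def rect_vertices_def xy)
  have tri: "tri_elems xg yg d i j \<subseteq> {[pt2 x0 y0, pt2 x1 y0, pt2 x1 y1], [pt2 x0 y0, pt2 x1 y1, pt2 x0 y1],
     [pt2 x0 y0, pt2 x1 y0, pt2 x0 y1], [pt2 x1 y0, pt2 x1 y1, pt2 x0 y1]}" for d
    by (auto simp: tri_elems_def Let_def xy)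
  have A: "(x1 - x0) * (y1 - y0) \<noteq> 0" using lt by simp
  have istri: "is_triangle Q" if "Q \<in> tri_elems xg yg d i j" for Q d
    using subsetD[OF tri that] A unfolding is_triangle_def cr_def by (auto simp: algebra_simps)
  show "mesh_cell P"
    using P istri lt unfolding is_rectangle_def rect by (auto split: if_splits)
  have "set P \<subseteq> set (rect_vertices x0 x1 y0 y1)"
    using P subsetD[OF tri] unfolding rect by (cases tri) (force simp: rect_vertices_def)+
  then have "elem P \<subseteq> elem (rect_vertices x0 x1 y0 y1)" unfolding elem_def by (rule hull_mono)
  then show "elem P \<subseteq> closure \<Omega>" using box lt by (simp add: elem_rect)
qed

text \<open>The expression is affine in \<theta> with values 1 at 0 and r at 1; leaving [0, 1] by
  \<epsilon> costs at most \<epsilon> |r - 1|.\<close>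

lemma interpolated_jump_pos:
  fixes r \<epsilon> \<theta> :: real
  assumes "r > 0" "0 \<le> \<epsilon>" "\<epsilon> * \<bar>r - 1\<bar> < min 1 r" "- \<epsilon> \<le> \<theta>" "\<theta> \<le> 1 + \<epsilon>"
  shows "1 + (r - 1) * \<theta> > 0"
proof (cases "r \<ge> 1")
  case True
  then have "(r - 1) * (- \<epsilon>) \<le> (r - 1) * \<theta>" using assms by (intro mult_left_mono) auto
  then show ?thesis using assms(3) True by (simp add: algebra_simps min_def split: if_splits)
next
  case False
  then have "(r - 1) * (1 + \<epsilon>) \<le> (r - 1) * \<theta>" using assms by (intro mult_left_mono_neg) auto
  then show ?thesis using assms(3) False by (simp add: algebra_simps min_def split: if_splits)
qed

text \<open>Smallness of h acts through the diameter of \<Gamma> \<inter> T, which has to fit into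
  two narrow cones. Division by n . w makes the triangle case exact, since the gradient there is
  \<theta> n.\<close>

lemma gradient_ratio_bounds:
  assumes g: "piecewise_C2_path g" "simple_path g" and eps: "0 < \<epsilon>"
  shows "\<exists>h0>0. \<forall>P h D E n F w. mesh_cell P \<longrightarrow> h < h0 \<longrightarrow>
     (\<forall>i<length P. dist (vtx P i) (vtx P (Suc i)) \<le> h) \<longrightarrow>
     path_image g \<inter> frontier (elem P) = {D, E} \<longrightarrow> D \<noteq> E \<longrightarrow> norm n = 1 \<longrightarrow> n \<bullet> (E - D) = 0 \<longrightarrow>
     (F \<in> path_image g \<inter> elem P \<and> F \<noteq> D \<and> F \<noteq> E \<and> unit_normal_at (path_image g \<inter> elem P) F w \<and> n \<bullet> w > 0
       \<or> F \<in> closed_segment D E \<and> w = n) \<longrightarrow>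
     - \<epsilon> \<le> dderiv (pos_interp P n D) F w / (n \<bullet> w) \<and> dderiv (pos_interp P n D) F w / (n \<bullet> w) \<le> 1 + \<epsilon>"
proof -
  \<comment> \<open>Cones of width \<mu> give tangents that are parallel up to 4 \<mu>, and the
    gradient estimate loses 200 times that, hence 800. The bound 1/16 ensures 4 \<mu> \<le>
    1/4.\<close>
  define \<mu> where "\<mu> = min (\<epsilon> / 800) (1 / 16)"
  have mu: "0 < \<mu>" "200 * (4 * \<mu>) \<le> \<epsilon>" "4 * \<mu> \<le> 1 / 4" using eps by (auto simp: \<mu>_def)
  obtain \<delta> where d: "0 < \<delta>" "\<And>A. A \<subseteq> path_image g \<Longrightarrow> diameter A < \<delta> \<Longrightarrow> two_cones \<mu> A"
    using small_arcs_two_cones[OF g mu(1)] by blast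
  have "- \<epsilon> \<le> dderiv (pos_interp P n D) F w / (n \<bullet> w) \<and> dderiv (pos_interp P n D) F w / (n \<bullet> w) \<le> 1 + \<epsilon>"
    if P: "mesh_cell P" and h: "h < \<delta> / 2" and e: "\<forall>i<length P. dist (vtx P i) (vtx P (Suc i)) \<le> h"
    and fr: "path_image g \<inter> frontier (elem P) = {D, E}" and n: "D \<noteq> E" "norm n = 1" "n \<bullet> (E - D) = 0"
    and F: "F \<in> path_image g \<inter> elem P \<and> F \<noteq> D \<and> F \<noteq> E \<and> unit_normal_at (path_image g \<inter> elem P) F w \<and> n \<bullet> w > 0
       \<or> F \<in> closed_segment D E \<and> w = n" for P h D E n F w
  proof -
    have nw: "n \<bullet> w > 0" using F n(2) by (auto simp: norm_eq_1)
    have DE: "D \<in> frontier (elem P)" "E \<in> frontier (elem P)" "D \<in> path_image g" "E \<in> path_image g" using fr by blast+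
    then have DEe: "D \<in> elem P" "E \<in> elem P" using closed_elem by (auto simp: frontier_def)
    show ?thesis using P
    proof
      assume "is_triangle P"
      then obtain \<theta> where "0 \<le> \<theta>" "\<theta> \<le> 1" "\<forall>F v. dderiv (pos_interp P n D) F v = \<theta> * (n \<bullet> v)"
        using triangle_gradient by blast
      then show ?thesis using nw eps by auto
    next
      assume "is_rectangle P"
      then obtain x0 x1 y0 y1 where Pr: "P = rect_vertices x0 x1 y0 y1" and xy: "x0 < x1" "y0 < y1"
        unfolding is_rectangle_def by auto
      have T: "elem P = {X. x0 \<le> X$1 \<and> X$1 \<le> x1 \<and> y0 \<le> X$2 \<and> X$2 \<le> y1}"
        using xy by (auto simp: Pr elem_rect mem_box_cart forall_2)
      from F show ?thesis
      proof
        assume L: "F \<in> closed_segment D E \<and> w = n"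
        have FT: "F \<in> elem P" using L closed_segment_subset[OF DEe convex_elem] by blast
        obtain u where "F = (1 - u) *\<^sub>R D + u *\<^sub>R E" using L unfolding in_segment by blast
        then have "F - D = u *\<^sub>R (E - D)" by (simp add: algebra_simps)
        then have Fn: "n \<bullet> (F - D) = 0" using n(3) by simp
        have Db: "x0 \<le> D$1" "D$1 \<le> x1" "y0 \<le> D$2" "D$2 \<le> y1" using DEe(1) unfolding T by auto
        have "0 \<le> dderiv (pos_interp P n D) F n \<and> dderiv (pos_interp P n D) F n \<le> 1"
          by (rule rect_gradient[OF xy n(2) Db, folded Pr]) (use FT Fn T in blast)
        then show ?thesis using L n(2) eps by (auto simp: norm_eq_1)
      next
        assume C: "F \<in> path_image g \<inter> elem P \<and> F \<noteq> D \<and> F \<noteq> E \<and> unit_normal_at (path_image g \<inter> elem P) F w \<and> n \<bullet> w > 0"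
        then obtain \<gamma> \<gamma>1 a b s where c: "C2_reg_param \<gamma> \<gamma>1 a b" "inj_on \<gamma> {a..b}" "\<gamma> ` {a..b} = path_image g \<inter> elem P"
          "s \<in> {a..b}" "\<gamma> s = F" "w \<bullet> \<gamma>1 s = 0" and w1: "norm w = 1"
          unfolding unit_normal_at_def by blast
        have "0 < length P" "Suc 0 < length P" by (simp_all add: Pr)
        then have "dist (pt2 x0 y0) (pt2 x1 y0) \<le> h" "dist (pt2 x1 y0) (pt2 x1 y1) \<le> h"
          using e[rule_format, of 0] e[rule_format, of "Suc 0"] by (simp_all add: Pr vtx_def rect_vertices_def)
        then have WH: "x1 - x0 \<le> h" "y1 - y0 \<le> h"
          using component_le_norm_cart[of "pt2 x0 y0 - pt2 x1 y0" 1] component_le_norm_cart[of "pt2 x1 y0 - pt2 x1 y1" 2]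
          unfolding dist_norm by auto
        \<comment> \<open>Both sides of the rectangle are at most h, so the l1 norm bounds the
          diameter by 2 h; this is why the threshold is half of \<delta>.\<close>
        have "diameter (path_image g \<inter> elem P) \<le> 2 * h"
        proof (rule diameter_le)
          show "path_image g \<inter> elem P \<noteq> {} \<or> 0 \<le> 2 * h" using C by blast
          fix X Y assume "X \<in> path_image g \<inter> elem P" "Y \<in> path_image g \<inter> elem P"
          then have "\<bar>(X - Y)$1\<bar> \<le> h" "\<bar>(X - Y)$2\<bar> \<le> h" using WH unfolding T by auto
          moreover have "norm (X - Y) \<le> \<bar>(X - Y)$1\<bar> + \<bar>(X - Y)$2\<bar>"
            using norm_le_l1_cart[of "X - Y"] by (simp add: sum_2)
          ultimately show "norm (X - Y) \<le> 2 * h" by linarith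
        qed
        then have tc: "two_cones \<mu> (\<gamma> ` {a..b})" unfolding c(3) using h by (intro d(2)) auto
        have par: "\<bar>cr (\<gamma>1 s) (\<gamma>1 t)\<bar> \<le> (4 * \<mu>) * norm (\<gamma>1 s) * norm (\<gamma>1 t)" if "s \<in> {a..b}" "t \<in> {a..b}" for s t
          by (rule tangents_nearly_parallel[OF c(1,2) tc _ that]) (use mu in simp)
        obtain sD sE where sDE: "sD \<in> {a..b}" "\<gamma> sD = D" "sE \<in> {a..b}" "\<gamma> sE = E"
          using c(3) DE DEe by (metis IntI imageE)
        have sub: "\<gamma> ` {a..b} \<subseteq> elem P" using c(3) by blast
        have "0 \<le> 4 * \<mu>" using mu(1) by simp
        note b = rect_curve_gradient[OF xy n(2,3,1) c(1) sub[unfolded Pr] par this mu(3) DE(1)[unfolded Pr] sDE(1,2)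
            DE(2)[unfolded Pr] sDE(3,4) c(4,5) _ _ w1 c(6) nw, folded Pr]
        then show ?thesis using C mu(2) by (meson order_trans neg_le_iff_le add_left_mono)
      qed
    qed
  qed
  moreover have "0 < \<delta> / 2" using d(1) by simp
  ultimately show ?thesis by blast
qed

theorem mainTheorem5:
  fixes \<Omega> \<Omega>p \<Omega>m \<Gamma> :: "pt set" and \<beta>p \<beta>m :: real
  assumes "interface_setting \<Omega> \<Omega>p \<Omega>m \<Gamma>" and "\<beta>p > 0" and "\<beta>m > 0"
  shows "\<exists>h0>0. \<forall>tri \<T> h P D E nb F vF Tpm (v :: nat \<Rightarrow> real).
     cartesian_mesh tri \<Omega> h \<T> \<and> h < h0 \<and> mesh_hyps \<Gamma> \<T> \<and> P \<in> \<T> \<and>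
     interior (elem P) \<inter> \<Gamma> \<noteq> {} \<and> \<Gamma> \<inter> frontier (elem P) = {D, E} \<and> D \<noteq> E \<and>
     norm nb = 1 \<and> nb \<bullet> (E - D) = 0 \<and>
     ((F \<in> \<Gamma> \<inter> elem P \<and> F \<noteq> D \<and> F \<noteq> E \<and> unit_normal_at (\<Gamma> \<inter> elem P) F vF \<and>
         nb \<bullet> vF > 0 \<and> Tpm = elem P \<inter> \<Omega>m)
      \<or> (F \<in> closed_segment D E \<and> vF = nb \<and> Tpm = line_piece (elem P) (elem P \<inter> \<Omega>m) D nb))
   \<longrightarrow>
    (let T = elem P; Tp = T \<inter> \<Omega>p; Tm = T \<inter> \<Omega>m; N = length P;
         Ip = Iside P Tp; Imb = Iside P Tm \<union> Iint P Tp Tm; Ipb = Iside P Tp \<union> Iint P Tp Tm;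
         \<psi> = shape_fn P; L = (\<lambda>X. nb \<bullet> (X - D)); \<rho> = \<beta>m / \<beta>p;
         k = (1 / \<rho> - 1) / (nb \<bullet> vF);
         \<gamma> = (\<lambda>i. dderiv (\<psi> i) F vF);
         \<delta> = (\<lambda>i. edge_part_avg (closure Tm) L (vtx P i) (vtx P (Suc i)));
         b = (\<lambda>i. v i - k * \<delta> i * (\<Sum>j\<in>Ip. \<gamma> j * v j));
         c = (\<lambda>i. b i - k * (\<Sum>j\<in>Imb. \<gamma> j * b j) * \<delta> i / (1 + k * (\<Sum>j\<in>Imb. \<gamma> j * \<delta> j)));
         c0 = k * ((\<Sum>i\<in>Imb. c i * \<gamma> i) + (\<Sum>i\<in>Ip. v i * \<gamma> i));
         \<phi>p = (\<lambda>X. (\<Sum>i\<in>Imb. c i * \<psi> i X) + (\<Sum>i\<in>Ip. v i * \<psi> i X));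
         \<phi>m = (\<lambda>X. \<phi>p X + c0 * L X);
         cond = (\<lambda>f g. is_IFE P D E F vF \<beta>p \<beta>m f g \<and>
                   (\<forall>i<N. edge_avg (ife_fun Tpm f g) (vtx P i) (vtx P (Suc i)) = v i))
     in (\<exists>!(f, g). cond f g) \<and>
        (card Imb \<le> card Ipb \<longrightarrow>
           1 + k * (\<Sum>j\<in>Imb. \<gamma> j * \<delta> j) \<noteq> 0 \<and> cond \<phi>p \<phi>m))"
proof -
  obtain g where g: "simple_path g" "path_image g = \<Gamma>" "piecewise_C2_path g"
    using assms(1) unfolding interface_setting_def by blast
  have op: "open \<Omega>p" "open \<Omega>m" "\<Omega>p \<inter> \<Omega>m = {}" and un: "\<Omega> - \<Gamma> = \<Omega>p \<union> \<Omega>m" and Oi: "interior (closure \<Omega>) = \<Omega>"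
    using assms(1) unfolding interface_setting_def by blast+
  have clG: "closed \<Gamma>" using g by (metis closed_simple_path_image)
  define r where "r = \<beta>p / \<beta>m"
  have r: "0 < r" using assms by (simp add: r_def)
  \<comment> \<open>With m > |r - 1| the product \<epsilon> |r - 1| stays below min(1, r); the added
    1 keeps m positive when r = 1.\<close>
  define m where "m = 2 * (\<bar>r - 1\<bar> + 1)"
  define \<epsilon> where "\<epsilon> = min 1 r / m"
  have "0 < \<bar>r - 1\<bar> + 1" by (rule add_nonneg_pos) auto
  then have m: "0 < m" "\<bar>r - 1\<bar> < m" by (auto simp: m_def)
  have eps: "0 < \<epsilon>" using r m by (simp add: \<epsilon>_def)
  have "\<epsilon> * m = min 1 r" using m by (simp add: \<epsilon>_def)
  then have epsr: "\<epsilon> * \<bar>r - 1\<bar> < min 1 r" using mult_strict_left_mono[OF m(2) eps] by simp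
  obtain h0 where h0: "0 < h0" and ratio: "\<And>P h D E n F w. mesh_cell P \<Longrightarrow> h < h0 \<Longrightarrow>
     \<forall>i<length P. dist (vtx P i) (vtx P (Suc i)) \<le> h \<Longrightarrow>
     \<Gamma> \<inter> frontier (elem P) = {D, E} \<Longrightarrow> D \<noteq> E \<Longrightarrow> norm n = 1 \<Longrightarrow> n \<bullet> (E - D) = 0 \<Longrightarrow>
     F \<in> \<Gamma> \<inter> elem P \<and> F \<noteq> D \<and> F \<noteq> E \<and> unit_normal_at (\<Gamma> \<inter> elem P) F w \<and> n \<bullet> w > 0
       \<or> F \<in> closed_segment D E \<and> w = n \<Longrightarrow>
     - \<epsilon> \<le> dderiv (pos_interp P n D) F w / (n \<bullet> w) \<and> dderiv (pos_interp P n D) F w / (n \<bullet> w) \<le> 1 + \<epsilon>"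
    using gradient_ratio_bounds[OF g(3,1) eps] unfolding g(2) by blast
  show ?thesis
  proof (intro exI[of _ h0] conjI h0 allI impI, goal_cases)
    case (1 tri \<T> h P D E nb F vF Tpm v)
    then have mesh: "cartesian_mesh tri \<Omega> h \<T>" "h < h0" "mesh_hyps \<Gamma> \<T>" "P \<in> \<T>"
      and int: "interior (elem P) \<inter> \<Gamma> \<noteq> {}" and fr: "\<Gamma> \<inter> frontier (elem P) = {D, E}" and DE: "D \<noteq> E"
      and n: "norm nb = 1" "nb \<bullet> (E - D) = 0"
      and F: "(F \<in> \<Gamma> \<inter> elem P \<and> F \<noteq> D \<and> F \<noteq> E \<and> unit_normal_at (\<Gamma> \<inter> elem P) F vF \<and>
         nb \<bullet> vF > 0 \<and> Tpm = elem P \<inter> \<Omega>m)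
      \<or> (F \<in> closed_segment D E \<and> vF = nb \<and> Tpm = line_piece (elem P) (elem P \<inter> \<Omega>m) D nb)"
      by blast+
    note P = mesh_element(1)[OF mesh(1,4)]
    have nv: "nb \<bullet> vF > 0" using F n(1) by (auto simp: norm_eq_1)
    have n0: "nb \<noteq> 0" using n(1) by auto
    have DEe: "D \<in> elem P" "E \<in> elem P" "D \<in> frontier (elem P)" "E \<in> frontier (elem P)"
      using fr closed_elem[of P] by (auto simp: frontier_def)
    have LE: "nb \<bullet> (E - D) = 0" "nb \<bullet> (D - D) = 0" using n by auto
    \<comment> \<open>This is (H2), with D and E as the two boundary points.\<close>
    have notedge: "\<not> {D, E} \<subseteq> edge P i" if "i < length P" for i
    proof -
      have "card (\<Gamma> \<inter> frontier (elem P)) = 2" unfolding fr using DE by simp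
      then show ?thesis using mesh(3,4) that unfolding mesh_hyps_def fr[symmetric] by blast
    qed
    have nonzero_edge: "nb \<bullet> (vtx P i - D) \<noteq> 0 \<or> nb \<bullet> (vtx P (Suc i) - D) \<noteq> 0" if "i < length P" for i
      using zero_line_in_edge[OF P n0 that _ _ DEe(1) LE(2)] zero_line_in_edge[OF P n0 that _ _ DEe(2) LE(1)] notedge[OF that]
      by blast
    \<comment> \<open>The mesh covers the closure of \<Omega>; since \<Omega> is the interior of its
      closure, interiors of elements lie in \<Omega> itself.\<close>
    have intO: "interior (elem P) \<subseteq> \<Omega>"
      using interior_mono[OF mesh_element(2)[OF mesh(1,4)]] Oi by simp
    define Tp Tm where "Tp = elem P \<inter> \<Omega>p" and "Tm = elem P \<inter> \<Omega>m"
    have compl: "X \<in> closure Tm \<longleftrightarrow> X \<notin> closure Tp" if "X \<in> frontier (elem P)" "nb \<bullet> (X - D) \<noteq> 0" for X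
    proof -
      have "X \<notin> {D, E}" using that(2) LE by auto
      then have "X \<notin> \<Gamma>" using that(1) fr by blast
      moreover have "X \<in> elem P" using that(1) closed_elem[of P] by (auto simp: frontier_def)
      ultimately show ?thesis
        unfolding Tm_def Tp_def using int
        by (intro closure_sides_complementary[OF op un clG convex_elem closed_elem _ intO]) auto
    qed
    have "\<exists>s1 s2. (\<forall>X\<in>frontier (elem P). nb \<bullet> (X - D) > 0 \<longrightarrow> (X \<in> closure Tm \<longleftrightarrow> s1)) \<and>
      (\<forall>X\<in>frontier (elem P). nb \<bullet> (X - D) < 0 \<longrightarrow> (X \<in> closure Tm \<longleftrightarrow> s2))"
      by (rule frontier_side_constant[OF P closed_closure closed_closure]) (rule compl)
    then obtain s1 s2 where s': "\<forall>X\<in>frontier (elem P). nb \<bullet> (X - D) > 0 \<longrightarrow> (X \<in> closure Tm \<longleftrightarrow> s1)"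
      "\<forall>X\<in>frontier (elem P). nb \<bullet> (X - D) < 0 \<longrightarrow> (X \<in> closure Tm \<longleftrightarrow> s2)"
      by (elim exE conjE) (rule that)
    have s: "X \<in> frontier (elem P) \<Longrightarrow> nb \<bullet> (X - D) > 0 \<Longrightarrow> X \<in> closure Tm \<longleftrightarrow> s1"
      "X \<in> frontier (elem P) \<Longrightarrow> nb \<bullet> (X - D) < 0 \<Longrightarrow> X \<in> closure Tm \<longleftrightarrow> s2" for X
      using s' by blast+
    \<comment> \<open>In both variants the closure of \<open>Tpm\<close> has the flags of the
      closure of T^-, so from here on the variants are treated together.\<close>
    have sT: "X \<in> frontier (elem P) \<Longrightarrow> nb \<bullet> (X - D) > 0 \<Longrightarrow> X \<in> closure Tpm \<longleftrightarrow> s1"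
      "X \<in> frontier (elem P) \<Longrightarrow> nb \<bullet> (X - D) < 0 \<Longrightarrow> X \<in> closure Tpm \<longleftrightarrow> s2" for X
      using F s[of X] line_piece_closure[OF closed_elem s, where X = X] unfolding Tm_def by auto
    have edge_fr: "X \<in> frontier (elem P)" if "i < length P" "X \<in> closed_segment (vtx P i) (vtx P (Suc i))" for i X
      using that unfolding frontier_elem[OF P] edge_def by auto
    define L where "L = (\<lambda>X. nb \<bullet> (X - D))"
    define \<delta> where "\<delta> = (\<lambda>i. edge_part_avg (closure Tm) L (vtx P i) (vtx P (Suc i)))"
    have \<delta>: "\<delta> i = sided_avg s1 s2 (nb \<bullet> (vtx P i - D)) (nb \<bullet> (vtx P (Suc i) - D))" if "i < length P" for i
      unfolding \<delta>_def L_def by (rule edge_part_avg_sided) (use s edge_fr[OF that] in auto)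
    have avg: "\<forall>i<length P. \<forall>f\<in>PiT (length P). \<forall>c.
      edge_mean (ife_fun Tpm f (\<lambda>X. f X + c * (nb \<bullet> (X - D)))) P i = edge_mean f P i + c * \<delta> i"
    proof (intro allI ballI impI)
      fix i f c assume i: "i < length P" and f: "f \<in> PiT (length P)"
      show "edge_mean (ife_fun Tpm f (\<lambda>X. f X + c * (nb \<bullet> (X - D)))) P i = edge_mean f P i + c * \<delta> i"
        unfolding \<delta>[OF i] by (rule edge_avg_ife_fun[OF f]) (use sT edge_fr[OF i] in auto)
    qed
    define k where "k = (1 / (\<beta>m / \<beta>p) - 1) / (nb \<bullet> vF)"
    define \<gamma> where "\<gamma> = (\<lambda>i. dderiv (shape_fn P i) F vF)"
    define \<theta> where "\<theta> = dderiv (pos_interp P nb D) F vF / (nb \<bullet> vF)"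
    have \<theta>: "- \<epsilon> \<le> \<theta>" "\<theta> \<le> 1 + \<epsilon>"
      using ratio[OF P mesh(2) _ fr DE n, of F vF] mesh_element(3)[OF mesh(1,4)] F unfolding \<theta>_def by auto
    have kr: "k = (r - 1) / (nb \<bullet> vF)" by (simp add: k_def r_def)
    \<comment> \<open>The flags turn \<theta> into \<theta>, 1 - \<theta>, 1 or 0, and each of these
      stays within \<epsilon> of [0, 1].\<close>
    have "(\<Sum>i<length P. \<gamma> i * \<delta> i) = of_bool s1 * (\<theta> * (nb \<bullet> vF)) + of_bool s2 * (nb \<bullet> vF - \<theta> * (nb \<bullet> vF))"
      using sided_gradient[OF P, of F vF s1 s2 nb D] nv by (simp add: \<delta> \<gamma>_def \<theta>_def)
    also have "\<dots> = (of_bool s1 * \<theta> + of_bool s2 * (1 - \<theta>)) * (nb \<bullet> vF)"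
      by (simp only: distrib_right left_diff_distrib right_diff_distrib mult.assoc mult_1)
    finally have "k * (\<Sum>i<length P. \<gamma> i * \<delta> i) = (r - 1) * (of_bool s1 * \<theta> + of_bool s2 * (1 - \<theta>))"
      using nv unfolding kr by simp
    moreover have "0 < 1 + (r - 1) * (of_bool s1 * \<theta> + of_bool s2 * (1 - \<theta>))"
      by (rule interpolated_jump_pos[OF r _ epsr]) (use \<theta> eps in auto)
    ultimately have nz: "1 + k * (\<Sum>i<length P. \<gamma> i * \<delta> i) \<noteq> 0" by linarith
    define Ip Imb where "Ip = Iside P Tp" and "Imb = Iside P Tm \<union> Iint P Tp Tm"
    \<comment> \<open>On an edge contained in both closures L would vanish at both end vertices,
      which (H2) has excluded.\<close>
    have "Iside P Tp \<inter> Iside P Tm = {}"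
    proof -
      have False if i: "i < length P" "edge P i \<subseteq> closure Tp" "edge P i \<subseteq> closure Tm" for i
      proof -
        have "vtx P i \<in> edge P i" "vtx P (Suc i) \<in> edge P i" by (auto simp: edge_def)
        then show False
          using nonzero_edge[OF i(1)] compl edge_fr[OF i(1)] i(2,3) unfolding edge_def by blast
      qed
      then show ?thesis unfolding Iside_def by blast
    qed
    then have I1: "Ip \<inter> Imb = {}" unfolding Ip_def Imb_def Iint_def by blast
    have I2: "Ip \<union> Imb = {..<length P}" unfolding Ip_def Imb_def Iint_def Iside_def by auto
    \<comment> \<open>An edge in the closure of T^+ meets the closure of T^- only where L = 0, so
      the integrand that defines \<delta> vanishes.\<close>
    have I3: "\<forall>i\<in>Ip. \<delta> i = 0"
    proof
      fix i assume "i \<in> Ip"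
      then have i: "i < length P" "edge P i \<subseteq> closure Tp" by (auto simp: Ip_def Iside_def)
      have z: "L X = 0" if "X \<in> closed_segment (vtx P i) (vtx P (Suc i))" "X \<in> closure Tm" for X
        using compl[OF edge_fr[OF i(1) that(1)]] that i(2) unfolding L_def edge_def by blast
      have "\<delta> i = integral {t \<in> {0..1}. vtx P i + t *\<^sub>R (vtx P (Suc i) - vtx P i) \<in> closure Tm} (\<lambda>t. 0)"
        unfolding \<delta>_def edge_part_avg_def
      proof (rule Henstock_Kurzweil_Integration.integral_cong)
        fix t :: real assume t: "t \<in> {t \<in> {0..1}. vtx P i + t *\<^sub>R (vtx P (Suc i) - vtx P i) \<in> closure Tm}"
        have "vtx P i + t *\<^sub>R (vtx P (Suc i) - vtx P i) \<in> closed_segment (vtx P i) (vtx P (Suc i))"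
          unfolding in_segment using t by (intro exI[of _ t]) (auto simp: algebra_simps)
        then show "L (vtx P i + t *\<^sub>R (vtx P (Suc i) - vtx P i)) = 0" using z t by blast
      qed
      then show "\<delta> i = 0" by simp
    qed
    define b where "b = (\<lambda>i. v i - k * \<delta> i * (\<Sum>j\<in>Ip. \<gamma> j * v j))"
    define c where "c = (\<lambda>i. b i - k * (\<Sum>j\<in>Imb. \<gamma> j * b j) * \<delta> i / (1 + k * (\<Sum>j\<in>Imb. \<gamma> j * \<delta> j)))"
    define c0 where "c0 = k * ((\<Sum>i\<in>Imb. c i * \<gamma> i) + (\<Sum>i\<in>Ip. v i * \<gamma> i))"
    define \<phi>p where "\<phi>p = (\<lambda>X. (\<Sum>i\<in>Imb. c i * shape_fn P i X) + (\<Sum>i\<in>Ip. v i * shape_fn P i X))"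
    define \<phi>m where "\<phi>m = (\<lambda>X. \<phi>p X + c0 * L X)"
    define cond where "cond = (\<lambda>f g. is_IFE P D E F vF \<beta>p \<beta>m f g \<and> (\<forall>i<length P. edge_mean (ife_fun Tpm f g) P i = v i))"
    note sys = ife_system[OF P DE n nv assms(2,3) avg k_def nz[unfolded \<gamma>_def] I1 I2 I3 b_def[unfolded \<gamma>_def]
        c_def[unfolded \<gamma>_def] c0_def[unfolded \<gamma>_def] \<phi>p_def cond_def]
    \<comment> \<open>One equivalence yields existence, uniqueness and the explicit form
      together.\<close>
    have uniq: "cond f g \<longleftrightarrow> f = \<phi>p \<and> g = \<phi>m" for f g
      using sys(2)[of f g] unfolding \<phi>m_def L_def .
    have "\<exists>!(f, g). cond f g" unfolding uniq by auto
    moreover have "1 + k * (\<Sum>j\<in>Imb. \<gamma> j * \<delta> j) \<noteq> 0" unfolding \<gamma>_def by (rule sys(1))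
    moreover have "cond \<phi>p \<phi>m" unfolding uniq by simp
    ultimately show ?case
      unfolding Let_def cond_def \<phi>m_def \<phi>p_def c0_def c_def b_def \<delta>_def \<gamma>_def k_def L_def Ip_def Imb_def Tp_def Tm_def
      by blast
  qed
qed

end
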